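(* Let $X$ be a Banach space with $\dim X<\infty$, let $p\in\{0\}\cup[1,\infty]$, and let $\mathbf{X}:=l^p(\mathbb{Z},X)$. If $A$ is a semi-Fredholm band-dominated operator on $\mathbf{X}$, then $A$ is Fredholm.
   Context: For a Banach space $X$ and $1\le p<\infty$, $l^p(\mathbb{Z},X)$ is the Banach space of all $x=(x_n)_{n\in\mathbb{Z}}$ with $x_n\in X$ and $\|x\|_p^p:=\sum_n\|x_n\|_X^p<\infty$; $l^\infty(\mathbb{Z},X)$ is the space of bounded sequences with norm $\|x\|_\infty:=\sup_n\|x_n\|_X$; and $l^0(\mathbb{Z},X)\subset l^\infty(\mathbb{Z},X)$ is the closed subspace (with the sup norm) of all sequences with $\|x_n\|_X\to0$ as $|n|\to\infty$. Let $\mathcal{L}(\mathbf{X})$ denote the Banach algebra of bounded linear operators on $\mathbf{X}$. Each $a=(a_n)\in l^\infty(\mathbb{Z},\mathcal{L}(X))$ defines a multiplication operator $aI:(x_n)\mapsto(a_nx_n)$ on $\mathbf{X}$, and for $k\in\mathbb{Z}$ the shift $V_k$ is $V_k(x_n):=(x_{n-k})$. A band operator is a finite sum $\sum_\alpha a_\alpha V_\alpha$ with $a_\alpha\in l^\infty(\mathbb{Z},\mathcal{L}(X))$. A band-dominated operator is an element of the closure, in the operator norm of $\mathcal{L}(\mathbf{X})$, of the set of all band operators. A bounded linear operator $A$ is normally solvable if its range is closed. $A$ is a $\Phi_+$-operator if it is normally solvable and $\dim\ker A<\infty$; $A$ is a $\Phi_-$-operator if it is normally solvable and $\dim\operatorname{coker}A<\infty$.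 $A$ is semi-Fredholm if $A\in\Phi_+\cup\Phi_-$, and Fredholm if $A\in\Phi:=\Phi_+\cap\Phi_-$. *)

theory Defs
  imports "HOL-Analysis.Analysis" "HOL-Library.Function_Algebras"
begin

text \<open>Functions carry the pointwise real vector space structure, so that \<^const>\<open>span\<close> applies to
  spaces of sequences and operators can be added and subtracted.\<close>

instantiation "fun" :: (type, real_vector) real_vector
begin

definition scaleR_fun :: "real \<Rightarrow> ('a \<Rightarrow> 'b) \<Rightarrow> 'a \<Rightarrow> 'b" where
  "scaleR_fun c f = (\<lambda>t. c *\<^sub>R f t)"

instance
  by standard (auto simp: scaleR_fun_def scaleR_add_right scaleR_add_left fun_eq_iff)

end

lemma scaleR_fun_apply [simp]: "(c *\<^sub>R f) t = c *\<^sub>R f t"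
  by (simp add: scaleR_fun_def)

text \<open>Banach spaces are taken over the reals (class \<^class>\<open>banach\<close>). This covers complex scalars by
  restriction: a complex-linear band-dominated operator is a real-linear one, its range is the
  same set, and finite-dimensionality over the two fields coincides.

  The exponent is an extended nonnegative real; following the convention for the symbol
  $l^0$, the value \<open>p = 0\<close> stands for the null sequences with the sup norm.\<close>

definition lp_space :: "ennreal \<Rightarrow> (int \<Rightarrow> 'a::real_normed_vector) set" where
  "lp_space p =
    (if p = 0 then {x. \<forall>e>0. \<exists>N. \<forall>n. \<bar>n\<bar> \<ge> N \<longrightarrow> norm (x n) < e}
     else if p = \<infinity> then {x. bounded (range x)}
     else {x. (\<lambda>n. norm (x n) powr enn2real p) summable_on UNIV})"

text \<open>Outside the space the norm is set to 0, because \<^const>\<open>Sup\<close> of an unbounded set of reals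
  is an arbitrary number.\<close>

definition lp_norm :: "ennreal \<Rightarrow> (int \<Rightarrow> 'a::real_normed_vector) \<Rightarrow> real" where
  "lp_norm p x =
    (if x \<notin> lp_space p then 0
     else if p = 0 \<or> p = \<infinity> then (SUP n. norm (x n))
     else (\<Sum>\<^sub>\<infinity>n. norm (x n) powr enn2real p) powr (1 / enn2real p))"

definition lp_dist :: "ennreal \<Rightarrow> (int \<Rightarrow> 'a::real_normed_vector) \<Rightarrow> (int \<Rightarrow> 'a) \<Rightarrow> real" where
  "lp_dist p x y = lp_norm p (x - y)"

definition lp_topology :: "ennreal \<Rightarrow> (int \<Rightarrow> 'a::real_normed_vector) topology" where
  "lp_topology p = Metric_space.mtopology (lp_space p) (lp_dist p)"

text \<open>An operator on $l^p$ is a function on all two-sided sequences of which only the values on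
  \<^term>\<open>lp_space p\<close> matter: every notion below restricts to that set.\<close>

definition lp_bounded_operator ::
  "ennreal \<Rightarrow> ((int \<Rightarrow> 'a::real_normed_vector) \<Rightarrow> (int \<Rightarrow> 'a)) \<Rightarrow> bool" where
  "lp_bounded_operator p A \<longleftrightarrow>
    A ` lp_space p \<subseteq> lp_space p \<and>
    (\<forall>x\<in>lp_space p. \<forall>y\<in>lp_space p. A (x + y) = A x + A y) \<and>
    (\<forall>c. \<forall>x\<in>lp_space p. A (c *\<^sub>R x) = c *\<^sub>R A x) \<and>
    (\<exists>C. \<forall>x\<in>lp_space p. lp_norm p (A x) \<le> C * lp_norm p x)"

definition lp_opnorm ::
  "ennreal \<Rightarrow> ((int \<Rightarrow> 'a::real_normed_vector) \<Rightarrow> (int \<Rightarrow> 'a)) \<Rightarrow> real" where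
  "lp_opnorm p A = (SUP x\<in>{x \<in> lp_space p. lp_norm p x \<le> 1}. lp_norm p (A x))"

definition mult_operator ::
  "(int \<Rightarrow> 'a::real_normed_vector \<Rightarrow>\<^sub>L 'a) \<Rightarrow> (int \<Rightarrow> 'a) \<Rightarrow> (int \<Rightarrow> 'a)" where
  "mult_operator a x = (\<lambda>n. blinfun_apply (a n) (x n))"

definition shift :: "int \<Rightarrow> (int \<Rightarrow> 'a) \<Rightarrow> (int \<Rightarrow> 'a)" where
  "shift k x = (\<lambda>n. x (n - k))"

definition band_operator :: "((int \<Rightarrow> 'a::real_normed_vector) \<Rightarrow> (int \<Rightarrow> 'a)) \<Rightarrow> bool" where
  "band_operator B \<longleftrightarrow>
    (\<exists>S a. finite S \<and> (\<forall>\<alpha>\<in>S. a \<alpha> \<in> lp_space \<infinity>) \<and>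
       B = (\<Sum>\<alpha>\<in>S. mult_operator (a \<alpha>) \<circ> shift \<alpha>))"

definition band_dominated ::
  "ennreal \<Rightarrow> ((int \<Rightarrow> 'a::real_normed_vector) \<Rightarrow> (int \<Rightarrow> 'a)) \<Rightarrow> bool" where
  "band_dominated p A \<longleftrightarrow>
    lp_bounded_operator p A \<and> (\<forall>e>0. \<exists>B. band_operator B \<and> lp_opnorm p (A - B) < e)"

text \<open>Finite dimension of a subspace, and of the quotient of a space \<open>V\<close> by a subspace \<open>R\<close>:
  the cosets of finitely many elements of \<open>V\<close> span the quotient. (The library function
  \<^const>\<open>dim\<close> returns 0 in infinite dimension and cannot express this.)\<close>

definition finite_dim :: "'a::real_vector set \<Rightarrow> bool" where
  "finite_dim V \<longleftrightarrow> (\<exists>B. finite B \<and> span B = V)"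

definition finite_dim_quotient :: "'a::real_vector set \<Rightarrow> 'a set \<Rightarrow> bool" where
  "finite_dim_quotient V R \<longleftrightarrow>
    (\<exists>B. finite B \<and> B \<subseteq> V \<and> (\<forall>v\<in>V. \<exists>b\<in>span B. v - b \<in> R))"

definition lp_kernel ::
  "ennreal \<Rightarrow> ((int \<Rightarrow> 'a::real_normed_vector) \<Rightarrow> (int \<Rightarrow> 'a)) \<Rightarrow> (int \<Rightarrow> 'a) set" where
  "lp_kernel p A = {x \<in> lp_space p. A x = 0}"

definition normally_solvable ::
  "ennreal \<Rightarrow> ((int \<Rightarrow> 'a::real_normed_vector) \<Rightarrow> (int \<Rightarrow> 'a)) \<Rightarrow> bool" where
  "normally_solvable p A \<longleftrightarrow>
    lp_bounded_operator p A \<and> closedin (lp_topology p) (A ` lp_space p)"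

definition Phi_plus ::
  "ennreal \<Rightarrow> ((int \<Rightarrow> 'a::real_normed_vector) \<Rightarrow> (int \<Rightarrow> 'a)) \<Rightarrow> bool" where
  "Phi_plus p A \<longleftrightarrow> normally_solvable p A \<and> finite_dim (lp_kernel p A)"

definition Phi_minus ::
  "ennreal \<Rightarrow> ((int \<Rightarrow> 'a::real_normed_vector) \<Rightarrow> (int \<Rightarrow> 'a)) \<Rightarrow> bool" where
  "Phi_minus p A \<longleftrightarrow>
    normally_solvable p A \<and> finite_dim_quotient (lp_space p) (A ` lp_space p)"

definition semi_Fredholm ::
  "ennreal \<Rightarrow> ((int \<Rightarrow> 'a::real_normed_vector) \<Rightarrow> (int \<Rightarrow> 'a)) \<Rightarrow> bool" where
  "semi_Fredholm p A \<longleftrightarrow> Phi_plus p A \<or> Phi_minus p A"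

definition Fredholm ::
  "ennreal \<Rightarrow> ((int \<Rightarrow> 'a::real_normed_vector) \<Rightarrow> (int \<Rightarrow> 'a)) \<Rightarrow> bool" where
  "Fredholm p A \<longleftrightarrow> Phi_plus p A \<and> Phi_minus p A"

text \<open>Two facts the definitions rely on: \<^const>\<open>lp_dist\<close> is a metric (so \<^const>\<open>lp_topology\<close>
  is the norm topology), and band operators are bounded on every $l^p$ (so \<^const>\<open>lp_opnorm\<close> in
  \<^const>\<open>band_dominated\<close> is a supremum of a bounded set).\<close>

lemma powr_convex_combination:
  fixes u v l p :: real
  assumes "0 \<le> u" "0 \<le> v" "0 \<le> l" "l \<le> 1" "1 \<le> p"
  shows "(l * u + (1 - l) * v) powr p \<le> l * u powr p + (1 - l) * v powr p"
proof -
  have shrink: "(m * w) powr p \<le> m * w powr p" if "0 \<le> m" "m \<le> 1" "0 \<le> w" for m w :: real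
  proof -
    have "m powr p \<le> m"
      using that assms(5) powr_mono'[of 1 p m] by (cases "m = 0") auto
    then show ?thesis
      using that by (simp add: powr_mult mult_right_mono)
  qed
  consider "u = 0" | "v = 0" | "u > 0" "v > 0"
    using assms by linarith
  then show ?thesis
  proof cases
    case 1
    then show ?thesis using shrink[of "1 - l" v] assms by simp
  next
    case 2
    then show ?thesis using shrink[of l u] assms by simp
  next
    case 3
    then show ?thesis
      using convex_onD[OF powr_convex[OF assms(5)], of "1 - l" u v] assms by (simp add: algebra_simps)
  qed
qed

lemma lp_exponent:
  assumes "p = 0 \<or> 1 \<le> p" "p \<noteq> 0" "p \<noteq> \<infinity>"
  shows "1 \<le> enn2real p"
  using assms by (metis enn2real_leI enn2real_mono enn2real_1 infinity_ennreal_def top.not_eq_extremum)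

lemma lp_space_0_iff:
  "x \<in> lp_space 0 \<longleftrightarrow> (\<forall>e>0. \<exists>N. \<forall>n. N \<le> \<bar>n\<bar> \<longrightarrow> norm (x n) < e)"
  by (simp add: lp_space_def)

lemma lp_space_0_subset: "x \<in> lp_space 0 \<Longrightarrow> bounded (range x)"
proof -
  assume "x \<in> lp_space 0"
  then obtain N where N: "\<And>n. \<bar>n\<bar> \<ge> N \<Longrightarrow> norm (x n) < 1"
    unfolding lp_space_def by (force dest!: spec[of _ "1::real"])
  have "bounded (x ` {-N..N} \<union> cball 0 1)" by (auto simp: finite_imp_bounded)
  moreover have "range x \<subseteq> x ` {-N..N} \<union> cball 0 1"
  proof clarify
    fix n assume "x n \<notin> cball 0 1"
    then have "\<not> \<bar>n\<bar> \<ge> N" using N[of n] by auto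
    then show "x n \<in> x ` {-N..N}" by (intro imageI) auto
  qed
  ultimately show ?thesis by (rule bounded_subset)
qed

lemma lp_space_zero: "0 \<in> lp_space p"
  by (auto simp: lp_space_def image_def)

lemma lp_space_scaleR: "x \<in> lp_space p \<Longrightarrow> c *\<^sub>R x \<in> lp_space p"
proof (cases "p = 0")
  case True
  assume x: "x \<in> lp_space p"
  show ?thesis
  proof (cases "c = 0")
    case False
    have "\<exists>N. \<forall>n. N \<le> \<bar>n\<bar> \<longrightarrow> \<bar>c\<bar> * norm (x n) < e" if "e > 0" for e
    proof -
      have "e / \<bar>c\<bar> > 0" using that False by simp
      then obtain N where "\<forall>n. N \<le> \<bar>n\<bar> \<longrightarrow> norm (x n) < e / \<bar>c\<bar>"
        using x True by (auto simp: lp_space_def)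
      then show ?thesis using False by (auto simp: field_simps)
    qed
    then show ?thesis using True by (simp add: lp_space_def)
  qed (auto simp: True lp_space_def)
next
  case False
  assume x: "x \<in> lp_space p"
  show ?thesis
  proof (cases "p = \<infinity>")
    case True
    then show ?thesis using x False bounded_scaling[of "range x" c]
      by (simp add: lp_space_def image_image scaleR_fun_def)
  next
    case F: False
    then show ?thesis using x False
      by (auto simp: lp_space_def powr_mult intro!: summable_on_cmult_right)
  qed
qed

lemma lp_space_add:
  assumes p: "p = 0 \<or> 1 \<le> p" and x: "x \<in> lp_space p" and y: "y \<in> lp_space p"
  shows "x + y \<in> lp_space p"
proof -
  consider "p = 0" | "p = \<infinity>" "p \<noteq> 0" | "p \<noteq> 0" "p \<noteq> \<infinity>" by blast
  then show ?thesis
  proof cases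
    case 1
    have "\<exists>N. \<forall>n. N \<le> \<bar>n\<bar> \<longrightarrow> norm (x n + y n) < e" if "e > 0" for e
    proof -
      have "e / 2 > 0" using that by simp
      then obtain N M where "\<forall>n. N \<le> \<bar>n\<bar> \<longrightarrow> norm (x n) < e / 2" "\<forall>n. M \<le> \<bar>n\<bar> \<longrightarrow> norm (y n) < e / 2"
        using x y unfolding 1 lp_space_0_iff by blast
      then have "\<forall>n. max N M \<le> \<bar>n\<bar> \<longrightarrow> norm (x n + y n) < e"
        by (metis max.bounded_iff field_sum_of_halves norm_triangle_lt add_strict_mono)
      then show ?thesis by blast
    qed
    then show ?thesis using 1 by (simp add: lp_space_def)
  next
    case 2
    then show ?thesis using x y bounded_plus_comp[of x UNIV y]
      by (simp add: lp_space_def plus_fun_def)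
  next
    case 3
    let ?q = "enn2real p"
    have q: "1 \<le> ?q" using lp_exponent[OF p 3] .
    have "(\<lambda>n. 1/2 * (2 powr ?q * norm (x n) powr ?q) + 1/2 * (2 powr ?q * norm (y n) powr ?q)) summable_on UNIV"
      using x y 3 by (intro summable_on_add summable_on_cmult_right) (auto simp: lp_space_def)
    moreover have "norm (x n + y n) powr ?q
        \<le> 1/2 * (2 powr ?q * norm (x n) powr ?q) + 1/2 * (2 powr ?q * norm (y n) powr ?q)" for n
    proof -
      have "norm (x n + y n) powr ?q \<le> (norm (x n) + norm (y n)) powr ?q"
        using q by (intro powr_mono2 norm_triangle_ineq) auto
      also have "\<dots> \<le> 1/2 * (2 * norm (x n)) powr ?q + 1/2 * (2 * norm (y n)) powr ?q"
        using powr_convex_combination[of "2 * norm (x n)" "2 * norm (y n)" "1/2" ?q] q by simp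
      finally show ?thesis by (simp add: powr_mult)
    qed
    ultimately have "(\<lambda>n. norm (x n + y n) powr ?q) summable_on UNIV"
      by (rule summable_on_comparison_test) auto
    then show ?thesis using 3 by (simp add: lp_space_def)
  qed
qed

lemma lp_norm_sup:
  assumes "p = 0 \<or> p = \<infinity>" "x \<in> lp_space p"
  shows "lp_norm p x = (SUP n. norm (x n))" and "bdd_above (range (\<lambda>n. norm (x n)))"
proof -
  show "lp_norm p x = (SUP n. norm (x n))" using assms by (simp add: lp_norm_def)
  have "bounded (range x)"
    using assms lp_space_0_subset[of x] by (auto simp: lp_space_def split: if_splits)
  then show "bdd_above (range (\<lambda>n. norm (x n)))"
    by (metis bdd_above_norm image_image)
qed

lemma lp_norm_nonneg: "0 \<le> lp_norm p x"
proof -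
  have "0 \<le> (SUP n. norm (x n))" if "p = 0 \<or> p = \<infinity>" "x \<in> lp_space p"
    using cSUP_upper[OF UNIV_I lp_norm_sup(2)[OF that], of 0] norm_ge_zero[of "x 0"] by linarith
  then show ?thesis by (auto simp: lp_norm_def)
qed

lemma lp_norm_eq_0:
  assumes p: "p = 0 \<or> 1 \<le> p" and x: "x \<in> lp_space p" and 0: "lp_norm p x = 0"
  shows "x = 0"
proof (cases "p = 0 \<or> p = \<infinity>")
  case True
  have "norm (x n) \<le> 0" for n
    using cSUP_upper[OF UNIV_I lp_norm_sup(2)[OF True x], of n] lp_norm_sup(1)[OF True x] 0 by linarith
  then show ?thesis by (auto simp: fun_eq_iff)
next
  case False
  then have s: "(\<lambda>n. norm (x n) powr enn2real p) summable_on UNIV" using x by (simp add: lp_space_def)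
  have "(\<Sum>\<^sub>\<infinity>n. norm (x n) powr enn2real p) = 0"
    using False x 0 by (simp add: lp_norm_def)
  then have "norm (x n) powr enn2real p = 0" for n
    using s by (intro nonneg_infsum_le_0D[of _ UNIV]) auto
  then show ?thesis by (auto simp: fun_eq_iff)
qed

lemma lp_norm_powr:
  assumes p: "p = 0 \<or> 1 \<le> p" and "p \<noteq> 0" "p \<noteq> \<infinity>" "x \<in> lp_space p"
  shows "(\<Sum>\<^sub>\<infinity>n. norm (x n) powr enn2real p) = lp_norm p x powr enn2real p"
  using assms lp_exponent[of p] by (simp add: lp_norm_def powr_powr infsum_nonneg)

lemma lp_norm_minus_commute: "lp_norm p (x - y) = lp_norm p (y - x)"
proof -
  have "x - y \<in> lp_space p \<longleftrightarrow> y - x \<in> lp_space p"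
    using lp_space_scaleR[of "x - y" p "-1"] lp_space_scaleR[of "y - x" p "-1"] by auto
  then show ?thesis by (simp add: lp_norm_def norm_minus_commute)
qed

lemma lp_norm_triangle:
  assumes p: "p = 0 \<or> 1 \<le> p" and x: "x \<in> lp_space p" and y: "y \<in> lp_space p"
  shows "lp_norm p (x + y) \<le> lp_norm p x + lp_norm p y"
proof (cases "p = 0 \<or> p = \<infinity>")
  case True
  have "norm (x n + y n) \<le> lp_norm p x + lp_norm p y" for n
    using cSUP_upper[OF UNIV_I lp_norm_sup(2)[OF True x], of n]
      cSUP_upper[OF UNIV_I lp_norm_sup(2)[OF True y], of n] norm_triangle_ineq[of "x n" "y n"]
    by (simp add: lp_norm_sup(1)[OF True x] lp_norm_sup(1)[OF True y])
  then show ?thesis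
    using lp_norm_sup(1)[OF True lp_space_add[OF p x y]] by (auto intro: cSUP_least)
next
  case False
  let ?q = "enn2real p" and ?a = "lp_norm p x" and ?b = "lp_norm p y"
  have q: "1 \<le> ?q" using lp_exponent[OF p] False by blast
  have xy: "x + y \<in> lp_space p" using lp_space_add[OF p x y] .
  consider "?a = 0" | "?b = 0" | "?a > 0" "?b > 0"
    using lp_norm_nonneg[of p x] lp_norm_nonneg[of p y] by linarith
  then show ?thesis
  proof cases
    case 1
    then show ?thesis using lp_norm_eq_0[OF p x] by simp
  next
    case 2
    then show ?thesis using lp_norm_eq_0[OF p y] by simp
  next
    case 3
    let ?l = "?a / (?a + ?b)"
    have sx: "(\<lambda>n. norm (x n) powr ?q) summable_on UNIV"
      and sy: "(\<lambda>n. norm (y n) powr ?q) summable_on UNIV"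
      and sxy: "(\<lambda>n. norm (x n + y n) powr ?q) summable_on UNIV"
      using x y xy False by (auto simp: lp_space_def)
    have l: "0 \<le> ?l" "?l \<le> 1" "1 - ?l = ?b / (?a + ?b)" using 3 by (auto simp: field_simps)
    have pt: "norm (x n + y n) powr ?q \<le> (?a + ?b) powr ?q *
      (?l / ?a powr ?q * norm (x n) powr ?q + (1 - ?l) / ?b powr ?q * norm (y n) powr ?q)" for n
    proof -
      have e: "norm (x n) + norm (y n) =
          (?a + ?b) * (?l * (norm (x n) / ?a) + (1 - ?l) * (norm (y n) / ?b))"
      proof -
        have "?l * (norm (x n) / ?a) = norm (x n) / (?a + ?b)"
          "(1 - ?l) * (norm (y n) / ?b) = norm (y n) / (?a + ?b)"
          unfolding l(3) using 3 by simp_all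
        then show ?thesis using 3 by (simp add: add_divide_distrib[symmetric])
      qed
      have "norm (x n + y n) powr ?q \<le> (norm (x n) + norm (y n)) powr ?q"
        using q by (intro powr_mono2 norm_triangle_ineq) auto
      also have "\<dots> = (?a + ?b) powr ?q * (?l * (norm (x n) / ?a) + (1 - ?l) * (norm (y n) / ?b)) powr ?q"
        using 3 l by (subst e) (simp add: powr_mult)
      also have "\<dots> \<le> (?a + ?b) powr ?q *
          (?l * (norm (x n) / ?a) powr ?q + (1 - ?l) * (norm (y n) / ?b) powr ?q)"
        using 3 l q by (intro mult_left_mono powr_convex_combination) auto
      finally show ?thesis using 3 by (simp add: powr_divide)
    qed
    have "lp_norm p (x + y) powr ?q = (\<Sum>\<^sub>\<infinity>n. norm (x n + y n) powr ?q)"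
      using lp_norm_powr[OF p _ _ xy] False by simp
    also have "\<dots> \<le> (\<Sum>\<^sub>\<infinity>n. (?a + ?b) powr ?q *
      (?l / ?a powr ?q * norm (x n) powr ?q + (1 - ?l) / ?b powr ?q * norm (y n) powr ?q))"
      by (intro infsum_mono sxy summable_on_cmult_right summable_on_add sx sy pt)
    also have "\<dots> = (?a + ?b) powr ?q *
      (?l / ?a powr ?q * ?a powr ?q + (1 - ?l) / ?b powr ?q * ?b powr ?q)"
      using lp_norm_powr[OF p _ _ x] lp_norm_powr[OF p _ _ y] False
      by (simp only: infsum_cmult_right' infsum_add[OF summable_on_cmult_right[OF sx] summable_on_cmult_right[OF sy]]) simp
    also have "\<dots> = (?a + ?b) powr ?q" using 3 by simp
    finally have le: "lp_norm p (x + y) powr ?q \<le> (?a + ?b) powr ?q" .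
    show ?thesis
    proof (rule ccontr)
      assume "\<not> ?thesis"
      then have "(?a + ?b) powr ?q < lp_norm p (x + y) powr ?q"
        using 3 q by (intro powr_less_mono2) auto
      then show False using le by simp
    qed
  qed
qed

lemma lp_space_diff:
  assumes "p = 0 \<or> 1 \<le> p" "x \<in> lp_space p" "y \<in> lp_space p"
  shows "x - y \<in> lp_space p"
  using lp_space_add[OF assms(1,2) lp_space_scaleR[OF assms(3), of "-1"]] by simp

lemma Metric_space_lp:
  assumes p: "p = 0 \<or> 1 \<le> p"
  shows "Metric_space (lp_space p) (lp_dist p :: (int \<Rightarrow> 'a::real_normed_vector) \<Rightarrow> _)"
proof
  fix x y z :: "int \<Rightarrow> 'a"
  show "0 \<le> lp_dist p x y" by (simp add: lp_dist_def lp_norm_nonneg)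
  show "lp_dist p x y = lp_dist p y x" by (simp add: lp_dist_def lp_norm_minus_commute)
  assume x: "x \<in> lp_space p" and y: "y \<in> lp_space p"
  have "lp_norm p (0 :: int \<Rightarrow> 'a) = 0" by (simp add: lp_norm_def)
  then show "lp_dist p x y = 0 \<longleftrightarrow> x = y"
    using lp_norm_eq_0[OF p lp_space_diff[OF p x y]] by (auto simp: lp_dist_def)
  assume z: "z \<in> lp_space p"
  show "lp_dist p x z \<le> lp_dist p x y + lp_dist p y z"
    using lp_norm_triangle[OF p lp_space_diff[OF p x y] lp_space_diff[OF p y z]]
    by (simp add: lp_dist_def)
qed

lemma lp_space_infinity_bound:
  assumes "a \<in> lp_space \<infinity>"
  obtains C where "0 \<le> C" "\<And>n. norm (a n) \<le> C"
proof -
  obtain C where "\<And>n. norm (a n) \<le> C" using assms by (auto simp: lp_space_def bounded_iff)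
  then show thesis using that[of C] norm_ge_zero[of "a 0"] by (meson order_trans)
qed

lemma lp_dominated:
  assumes p: "p = 0 \<or> 1 \<le> p" and x: "x \<in> lp_space p" and C: "0 \<le> C"
    and le: "\<And>n. norm (y n) \<le> C * norm (x n)"
  shows "y \<in> lp_space p" and "lp_norm p y \<le> C * lp_norm p x"
proof -
  consider "p = 0 \<or> p = \<infinity>" | "p \<noteq> 0" "p \<noteq> \<infinity>" by blast
  then have "y \<in> lp_space p \<and> lp_norm p y \<le> C * lp_norm p x"
  proof cases
    case 1
    have Cx: "C *\<^sub>R x \<in> lp_space p" using lp_space_scaleR[OF x] .
    have le': "norm (y n) \<le> norm ((C *\<^sub>R x) n)" for n using le[of n] C by simp
    have y: "y \<in> lp_space p"
    proof (cases "p = 0")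
      case True
      then show ?thesis using Cx order_le_less_trans[OF le'] unfolding True lp_space_0_iff by meson
    next
      case False
      then have "p = \<infinity>" using 1 by blast
      then show ?thesis using Cx order_trans[OF le'] unfolding lp_space_def
        by (auto simp: bounded_iff)
    qed
    have "norm (y n) \<le> C * lp_norm p x" for n
      using cSUP_upper[OF UNIV_I lp_norm_sup(2)[OF 1 x], of n] le[of n] C
      by (metis lp_norm_sup(1)[OF 1 x] mult_left_mono order_trans)
    then show ?thesis using y lp_norm_sup(1)[OF 1 y] by (auto intro: cSUP_least)
  next
    case 2
    let ?q = "enn2real p"
    have q: "1 \<le> ?q" using lp_exponent[OF p 2] .
    have s: "(\<lambda>n. C powr ?q * norm (x n) powr ?q) summable_on UNIV"
      using x 2 by (intro summable_on_cmult_right) (auto simp: lp_space_def)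
    have le': "norm (y n) powr ?q \<le> C powr ?q * norm (x n) powr ?q" for n
      using powr_mono2[OF _ _ le[of n], of ?q] q C by (simp add: powr_mult)
    have sy: "(\<lambda>n. norm (y n) powr ?q) summable_on UNIV"
      by (rule summable_on_comparison_test[OF s]) (use le' in auto)
    then have y: "y \<in> lp_space p" using 2 by (simp add: lp_space_def)
    have "lp_norm p y powr ?q \<le> (C * lp_norm p x) powr ?q"
      using infsum_mono[OF sy s le'] lp_norm_powr[OF p 2 x] lp_norm_powr[OF p 2 y] C
      by (simp add: infsum_cmult_right' powr_mult lp_norm_nonneg)
    then have "lp_norm p y \<le> C * lp_norm p x"
      using powr_less_mono2[of ?q "C * lp_norm p x" "lp_norm p y"] q C lp_norm_nonneg[of p x]
      by (meson leD less_le_trans mult_nonneg_nonneg not_less zero_less_one)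
    with y show ?thesis by blast
  qed
  then show "y \<in> lp_space p" "lp_norm p y \<le> C * lp_norm p x" by blast+
qed

lemma lp_shift:
  assumes x: "x \<in> lp_space p"
  shows "shift k x \<in> lp_space p" and "lp_norm p (shift k x) = lp_norm p x"
proof -
  have bij: "bij_betw (\<lambda>n. n - k) UNIV (UNIV :: int set)"
    by (rule bij_betwI[of _ _ _ "\<lambda>n. n + k"]) auto
  have sur: "range (\<lambda>n. f (n - k)) = range f" for f :: "int \<Rightarrow> 'b"
    using bij by (metis bij_betw_imp_surj_on image_image)
  show s: "shift k x \<in> lp_space p"
  proof (cases "p = 0")
    case True
    show ?thesis unfolding True lp_space_def
    proof (simp, intro allI impI)
      fix e :: real assume "e > 0"
      then obtain N where "\<forall>n. N \<le> \<bar>n\<bar> \<longrightarrow> norm (x n) < e"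
        using x True by (auto simp: lp_space_def)
      then have "\<forall>n. N + \<bar>k\<bar> \<le> \<bar>n\<bar> \<longrightarrow> norm (shift k x n) < e" by (auto simp: shift_def)
      then show "\<exists>N. \<forall>n. N \<le> \<bar>n\<bar> \<longrightarrow> norm (shift k x n) < e" by blast
    qed
  next
    case False
    then show ?thesis using x summable_on_reindex_bij_betw[OF bij, of "\<lambda>n. norm (x n) powr enn2real p"]
      by (auto simp: lp_space_def shift_def sur)
  qed
  show "lp_norm p (shift k x) = lp_norm p x"
    using s x infsum_reindex_bij_betw[OF bij, of "\<lambda>n. norm (x n) powr enn2real p"]
      sur[of "\<lambda>n. norm (x n)"]
    by (auto simp: lp_norm_def shift_def)
qed

lemma lp_bounded_operator_band:
  assumes p: "p = 0 \<or> 1 \<le> p" and B: "band_operator B"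
  shows "lp_bounded_operator p B"
proof -
  obtain S a where S: "finite S" "\<forall>\<alpha>\<in>S. a \<alpha> \<in> lp_space \<infinity>"
    and B: "B = (\<Sum>\<alpha>\<in>S. mult_operator (a \<alpha>) \<circ> shift \<alpha>)"
    using B by (auto simp: band_operator_def)
  show ?thesis
    using S unfolding B
  proof (induction S rule: finite_induct)
    case empty
    show ?case
      by (auto simp: lp_bounded_operator_def lp_space_zero[unfolded zero_fun_def] zero_fun_def fun_eq_iff lp_norm_def intro!: exI[of _ 0])
  next
    case (insert \<alpha> S)
    let ?T = "mult_operator (a \<alpha>) \<circ> shift \<alpha>" and ?R = "\<Sum>\<alpha>\<in>S. mult_operator (a \<alpha>) \<circ> shift \<alpha>"
    have R: "lp_bounded_operator p ?R" using insert.IH insert.prems by blast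
    then obtain D where D: "\<And>x. x \<in> lp_space p \<Longrightarrow> lp_norm p (?R x) \<le> D * lp_norm p x"
      unfolding lp_bounded_operator_def by blast
    obtain C where C: "0 \<le> C" "\<And>n. norm (a \<alpha> n) \<le> C"
      using insert.prems lp_space_infinity_bound by (metis insertI1)
    have n: "norm (?T x n) \<le> C * norm (shift \<alpha> x n)" for x n
      using norm_blinfun[of "a \<alpha> n" "shift \<alpha> x n"] mult_right_mono[OF C(2)[of n] norm_ge_zero[of "shift \<alpha> x n"]]
      by (simp add: mult_operator_def)
    have T: "?T x \<in> lp_space p" "lp_norm p (?T x) \<le> C * lp_norm p x" if "x \<in> lp_space p" for x
      using lp_dominated[OF p lp_shift(1)[OF that] C(1) n] lp_shift(2)[OF that] by auto
    have Rin: "?R x \<in> lp_space p" if "x \<in> lp_space p" for x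
      using R that by (auto simp: lp_bounded_operator_def)
    have bound: "lp_norm p (?T x + ?R x) \<le> (C + D) * lp_norm p x" if "x \<in> lp_space p" for x
      using lp_norm_triangle[OF p T(1)[OF that] Rin[OF that]] T(2)[OF that] D[OF that]
      by (simp add: distrib_right)
    have "\<exists>E. \<forall>x\<in>lp_space p. lp_norm p (?T x + ?R x) \<le> E * lp_norm p x"
      using bound by blast
    moreover have "?T x + ?R x \<in> lp_space p" if "x \<in> lp_space p" for x
      using lp_space_add[OF p T(1)[OF that] Rin[OF that]] .
    moreover have "?T (x + y) = ?T x + ?T y" "?T (c *\<^sub>R x) = c *\<^sub>R ?T x" for x y c
      by (auto simp: mult_operator_def shift_def fun_eq_iff blinfun.add_right blinfun.scaleR_right)
    moreover have "?R (x + y) = ?R x + ?R y" "?R (c *\<^sub>R x) = c *\<^sub>R ?R x"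
      if "x \<in> lp_space p" "y \<in> lp_space p" for x y c
      using R that by (auto simp: lp_bounded_operator_def)
    ultimately have "lp_bounded_operator p (?T + ?R)"
      unfolding lp_bounded_operator_def
      by (auto simp del: comp_apply simp: scaleR_add_right algebra_simps)
    then show ?case by (simp only: sum.insert[OF insert.hyps])
  qed
qed

end

theory Submission
  imports Defs "HOL-Library.Diagonal_Subsequence"
begin

text \<open>
  Why a semi-Fredholm band-dominated operator is Fredholm. Let \<open>d = dim X\<close>.

  For a band operator \<open>B\<close> of width \<open>w\<close> this is a count of dimensions in finite windows. The sequences
  supported in \<open>[-n, n]\<close> form a space of dimension \<open>(2 n + 1) d\<close>, and \<open>B\<close> maps it into the sequences
  supported in \<open>[-n - w, n + w]\<close>, a space with only \<open>2 w d\<close> dimensions more. Hence a bound on the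
  kernel of \<open>B\<close> bounds the number of dimensions that \<open>B\<close> misses in a window, independently of \<open>n\<close>, and
  a compactness argument for \<open>n \<rightarrow> \<infinity>\<close> turns this into a bound on the codimension of the range
  (\<open>band_codim_range\<close>). Conversely, if \<open>B\<close> is onto up to finitely many dimensions, its rank in
  each window is nearly full, so few dimensions are left for the kernel (\<open>band_dim_preimage\<close>).

  A band-dominated operator \<open>A\<close> is close to a band operator \<open>B\<close>, but the width of \<open>B\<close>, and with it the
  bound obtained for \<open>B\<close>, depends on how close \<open>B\<close> has to be. Passing from \<open>B\<close> back to \<open>A\<close> is
  therefore the stability of the index. The distance is first fixed by a constant of \<open>A\<close> alone, in
  such a way that all operators on the segment from \<open>B\<close> to \<open>A\<close> satisfy the same quantitative
  estimate: a lower bound on a subspace of finite codimension when \<open>A\<close> is \<open>\<Phi>\<^sub>+\<close>, solvability with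
  control of the norm modulo a fixed finite-dimensional space when \<open>A\<close> is \<open>\<Phi>\<^sub>-\<close>. Only then is the bound
  \<open>n\<close> for \<open>B\<close> known, and the segment is cut into steps so small, in terms of \<open>n\<close> and the estimate, that
  the property "less than \<open>n\<close> dimensions" survives each of them (\<open>codim_range_stable\<close>,
  \<open>dim_preimage_stable\<close>). A single step rests on Riesz's lemma: \<open>n\<close> vectors that are independent
  modulo a closed subspace can be replaced by unit vectors that are independent with a constant
  depending on \<open>n\<close> only (\<open>almost_orthogonal_family\<close>), so they cannot become dependent under a small
  perturbation.

  The estimates themselves come from the open mapping theorem for an operator with closed range.
\<close>

section \<open>Counting dimensions modulo a subspace\<close>

lemma underdetermined_system:
  fixes f :: "'i \<Rightarrow> 'j \<Rightarrow> real"
  assumes "finite J" "finite I" "card J < card I"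
  shows "\<exists>c. (\<exists>i\<in>I. c i \<noteq> 0) \<and> (\<forall>j\<in>J. (\<Sum>i\<in>I. c i * f i j) = 0)"
  using assms
proof (induction J arbitrary: I f rule: finite_induct)
  case empty
  then obtain i where "i \<in> I" by fastforce
  then show ?case by (intro exI[of _ "\<lambda>_. 1"]) auto
next
  case (insert j J)
  show ?case
  proof (cases "\<forall>i\<in>I. f i j = 0")
    case True
    have "card J < card I" using insert by simp
    then obtain c where "\<exists>i\<in>I. c i \<noteq> 0" "\<forall>j\<in>J. (\<Sum>i\<in>I. c i * f i j) = 0"
      using insert.IH[of I f] insert.prems by blast
    then show ?thesis using True by (intro exI[of _ c]) simp
  next
    case False
    then obtain i0 where i0: "i0 \<in> I" "f i0 j \<noteq> 0" by blast
    let ?I = "I - {i0}"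
    define g where "g i k = f i k - f i j / f i0 j * f i0 k" for i k
    have "card J < card ?I" using insert i0 by simp
    then obtain c where c: "\<exists>i\<in>?I. c i \<noteq> 0" "\<forall>k\<in>J. (\<Sum>i\<in>?I. c i * g i k) = 0"
      using insert.IH[of ?I g] insert.prems by blast
    define c' where "c' i = (if i = i0 then - (\<Sum>i\<in>?I. c i * f i j) / f i0 j else c i)" for i
    have split: "(\<Sum>i\<in>I. c' i * f i k) = c' i0 * f i0 k + (\<Sum>i\<in>?I. c i * f i k)" for k
      using insert.prems i0 by (subst sum.remove[of I i0]) (auto simp: c'_def intro!: sum.cong)
    have "(\<Sum>i\<in>I. c' i * f i k) = (\<Sum>i\<in>?I. c i * g i k)" for k
      unfolding split g_def
      by (simp add: c'_def algebra_simps sum_subtractf sum_distrib_left sum_distrib_right sum_divide_distrib)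
    then have "\<forall>k\<in>J. (\<Sum>i\<in>I. c' i * f i k) = 0" using c by simp
    moreover have "(\<Sum>i\<in>I. c' i * f i j) = 0" unfolding split using i0 by (simp add: c'_def)
    moreover have "\<exists>i\<in>I. c' i \<noteq> 0" using c by (auto simp: c'_def)
    ultimately show ?thesis by blast
  qed
qed

text \<open>The inequality \<open>dim (U / R) < n\<close>, expressed by vectors of \<open>U\<close> without forming the quotient; for
  \<open>R = {0}\<close> it bounds the dimension of \<open>U\<close>. A bound that can be written for a fixed \<open>n\<close> is what is
  transported along a path of operators.\<close>

definition codim_below :: "'v::real_vector set \<Rightarrow> 'v set \<Rightarrow> nat \<Rightarrow> bool" where
  "codim_below U R n \<longleftrightarrow>
    (\<forall>v. (\<forall>j<n. v j \<in> U) \<longrightarrow> (\<exists>c. (\<exists>j<n. c j \<noteq> 0) \<and> (\<Sum>j<n. c j *\<^sub>R v j) \<in> R))"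

lemma codim_belowD:
  assumes "codim_below U R n" "\<And>j. j < n \<Longrightarrow> v j \<in> U"
  obtains c where "\<exists>j<n. c j \<noteq> 0" "(\<Sum>j<n. c j *\<^sub>R v j) \<in> R"
  using assms unfolding codim_below_def by meson

lemma codim_below_mono:
  assumes "codim_below U R n" "U' \<subseteq> U" "R \<subseteq> R'"
  shows "codim_below U' R' n"
  unfolding codim_below_def
proof (intro allI impI)
  fix v :: "nat \<Rightarrow> 'a" assume "\<forall>j<n. v j \<in> U'"
  then have "\<And>j. j < n \<Longrightarrow> v j \<in> U" using assms by blast
  from codim_belowD[OF assms(1), of v, OF this] obtain c
    where "\<exists>j<n. c j \<noteq> 0" "(\<Sum>j<n. c j *\<^sub>R v j) \<in> R" by blast
  then show "\<exists>c. (\<exists>j<n. c j \<noteq> 0) \<and> (\<Sum>j<n. c j *\<^sub>R v j) \<in> R'"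
    using assms(3) by blast
qed

lemma codim_below_spanned:
  assumes R: "subspace R" and "m < n"
    and span: "\<And>z. z \<in> U \<Longrightarrow> \<exists>c. z - (\<Sum>j<m. c j *\<^sub>R u j) \<in> R"
  shows "codim_below U R n"
  unfolding codim_below_def
proof (intro allI impI)
  fix v assume v: "\<forall>j<n. v j \<in> U"
  then have "\<forall>i\<in>{..<n}. \<exists>c. v i - (\<Sum>j<m. c j *\<^sub>R u j) \<in> R" using span by blast
  then obtain f where f: "\<And>i. i < n \<Longrightarrow> v i - (\<Sum>j<m. f i j *\<^sub>R u j) \<in> R"
    by (metis lessThan_iff)
  obtain c where c: "\<exists>i\<in>{..<n}. c i \<noteq> 0" "\<forall>j\<in>{..<m}. (\<Sum>i<n. c i * f i j) = 0"
    using underdetermined_system[of "{..<m}" "{..<n}" f] assms(2) by auto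
  have "(\<Sum>i<n. c i *\<^sub>R (\<Sum>j<m. f i j *\<^sub>R u j)) = (\<Sum>j<m. (\<Sum>i<n. c i * f i j) *\<^sub>R u j)"
    by (simp add: scaleR_sum_right scaleR_sum_left) (rule sum.swap)
  also have "\<dots> = 0" using c(2) by simp
  finally have "(\<Sum>i<n. c i *\<^sub>R v i) = (\<Sum>i<n. c i *\<^sub>R (v i - (\<Sum>j<m. f i j *\<^sub>R u j)))"
    by (simp add: scaleR_diff_right sum_subtractf)
  also have "\<dots> \<in> R" using f by (intro subspace_sum[OF R] subspace_scale[OF R]) auto
  finally show "\<exists>c. (\<exists>j<n. c j \<noteq> 0) \<and> (\<Sum>j<n. c j *\<^sub>R v j) \<in> R" using c(1) by blast
qed

lemma spanned_by_independent_mod: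
  assumes R: "subspace R" and n: "codim_below U R (Suc m)"
    and v: "\<And>j. j < m \<Longrightarrow> v j \<in> U"
    and indep: "\<And>c. (\<Sum>j<m. c j *\<^sub>R v j) \<in> R \<Longrightarrow> \<forall>j<m. c j = 0"
    and z: "z \<in> U"
  shows "\<exists>c. z - (\<Sum>j<m. c j *\<^sub>R v j) \<in> R"
proof -
  define w where "w j = (if j < m then v j else z)" for j
  obtain c where c: "\<exists>j<Suc m. c j \<noteq> 0" "(\<Sum>j<Suc m. c j *\<^sub>R w j) \<in> R"
    using codim_belowD[OF n, of w] v z by (metis w_def)
  have s: "(\<Sum>j<Suc m. c j *\<^sub>R w j) = (\<Sum>j<m. c j *\<^sub>R v j) + c m *\<^sub>R z"
    by (simp add: w_def)
  have cm: "c m \<noteq> 0"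
  proof
    assume "c m = 0"
    then have "\<forall>j<m. c j = 0" using c(2) indep unfolding s by simp
    then show False using c(1) \<open>c m = 0\<close> by (auto simp: less_Suc_eq)
  qed
  have "(1 / c m) *\<^sub>R ((\<Sum>j<m. c j *\<^sub>R v j) + c m *\<^sub>R z) \<in> R"
    using c(2) s by (intro subspace_scale[OF R]) simp
  also have "(1 / c m) *\<^sub>R ((\<Sum>j<m. c j *\<^sub>R v j) + c m *\<^sub>R z)
      = z - (\<Sum>j<m. (- c j / c m) *\<^sub>R v j)"
    using cm by (simp add: scaleR_add_right scaleR_sum_right sum_negf)
  finally show ?thesis by (intro exI)
qed

lemma least_codim_below:
  assumes "codim_below U R n"
  obtains m where "m < n" "\<not> codim_below U R m" "codim_below U R (Suc m)"
proof -
  have "\<not> codim_below U R 0" by (simp add: codim_below_def)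
  then obtain m where "m < n" "\<not> codim_below U R m" "codim_below U R (Suc m)"
    using assms ex_least_nat_less[of "codim_below U R" n] by auto
  then show ?thesis using that by blast
qed

lemma codim_below_basis:
  assumes R: "subspace R" and "codim_below U R n"
  obtains m :: nat and v where "\<And>j. j < m \<Longrightarrow> v j \<in> U"
    "\<And>c. (\<Sum>j<m. c j *\<^sub>R v j) \<in> R \<Longrightarrow> \<forall>j<m. c j = 0"
    "\<And>z. z \<in> U \<Longrightarrow> \<exists>c. z - (\<Sum>j<m. c j *\<^sub>R v j) \<in> R"
proof -
  obtain m where m: "\<not> codim_below U R m" "codim_below U R (Suc m)"
    using least_codim_below[OF assms(2)] by blast
  then obtain v where v: "\<And>j. j < m \<Longrightarrow> v j \<in> U"
    "\<And>c. (\<Sum>j<m. c j *\<^sub>R v j) \<in> R \<Longrightarrow> \<forall>j<m. c j = 0"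
    unfolding codim_below_def by blast
  show ?thesis by (rule that[of m v, OF v spanned_by_independent_mod[OF R m(2), of v, OF v]])
qed

lemma in_span_image_iff:
  "z \<in> span (v ` {..<m}) \<longleftrightarrow> (\<exists>c. z = (\<Sum>j<m::nat. c j *\<^sub>R v j))"
proof
  show "z \<in> span (v ` {..<m})" if "\<exists>c. z = (\<Sum>j<m. c j *\<^sub>R v j)"
    using that by (auto intro!: span_sum span_scale intro: span_base)
  assume "z \<in> span (v ` {..<m})"
  then show "\<exists>c. z = (\<Sum>j<m. c j *\<^sub>R v j)"
  proof (induction rule: span_induct_alt)
    case base
    show ?case by (intro exI[of _ "\<lambda>_. 0"]) simp
  next
    case (step a x y)
    then obtain k c where k: "k < m" "x = v k" "y = (\<Sum>j<m. c j *\<^sub>R v j)" by blast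
    have "(\<Sum>j<m. (if j = k then a else 0) *\<^sub>R v j) = a *\<^sub>R x"
      using k by (simp add: if_distrib[of "\<lambda>t. t *\<^sub>R _"] cong: if_cong)
    then show ?case using k
      by (intro exI[of _ "\<lambda>j. (if j = k then a else 0) + c j"])
        (simp add: scaleR_add_left sum.distrib)
  qed
qed

lemma finite_dim_quotient_iff_codim_below:
  assumes R: "subspace R"
  shows "finite_dim_quotient U R \<longleftrightarrow> (\<exists>n. codim_below U R n)"
proof
  assume "finite_dim_quotient U R"
  then obtain B where B: "finite B" "\<forall>v\<in>U. \<exists>b\<in>span B. v - b \<in> R"
    by (auto simp: finite_dim_quotient_def)
  obtain u and m :: nat where u: "B = u ` {..<m}"
    using B(1) by (metis finite_imp_nat_seg_image_inj_on lessThan_def)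
  have "codim_below U R (Suc m)"
  proof (rule codim_below_spanned[OF R lessI])
    fix z assume "z \<in> U"
    then show "\<exists>c. z - (\<Sum>j<m. c j *\<^sub>R u j) \<in> R"
      using B(2) unfolding u by (metis in_span_image_iff)
  qed
  then show "\<exists>n. codim_below U R n" by blast
next
  assume "\<exists>n. codim_below U R n"
  then obtain n where "codim_below U R n" by blast
  then obtain m :: nat and v where v: "\<And>j. j < m \<Longrightarrow> v j \<in> U"
    "\<And>z. z \<in> U \<Longrightarrow> \<exists>c. z - (\<Sum>j<m. c j *\<^sub>R v j) \<in> R"
    by (rule codim_below_basis[OF R]) blast
  show "finite_dim_quotient U R" unfolding finite_dim_quotient_def
  proof (intro exI[of _ "v ` {..<m}"] conjI ballI)
    fix z assume "z \<in> U"
    then obtain c where "z - (\<Sum>j<m. c j *\<^sub>R v j) \<in> R" using v(2) by blast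
    then show "\<exists>b\<in>span (v ` {..<m}). z - b \<in> R" using in_span_image_iff by (intro bexI) blast+
  qed (use v in auto)
qed

lemma finite_dim_iff_codim_below:
  assumes U: "subspace U"
  shows "finite_dim U \<longleftrightarrow> (\<exists>n. codim_below U {0} n)"
proof -
  have "finite_dim U \<longleftrightarrow> finite_dim_quotient U {0}"
  proof
    assume "finite_dim U"
    then show "finite_dim_quotient U {0}"
      unfolding finite_dim_def finite_dim_quotient_def by (metis eq_iff_diff_eq_0 singletonI span_superset)
  next
    assume "finite_dim_quotient U {0}"
    then obtain B where B: "finite B" "B \<subseteq> U" "\<forall>v\<in>U. \<exists>b\<in>span B. v - b \<in> {0}"
      by (auto simp: finite_dim_quotient_def)
    then have "U \<subseteq> span B" by auto
    then have "span B = U" using span_minimal[OF B(2) U] by blast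
    then show "finite_dim U" using B(1) by (auto simp: finite_dim_def)
  qed
  then show ?thesis using finite_dim_quotient_iff_codim_below[of "{0}" U] by (simp add: subspace_def)
qed

section \<open>Linear maps on a subspace\<close>

text \<open>Linearity relative to a carrier: the values of an operator outside the space on which it acts
  are arbitrary.\<close>

definition linear_into :: "'v::real_vector set \<Rightarrow> 'w::real_vector set \<Rightarrow> ('v \<Rightarrow> 'w) \<Rightarrow> bool" where
  "linear_into U V T \<longleftrightarrow> (\<forall>x\<in>U. T x \<in> V) \<and>
    (\<forall>x\<in>U. \<forall>y\<in>U. T (x + y) = T x + T y) \<and> (\<forall>c. \<forall>x\<in>U. T (c *\<^sub>R x) = c *\<^sub>R T x)"

lemma linear_into_zero: "linear_into U V T \<Longrightarrow> subspace U \<Longrightarrow> T 0 = 0"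
  unfolding linear_into_def by (metis scaleR_zero_left subspace_0)

lemma linear_into_diff:
  "linear_into U V T \<Longrightarrow> subspace U \<Longrightarrow> x \<in> U \<Longrightarrow> y \<in> U \<Longrightarrow> T (x - y) = T x - T y"
  unfolding linear_into_def
  by (metis add_diff_cancel diff_add_cancel subspace_diff)

lemma linear_into_sum:
  assumes T: "linear_into U V T" and U: "subspace U" and x: "\<And>j. j \<in> J \<Longrightarrow> x j \<in> U"
  shows "T (\<Sum>j\<in>J. c j *\<^sub>R x j) = (\<Sum>j\<in>J. c j *\<^sub>R T (x j))"
  using x
proof (induction J rule: infinite_finite_induct)
  case (insert i J)
  have "(\<Sum>j\<in>J. c j *\<^sub>R x j) \<in> U"
    using insert.prems by (intro subspace_sum[OF U] subspace_scale[OF U]) auto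
  then show ?case using T insert U subspace_scale[OF U]
    by (simp add: linear_into_def)
qed (auto simp: linear_into_zero[OF T U])

lemma subspace_linear_image:
  assumes T: "linear_into U V T" and U: "subspace U"
  shows "subspace (T ` U)"
  unfolding subspace_def
proof (intro conjI ballI allI)
  show "0 \<in> T ` U" using linear_into_zero[OF T U] subspace_0[OF U] by force
next
  fix x y assume "x \<in> T ` U" "y \<in> T ` U"
  then show "x + y \<in> T ` U" using T subspace_add[OF U] unfolding linear_into_def
    by (metis (no_types, lifting) image_iff)
next
  fix c x assume "x \<in> T ` U"
  then show "c *\<^sub>R x \<in> T ` U" using T subspace_scale[OF U] unfolding linear_into_def
    by (metis (no_types, lifting) image_iff)
qed

lemma subspace_linear_preimage:
  assumes T: "linear_into U V T" and U: "subspace U" and G: "subspace G"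
  shows "subspace {x\<in>U. T x \<in> G}"
  using T U G linear_into_zero[OF T U] by (auto simp: subspace_def linear_into_def)

section \<open>Pointwise convergent subsequences\<close>

lemma pointwise_convergent_subsequence:
  fixes f :: "nat \<Rightarrow> 'i::countable \<Rightarrow> real"
  assumes bdd: "\<And>i. bounded (range (\<lambda>n. f n i))"
  obtains r g where "strict_mono r" "\<And>i. (\<lambda>n. f (r n) i) \<longlonglongrightarrow> g i"
proof -
  interpret subseqs "\<lambda>k s. convergent (\<lambda>n. f (s n) (from_nat k))"
  proof
    fix k and s :: "nat \<Rightarrow> nat" assume "strict_mono s"
    have "bounded (range (\<lambda>n. f (s n) (from_nat k)))"
      by (rule bounded_subset[OF bdd[of "from_nat k"]]) auto
    from bounded_imp_convergent_subsequence[OF this] obtain l r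
      where "strict_mono r" "((\<lambda>n. f (s n) (from_nat k)) \<circ> r) \<longlonglongrightarrow> l" by auto
    then show "\<exists>r'. strict_mono r' \<and> convergent (\<lambda>n. f ((s \<circ> r') n) (from_nat k))"
      by (auto simp: convergent_def o_def)
  qed
  have "convergent (\<lambda>n. f (diagseq n) i)" for i
  proof -
    have "convergent (\<lambda>n. f ((diagseq \<circ> (+) (Suc (to_nat i))) n) (from_nat (to_nat i)))"
    proof (rule diagseq_holds)
      fix r s :: "nat \<Rightarrow> nat" and k
      assume "strict_mono r" "convergent (\<lambda>n. f (s n) (from_nat k))"
      then show "convergent (\<lambda>n. f ((s \<circ> r) n) (from_nat k))"
        using convergent_subseq_convergent[of "\<lambda>n. f (s n) (from_nat k)" r] by (simp add: o_def)
    qed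
    then have "convergent (\<lambda>n. f (diagseq (n + Suc (to_nat i))) i)" by (simp add: add.commute)
    then show ?thesis using convergent_ignore_initial_segment[of "\<lambda>n. f (diagseq n) i" "Suc (to_nat i)"] by simp
  qed
  then have "\<forall>i. \<exists>l. (\<lambda>n. f (diagseq n) i) \<longlonglongrightarrow> l" by (simp add: convergent_def)
  then obtain g where "\<And>i. (\<lambda>n. f (diagseq n) i) \<longlonglongrightarrow> g i" by (auto simp: choice_iff)
  then show ?thesis by (rule that[OF subseq_diagseq])
qed

text \<open>The unit sphere of the coefficient space is compact: a sequence of normalised coefficient
  vectors has a limit that is not zero.\<close>

lemma unit_coefficients_subsequence:
  fixes c :: "nat \<Rightarrow> nat \<Rightarrow> real"
  assumes "\<And>k. (\<Sum>j<n. \<bar>c k j\<bar>) = 1"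
  obtains r g where "strict_mono r" "\<And>j. j < n \<Longrightarrow> (\<lambda>k. c (r k) j) \<longlonglongrightarrow> g j"
    "\<exists>j<n. g j \<noteq> 0"
proof -
  define f where "f k j = (if j < n then c k j else 0)" for k j
  have "\<bar>f k j\<bar> \<le> 1" for k j
    using member_le_sum[of j "{..<n}" "\<lambda>j. \<bar>c k j\<bar>"] assms[of k] by (simp add: f_def)
  then have "bounded (range (\<lambda>k. f k j))" for j by (auto simp: bounded_iff)
  then obtain r g where r: "strict_mono r" "\<And>j. (\<lambda>k. f (r k) j) \<longlonglongrightarrow> g j"
    by (rule pointwise_convergent_subsequence[of f]) blast
  have lim: "(\<lambda>k. c (r k) j) \<longlonglongrightarrow> g j" if "j < n" for j
    using r(2)[of j] that by (simp add: f_def)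
  then have "(\<lambda>k. \<Sum>j<n. \<bar>c (r k) j\<bar>) \<longlonglongrightarrow> (\<Sum>j<n. \<bar>g j\<bar>)"
    by (intro tendsto_sum tendsto_rabs) auto
  then have "(\<lambda>k::nat. 1::real) \<longlonglongrightarrow> (\<Sum>j<n. \<bar>g j\<bar>)" by (simp add: assms)
  then have "(\<Sum>j<n. \<bar>g j\<bar>) = 1" by (simp add: LIMSEQ_const_iff)
  then have "\<exists>j<n. g j \<noteq> 0" by (rule contrapos_pp) simp
  then show ?thesis using that r(1) lim by blast
qed

lemma normalise_coefficients:
  fixes c :: "nat \<Rightarrow> real"
  assumes "\<exists>j<n. c j \<noteq> 0"
  obtains s where "s > 0" "(\<Sum>j<n. \<bar>s * c j\<bar>) = 1"
proof -
  have "(\<Sum>j<n. \<bar>c j\<bar>) > 0"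
    using assms by (auto intro!: sum_pos2)
  then show ?thesis using that[of "1 / (\<Sum>j<n. \<bar>c j\<bar>)"]
    by (simp add: abs_mult sum_divide_distrib[symmetric])
qed

lemma maximal_coefficient:
  fixes c :: "nat \<Rightarrow> real"
  assumes "\<exists>j<n. c j \<noteq> 0"
  obtains k where "k < n" "\<bar>c k\<bar> > 0" "\<And>j. j < n \<Longrightarrow> \<bar>c j\<bar> \<le> \<bar>c k\<bar>"
proof -
  obtain i where i: "i < n" "c i \<noteq> 0" using assms by blast
  let ?M = "Max ((\<lambda>j. \<bar>c j\<bar>) ` {..<n})"
  have "?M \<in> (\<lambda>j. \<bar>c j\<bar>) ` {..<n}" using i by (intro Max_in) auto
  then obtain k where k: "k < n" "?M = \<bar>c k\<bar>" by auto
  have "\<bar>c j\<bar> \<le> \<bar>c k\<bar>" if "j < n" for j unfolding k(2)[symmetric] using that by (intro Max_ge) auto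
  then show ?thesis using that[OF k(1)] i by force
qed

section \<open>Normed and Banach spaces on a carrier set\<close>

text \<open>The spaces \<open>l\<^sup>p\<close> are sets that depend on the parameter \<open>p\<close>, so their functional analysis is developed
  relative to a carrier \<open>V\<close>. Two of the norm axioms are imposed on all vectors: the \<open>l\<^sup>p\<close>-norm satisfies
  them everywhere, since it is \<open>0\<close> outside the space.\<close>

locale normed_carrier =
  fixes V :: "'v::real_vector set" and N :: "'v \<Rightarrow> real"
  assumes subspace_V: "subspace V"
    and norm_nonneg: "0 \<le> N x"
    and norm_eq_0: "x \<in> V \<Longrightarrow> N x = 0 \<Longrightarrow> x = 0"
    and norm_scale: "N (c *\<^sub>R x) = \<bar>c\<bar> * N x"
    and norm_triangle: "x \<in> V \<Longrightarrow> y \<in> V \<Longrightarrow> N (x + y) \<le> N x + N y"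
begin

lemma norm_0 [simp]: "N 0 = 0"
  using norm_scale[of 0 0] by simp

lemma norm_commute: "N (x - y) = N (y - x)"
  using norm_scale[of "-1" "x - y"] by simp

lemma norm_triangle_diff: "x \<in> V \<Longrightarrow> y \<in> V \<Longrightarrow> N (x - y) \<le> N x + N y"
  using norm_triangle[of x "- y"] norm_scale[of "-1" y] subspace_neg[OF subspace_V] by simp

lemma norm_triangle_sub: "x \<in> V \<Longrightarrow> y \<in> V \<Longrightarrow> N x \<le> N (x - y) + N y"
  using norm_triangle[of "x - y" y] subspace_diff[OF subspace_V] by simp

lemma norm_sum_le:
  assumes "\<And>j. j \<in> J \<Longrightarrow> x j \<in> V" "\<And>j. j \<in> J \<Longrightarrow> N (x j) \<le> L"
  shows "N (\<Sum>j\<in>J. c j *\<^sub>R x j) \<le> (\<Sum>j\<in>J. \<bar>c j\<bar>) * L"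
  using assms
proof (induction J rule: infinite_finite_induct)
  case (insert i J)
  have "(\<Sum>j\<in>J. c j *\<^sub>R x j) \<in> V"
    using insert.prems by (intro subspace_sum[OF subspace_V] subspace_scale[OF subspace_V]) auto
  then have "N (\<Sum>j\<in>insert i J. c j *\<^sub>R x j) \<le> N (c i *\<^sub>R x i) + N (\<Sum>j\<in>J. c j *\<^sub>R x j)"
    using insert subspace_scale[OF subspace_V] by (simp add: norm_triangle)
  also have "N (c i *\<^sub>R x i) \<le> \<bar>c i\<bar> * L"
    using insert.prems by (simp add: norm_scale mult_left_mono)
  finally show ?case using insert by (simp add: distrib_right)
qed auto

definition norm_closed :: "'v set \<Rightarrow> bool" where
  "norm_closed Y \<longleftrightarrow> (\<forall>z\<in>V. (\<forall>e>0. \<exists>y\<in>Y. N (z - y) < e) \<longrightarrow> z \<in> Y)"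

lemma norm_closedD:
  assumes "norm_closed Y" "z \<in> V" "\<And>k. y k \<in> Y" "(\<lambda>k. N (z - y k)) \<longlonglongrightarrow> 0"
  shows "z \<in> Y"
proof -
  have "\<exists>x\<in>Y. N (z - x) < e" if "e > 0" for e
    using order_tendstoD(2)[OF assms(4) that] assms(3) by (auto simp: eventually_sequentially)
  then show ?thesis using assms(1,2) by (auto simp: norm_closed_def)
qed

lemma norm_closed_approx:
  assumes "norm_closed Y" "z \<in> V" "z \<notin> Y"
  obtains e where "e > 0" "\<And>y. y \<in> Y \<Longrightarrow> e \<le> N (z - y)"
  using assms unfolding norm_closed_def by (meson not_less)

lemma norm_closed_0: "norm_closed {0}"
  unfolding norm_closed_def
proof (intro ballI impI)
  fix z assume z: "z \<in> V" "\<forall>e>0. \<exists>y\<in>{0}. N (z - y) < e"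
  have "\<not> 0 < N z"
  proof
    assume "0 < N z"
    then have "\<exists>y\<in>{0}. N (z - y) < N z" using z(2) by blast
    then show False by simp
  qed
  then have "N z = 0" using norm_nonneg[of z] by simp
  then show "z \<in> {0}" using norm_eq_0[OF z(1)] by simp
qed

text \<open>Riesz's lemma: normalise a vector whose distance to \<open>Y\<close> is nearly attained.\<close>

lemma riesz_lemma:
  assumes Y: "subspace Y" "norm_closed Y" "Y \<subseteq> U" and U: "subspace U" "U \<subseteq> V"
    and v: "v \<in> U" "v \<notin> Y"
  obtains u where "u \<in> U" "N u = 1" "\<And>y. y \<in> Y \<Longrightarrow> 1 / 2 \<le> N (u - y)"
proof -
  define D where "D = (\<lambda>y. N (v - y)) ` Y"
  obtain e where e: "e > 0" "\<And>y. y \<in> Y \<Longrightarrow> e \<le> N (v - y)"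
    using norm_closed_approx[OF Y(2)] v U by blast
  have D: "D \<noteq> {}" "bdd_below D"
    using subspace_0[OF Y(1)] e(2) by (auto simp: D_def intro!: bdd_belowI2)
  have "e \<le> Inf D" using e(2) D by (intro cInf_greatest) (auto simp: D_def)
  then have "Inf D < 2 * Inf D" using e by simp
  then obtain d where "d \<in> D" "d < 2 * Inf D" using cInf_lessD[OF D(1)] by blast
  then obtain y0 where y0: "y0 \<in> Y" "N (v - y0) < 2 * Inf D" by (auto simp: D_def)
  let ?t = "N (v - y0)"
  have t: "?t > 0" using e(1) e(2)[OF y0(1)] by linarith
  have vy: "v - y0 \<in> U" using v y0 Y U by (meson subspace_diff subsetD)
  have dist: "1 / 2 \<le> N ((1 / ?t) *\<^sub>R (v - y0) - y)" if y: "y \<in> Y" for y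
  proof -
    have in_Y: "y0 + ?t *\<^sub>R y \<in> Y" using y0 y Y(1) by (simp add: subspace_add subspace_scale)
    then have "Inf D \<le> N (v - (y0 + ?t *\<^sub>R y))" by (intro cInf_lower D) (auto simp: D_def)
    moreover have "v - (y0 + ?t *\<^sub>R y) \<in> V"
      using in_Y v Y U by (meson subspace_diff subsetD)
    moreover have "(1 / ?t) *\<^sub>R (v - (y0 + ?t *\<^sub>R y)) = (1 / ?t) *\<^sub>R (v - y0) - y"
      using t by (simp add: algebra_simps)
    ultimately have "Inf D / ?t \<le> N ((1 / ?t) *\<^sub>R (v - y0) - y)"
      using t norm_scale[of "1 / ?t" "v - (y0 + ?t *\<^sub>R y)"]
      by (simp add: divide_right_mono)
    moreover have "1 / 2 \<le> Inf D / ?t" using y0(2) t by (simp add: field_simps)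
    ultimately show ?thesis by linarith
  qed
  show ?thesis
  proof (rule that[OF _ _ dist])
    show "(1 / ?t) *\<^sub>R (v - y0) \<in> U" using vy U(1) by (simp add: subspace_scale)
    show "N ((1 / ?t) *\<^sub>R (v - y0)) = 1" using t norm_scale[of "1 / ?t" "v - y0"] by auto
  qed
qed

text \<open>Since \<open>u\<close> keeps a distance from \<open>Y\<close>, the coefficient of \<open>u\<close> in a vector of \<open>Y + \<real> u\<close> is
  controlled by the norm of that vector. So a convergent sequence in \<open>Y + \<real> u\<close> has convergent
  coefficients, and hence convergent parts in \<open>Y\<close>.\<close>

lemma norm_closed_add_line:
  assumes Y: "subspace Y" "norm_closed Y" "Y \<subseteq> V" and u: "u \<in> V"
    and dist: "\<And>y. y \<in> Y \<Longrightarrow> 1 / 2 \<le> N (u - y)"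
  shows "\<And>c y. y \<in> Y \<Longrightarrow> \<bar>c\<bar> \<le> 2 * N (c *\<^sub>R u + y)"
    and "norm_closed {c *\<^sub>R u + y | c y. y \<in> Y}"
proof -
  show coeff: "\<bar>c\<bar> \<le> 2 * N (c *\<^sub>R u + y)" if y: "y \<in> Y" for c y
  proof (cases "c = 0")
    case False
    have "1 / 2 \<le> N (u - (- 1 / c) *\<^sub>R y)"
      by (intro dist subspace_scale Y(1) y)
    moreover have "N (c *\<^sub>R (u - (- 1 / c) *\<^sub>R y)) = \<bar>c\<bar> * N (u - (- 1 / c) *\<^sub>R y)"
      by (rule norm_scale)
    moreover have "c *\<^sub>R (u - (- 1 / c) *\<^sub>R y) = c *\<^sub>R u + y"
      using False by (simp add: algebra_simps)
    moreover have "\<bar>c\<bar> * (1 / 2) \<le> \<bar>c\<bar> * N (u - (- 1 / c) *\<^sub>R y)"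
      using calculation(1) by (intro mult_left_mono) auto
    ultimately show ?thesis by simp
  qed (simp add: norm_nonneg)
  show "norm_closed {c *\<^sub>R u + y | c y. y \<in> Y}"
    unfolding norm_closed_def
  proof (intro ballI impI)
    fix z assume z: "z \<in> V" and near: "\<forall>e>0. \<exists>y\<in>{c *\<^sub>R u + y | c y. y \<in> Y}. N (z - y) < e"
    have "\<exists>c y. y \<in> Y \<and> N (z - (c *\<^sub>R u + y)) < 1 / 2 ^ k" for k :: nat
      using near[rule_format, of "1 / 2 ^ k"] by auto
    then obtain c y where y: "\<And>k. y k \<in> Y" and lim: "\<And>k::nat. N (z - (c k *\<^sub>R u + y k)) < 1 / 2 ^ k"
      by metis
    have small: "(\<lambda>k. 1 / 2 ^ k :: real) \<longlonglongrightarrow> 0"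
      using LIMSEQ_inverse_realpow_zero[of 2] by (simp add: field_simps)
    have mem: "c k *\<^sub>R u + y k \<in> V" for k
      using u y[of k] Y(3) by (auto intro!: subspace_add subspace_scale subspace_V)
    have diff: "\<bar>c k - c l\<bar> \<le> 2 * (1 / 2 ^ k + 1 / 2 ^ l)" for k l
    proof -
      have "(c k - c l) *\<^sub>R u + (y k - y l) = (z - (c l *\<^sub>R u + y l)) - (z - (c k *\<^sub>R u + y k))"
        by (simp add: algebra_simps)
      then have "N ((c k - c l) *\<^sub>R u + (y k - y l))
          \<le> N (z - (c l *\<^sub>R u + y l)) + N (z - (c k *\<^sub>R u + y k))"
        using norm_triangle_diff z mem by (metis subspace_V subspace_diff)
      also have "\<dots> \<le> 1 / 2 ^ k + 1 / 2 ^ l" using lim[of k] lim[of l] by linarith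
      finally show ?thesis using coeff[of "y k - y l" "c k - c l"] y Y(1)
        by (simp add: subspace_diff)
    qed
    have "Cauchy c"
    proof (rule metric_CauchyI)
      fix e :: real assume "e > 0"
      then have "\<forall>\<^sub>F k in sequentially. 1 / 2 ^ k < e / 4"
        by (intro order_tendstoD(2)[OF small]) simp
      then obtain M where M: "\<And>k. k \<ge> M \<Longrightarrow> 1 / 2 ^ k < e / 4" by (auto simp: eventually_sequentially)
      have "dist (c k) (c l) < e" if "k \<ge> M" "l \<ge> M" for k l
      proof -
        have "\<bar>c k - c l\<bar> \<le> 2 * (1 / 2 ^ k + 1 / 2 ^ l)" by (rule diff)
        also have "\<dots> < 2 * (e / 4 + e / 4)"
          using M that by (intro mult_strict_left_mono add_strict_mono) auto
        finally show ?thesis by (simp add: dist_real_def)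
      qed
      then show "\<exists>M. \<forall>m\<ge>M. \<forall>n\<ge>M. dist (c m) (c n) < e" by blast
    qed
    then obtain b where b: "c \<longlonglongrightarrow> b" by (auto simp: Cauchy_convergent_iff convergent_def)
    have zb: "z - b *\<^sub>R u \<in> V" using z u by (intro subspace_diff subspace_scale subspace_V)
    have "z - b *\<^sub>R u \<in> Y"
    proof (rule norm_closedD[OF Y(2) zb, of y])
      show "(\<lambda>k. N (z - b *\<^sub>R u - y k)) \<longlonglongrightarrow> 0"
      proof (rule tendsto_sandwich[OF _ _ tendsto_const])
        show "\<forall>\<^sub>F k in sequentially. N (z - b *\<^sub>R u - y k) \<le> 1 / 2 ^ k + \<bar>c k - b\<bar> * N u"
        proof (intro always_eventually allI)
          fix k
          have "z - b *\<^sub>R u - y k = (z - (c k *\<^sub>R u + y k)) + (c k - b) *\<^sub>R u"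
            by (simp add: algebra_simps)
          then have "N (z - b *\<^sub>R u - y k) \<le> N (z - (c k *\<^sub>R u + y k)) + N ((c k - b) *\<^sub>R u)"
            using norm_triangle z mem u by (metis subspace_V subspace_diff subspace_scale)
          then show "N (z - b *\<^sub>R u - y k) \<le> 1 / 2 ^ k + \<bar>c k - b\<bar> * N u"
            using lim[of k] norm_scale by simp
        qed
        have "(\<lambda>k. 1 / 2 ^ k + \<bar>c k - b\<bar> * N u) \<longlonglongrightarrow> 0 + \<bar>b - b\<bar> * N u"
          by (intro tendsto_intros small b)
        then show "(\<lambda>k. 1 / 2 ^ k + \<bar>c k - b\<bar> * N u) \<longlonglongrightarrow> 0" by simp
      qed (simp add: norm_nonneg)
    qed (rule y)
    then show "z \<in> {c *\<^sub>R u + y | c y. y \<in> Y}"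
      by (intro CollectI exI[of _ b] exI[of _ "z - b *\<^sub>R u"]) simp
  qed
qed

text \<open>Riesz's lemma, iterated: each vector has distance at least \<open>1 / 2\<close> from \<open>R\<close> and the earlier vectors.
  The last coefficient is then at most twice the norm of a combination, so that removing the last
  term at most triples this norm; this is the source of \<open>3 ^ n\<close>. The point is that the constant
  depends only on the number of vectors, not on the subspaces.\<close>

lemma almost_orthogonal_family:
  assumes R: "subspace R" "norm_closed R" "R \<subseteq> U" and U: "subspace U" "U \<subseteq> V"
    and "\<not> codim_below U R n"
  obtains u where "\<And>j. j < n \<Longrightarrow> u j \<in> U" "\<And>j. j < n \<Longrightarrow> N (u j) \<le> 1"
    "\<And>c y j. y \<in> R \<Longrightarrow> j < n \<Longrightarrow> \<bar>c j\<bar> \<le> 3 ^ n * N ((\<Sum>j<n. c j *\<^sub>R u j) - y)"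
proof -
  define Y where "Y m u = {(\<Sum>j<m. c j *\<^sub>R u j) + y | c y. y \<in> R}" for m :: nat and u
  have "\<exists>u. (\<forall>j<m. u j \<in> U \<and> N (u j) \<le> 1) \<and> norm_closed (Y m u) \<and>
      (\<forall>c. \<forall>y\<in>R. \<forall>j<m. \<bar>c j\<bar> \<le> 3 ^ m * N ((\<Sum>j<m. c j *\<^sub>R u j) - y))" if "m \<le> n" for m
    using that
  proof (induction m)
    case 0
    have "Y 0 u = R" for u by (auto simp: Y_def)
    then show ?case using R by simp
  next
    case (Suc m)
    from Suc.IH[OF Suc_leD[OF Suc.prems]] obtain u
      where u0: "\<forall>j<m. u j \<in> U \<and> N (u j) \<le> 1" "norm_closed (Y m u)"
        "\<forall>c. \<forall>y\<in>R. \<forall>j<m. \<bar>c j\<bar> \<le> 3 ^ m * N ((\<Sum>j<m. c j *\<^sub>R u j) - y)" by blast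
    then have u: "\<And>j. j < m \<Longrightarrow> u j \<in> U" "\<And>j. j < m \<Longrightarrow> N (u j) \<le> 1"
      "norm_closed (Y m u)"
      "\<And>c y j. y \<in> R \<Longrightarrow> j < m \<Longrightarrow> \<bar>c j\<bar> \<le> 3 ^ m * N ((\<Sum>j<m. c j *\<^sub>R u j) - y)" by blast+
    have sum_U: "(\<Sum>j<m. c j *\<^sub>R u j) \<in> U" for c
      using u(1) by (intro subspace_sum U(1) subspace_scale) auto
    have YU: "Y m u \<subseteq> U" using sum_U R(3) U(1) by (auto simp: Y_def intro!: subspace_add)
    have sub: "subspace (Y m u)"
      unfolding subspace_def
    proof (intro conjI ballI allI)
      show "0 \<in> Y m u" unfolding Y_def using subspace_0[OF R(1)]
        by (intro CollectI exI[of _ "\<lambda>_. 0"] exI[of _ 0]) simp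
    next
      fix x y assume "x \<in> Y m u" "y \<in> Y m u"
      then obtain c d r s where "x = (\<Sum>j<m. c j *\<^sub>R u j) + r" "y = (\<Sum>j<m. d j *\<^sub>R u j) + s" "r \<in> R" "s \<in> R"
        by (auto simp: Y_def)
      then show "x + y \<in> Y m u" unfolding Y_def using subspace_add[OF R(1)]
        by (intro CollectI exI[of _ "\<lambda>j. c j + d j"] exI[of _ "r + s"])
          (simp add: scaleR_add_left sum.distrib)
    next
      fix a x assume "x \<in> Y m u"
      then obtain c r where "x = (\<Sum>j<m. c j *\<^sub>R u j) + r" "r \<in> R" by (auto simp: Y_def)
      then show "a *\<^sub>R x \<in> Y m u" unfolding Y_def using subspace_scale[OF R(1)]
        by (intro CollectI exI[of _ "\<lambda>j. a * c j"] exI[of _ "a *\<^sub>R r"])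
          (simp add: scaleR_add_right scaleR_sum_right)
    qed
    have "\<exists>v\<in>U. v \<notin> Y m u"
    proof (rule ccontr)
      assume all: "\<not> (\<exists>v\<in>U. v \<notin> Y m u)"
      have "\<exists>c. z - (\<Sum>j<m. c j *\<^sub>R u j) \<in> R" if "z \<in> U" for z
      proof -
        have "z \<in> Y m u" using all that by blast
        then obtain c y where "z = (\<Sum>j<m. c j *\<^sub>R u j) + y" "y \<in> R" by (auto simp: Y_def)
        then show ?thesis by (intro exI[of _ c]) simp
      qed
      then have "codim_below U R n" using codim_below_spanned[OF R(1), of m n U u] Suc.prems by auto
      then show False using assms by blast
    qed
    then obtain v where v: "v \<in> U" "v \<notin> Y m u" by blast
    obtain w where w: "w \<in> U" "N w = 1" "\<And>y. y \<in> Y m u \<Longrightarrow> 1 / 2 \<le> N (w - y)"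
      using riesz_lemma[OF sub u(3) YU U v] by blast
    define u' where "u' = u(m := w)"
    have sum: "(\<Sum>j<Suc m. c j *\<^sub>R u' j) = c m *\<^sub>R w + (\<Sum>j<m. c j *\<^sub>R u j)" for c
      by (simp add: u'_def)
    have coeff: "\<And>c y. y \<in> Y m u \<Longrightarrow> \<bar>c\<bar> \<le> 2 * N (c *\<^sub>R w + y)"
      and closed: "norm_closed {c *\<^sub>R w + y | c y. y \<in> Y m u}"
      using norm_closed_add_line[OF sub u(3) _ _ w(3)] YU U(2) w(1) by blast+
    have "Y (Suc m) u' = {c *\<^sub>R w + y | c y. y \<in> Y m u}"
    proof (intro equalityI subsetI)
      fix z assume "z \<in> Y (Suc m) u'"
      then obtain c y where cy: "z = c m *\<^sub>R w + (\<Sum>j<m. c j *\<^sub>R u j) + y" "y \<in> R"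
        unfolding Y_def sum by blast
      then have "(\<Sum>j<m. c j *\<^sub>R u j) + y \<in> Y m u" by (auto simp: Y_def)
      then show "z \<in> {c *\<^sub>R w + y | c y. y \<in> Y m u}" using cy by (metis (mono_tags, lifting) CollectI add.assoc)
    next
      fix z assume "z \<in> {c *\<^sub>R w + y | c y. y \<in> Y m u}"
      then obtain a c y where "z = a *\<^sub>R w + ((\<Sum>j<m. c j *\<^sub>R u j) + y)" "y \<in> R"
        unfolding Y_def by blast
      then show "z \<in> Y (Suc m) u'" unfolding Y_def sum
        by (intro CollectI exI[of _ "c(m := a)"] exI[of _ y]) (simp add: add.assoc)
    qed
    then have "norm_closed (Y (Suc m) u')" using closed by simp
    moreover have "\<bar>c j\<bar> \<le> 3 ^ Suc m * N ((\<Sum>j<Suc m. c j *\<^sub>R u' j) - y)" if y: "y \<in> R" and j: "j < Suc m" for c y j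
    proof -
      let ?s = "(\<Sum>j<m. c j *\<^sub>R u j) - y" and ?t = "N ((\<Sum>j<Suc m. c j *\<^sub>R u' j) - y)"
      have s: "?s \<in> Y m u" unfolding Y_def using subspace_neg[OF R(1) y]
        by (intro CollectI exI[of _ c] exI[of _ "- y"]) simp
      have e: "(\<Sum>j<Suc m. c j *\<^sub>R u' j) - y = c m *\<^sub>R w + ?s" unfolding sum by simp
      have cm: "\<bar>c m\<bar> \<le> 2 * ?t" using coeff[OF s, of "c m"] unfolding e by simp
      have "N ?s \<le> N (c m *\<^sub>R w + ?s) + N (c m *\<^sub>R w)"
      proof -
        have "c m *\<^sub>R w \<in> V" "?s \<in> V" using w(1) s YU U by (auto intro: subspace_scale)
        then show ?thesis
          using norm_triangle_diff[of "c m *\<^sub>R w + ?s" "c m *\<^sub>R w"] subspace_add[OF subspace_V] by simp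
      qed
      then have "N ?s \<le> ?t + \<bar>c m\<bar>" unfolding e using norm_scale[of "c m" w] w(2) by simp
      then have st: "N ?s \<le> 3 * ?t" using cm by linarith
      show ?thesis
      proof (cases "j = m")
        case True
        have "2 * ?t \<le> 3 ^ Suc m * ?t"
        proof (rule mult_right_mono[OF _ norm_nonneg])
          have "1 \<le> (3::real) ^ m" by simp
          then show "2 \<le> (3::real) ^ Suc m" unfolding power_Suc by linarith
        qed
        then show ?thesis unfolding True using cm by linarith
      next
        case False
        then have "\<bar>c j\<bar> \<le> 3 ^ m * N ?s" using u(4)[OF y, of j c] j by simp
        also have "\<dots> \<le> 3 ^ m * (3 * ?t)" using st by (intro mult_left_mono) auto
        finally show ?thesis by simp
      qed
    qed
    moreover have "u' j \<in> U \<and> N (u' j) \<le> 1" if "j < Suc m" for j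
      using that u w by (auto simp: u'_def less_Suc_eq)
    ultimately show ?case by (intro exI[of _ u']) blast
  qed
  then obtain u where "\<forall>j<n. u j \<in> U \<and> N (u j) \<le> 1" "norm_closed (Y n u)"
      "\<forall>c. \<forall>y\<in>R. \<forall>j<n. \<bar>c j\<bar> \<le> 3 ^ n * N ((\<Sum>j<n. c j *\<^sub>R u j) - y)" by blast
  then show ?thesis by (intro that[of u]) auto
qed

lemma almost_orthogonal_basis:
  assumes R: "subspace R" "norm_closed R" "R \<subseteq> U" and U: "subspace U" "U \<subseteq> V"
    and "codim_below U R n"
  obtains m :: nat and u where "\<And>j. j < m \<Longrightarrow> u j \<in> U" "\<And>j. j < m \<Longrightarrow> N (u j) \<le> 1"
    "\<And>c y j. y \<in> R \<Longrightarrow> j < m \<Longrightarrow> \<bar>c j\<bar> \<le> 3 ^ m * N ((\<Sum>j<m. c j *\<^sub>R u j) - y)"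
    "\<And>z. z \<in> U \<Longrightarrow> \<exists>c. z - (\<Sum>j<m. c j *\<^sub>R u j) \<in> R"
proof -
  obtain m where m: "\<not> codim_below U R m" "codim_below U R (Suc m)"
    using least_codim_below[OF assms(6)] by blast
  obtain u where
    u: "\<And>j. j < m \<Longrightarrow> u j \<in> U" "\<And>j. j < m \<Longrightarrow> N (u j) \<le> 1"
    "\<And>c y j. y \<in> R \<Longrightarrow> j < m \<Longrightarrow> \<bar>c j\<bar> \<le> 3 ^ m * N ((\<Sum>j<m. c j *\<^sub>R u j) - y)"
    by (rule almost_orthogonal_family[OF R U m(1)]) blast
  have "\<forall>j<m. c j = 0" if "(\<Sum>j<m. c j *\<^sub>R u j) \<in> R" for c
    using u(3)[OF that, of _ c] by auto
  then show ?thesis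
    by (intro that[of m u, OF u spanned_by_independent_mod[OF R(1) m(2), of u, OF u(1)]]) blast+
qed

section \<open>Stability under small perturbations\<close>

text \<open>An almost orthogonal family modulo the perturbed range would have a nontrivial combination in the
  old range, which is too close to the perturbed range. The admissible size of the perturbation
  depends on \<open>n\<close> and the lower bound only, so a path with a uniform lower bound can be followed in
  finitely many steps.\<close>

lemma codim_range_stable:
  assumes U: "subspace U" "U \<subseteq> V"
    and S: "linear_into U V S" and T: "linear_into U V T"
    and lower: "\<And>x. x \<in> U \<Longrightarrow> a * N x \<le> N (S x)" and "a > 0"
    and near: "\<And>x. x \<in> U \<Longrightarrow> N (S x - T x) \<le> e * N x" and "e \<ge> 0"
    and closed: "norm_closed (T ` U)"
    and small: "3 ^ n * real n * e < a"
    and codim: "codim_below V (S ` U) n"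
  shows "codim_below V (T ` U) n"
proof (rule ccontr)
  assume not: "\<not> codim_below V (T ` U) n"
  have TU: "T ` U \<subseteq> V" using T by (auto simp: linear_into_def)
  obtain u where u: "\<And>j. j < n \<Longrightarrow> u j \<in> V" "\<And>j. j < n \<Longrightarrow> N (u j) \<le> 1"
    "\<And>c y j. y \<in> T ` U \<Longrightarrow> j < n \<Longrightarrow> \<bar>c j\<bar> \<le> 3 ^ n * N ((\<Sum>j<n. c j *\<^sub>R u j) - y)"
    by (rule almost_orthogonal_family[OF subspace_linear_image[OF T U(1)] closed TU subspace_V order_refl not])
      blast
  obtain c where c: "\<exists>j<n. c j \<noteq> 0" "(\<Sum>j<n. c j *\<^sub>R u j) \<in> S ` U"
    using codim_belowD[OF codim, of u] u(1) by blast
  then obtain x where x: "x \<in> U" "(\<Sum>j<n. c j *\<^sub>R u j) = S x" by blast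
  obtain k where k: "k < n" "\<bar>c k\<bar> > 0" "\<And>j. j < n \<Longrightarrow> \<bar>c j\<bar> \<le> \<bar>c k\<bar>"
    using maximal_coefficient[OF c(1)] by blast
  have "a * N x \<le> N (\<Sum>j<n. c j *\<^sub>R u j)" using lower[OF x(1)] x(2) by simp
  also have "\<dots> \<le> (\<Sum>j<n. \<bar>c j\<bar>) * 1" using u by (intro norm_sum_le) auto
  also have "\<dots> \<le> n * \<bar>c k\<bar>" using sum_bounded_above[of "{..<n}" "\<lambda>j. \<bar>c j\<bar>"] k(3) by simp
  finally have Nx: "a * N x \<le> n * \<bar>c k\<bar>" .
  have "\<bar>c k\<bar> \<le> 3 ^ n * N (S x - T x)" using u(3)[of "T x" k c] x k(1) by simp
  also have "\<dots> \<le> 3 ^ n * (e * N x)" using near[OF x(1)] by (intro mult_left_mono) auto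
  finally have "a * \<bar>c k\<bar> \<le> (3 ^ n * e) * (a * N x)"
    using \<open>a > 0\<close> by (simp add: mult.left_commute mult_left_mono algebra_simps)
  also have "\<dots> \<le> (3 ^ n * e) * (n * \<bar>c k\<bar>)" using Nx \<open>e \<ge> 0\<close> by (intro mult_left_mono) auto
  also have "\<dots> = (3 ^ n * real n * e) * \<bar>c k\<bar>" by simp
  also have "\<dots> < a * \<bar>c k\<bar>" using small k(2) by (intro mult_strict_right_mono) auto
  finally show False by simp
qed

text \<open>Dually, an almost orthogonal family in the perturbed preimage of \<open>G\<close> is moved by small
  corrections into the old preimage, where it becomes dependent.\<close>

lemma dim_preimage_stable:
  assumes G: "subspace G" "G \<subseteq> V"
    and S: "linear_into V V S" and T: "linear_into V V T"
    and onto: "\<And>y. y \<in> V \<Longrightarrow> \<exists>x\<in>V. N x \<le> C * N y \<and> y - S x \<in> G" and "C \<ge> 0"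
    and near: "\<And>x. x \<in> V \<Longrightarrow> N (S x - T x) \<le> e * N x" and "e \<ge> 0"
    and small: "3 ^ n * real n * (C * e) < 1"
    and dim: "codim_below {x\<in>V. S x \<in> G} {0} n"
  shows "codim_below {x\<in>V. T x \<in> G} {0} n"
proof (rule ccontr)
  let ?K = "\<lambda>T. {x\<in>V. T x \<in> G}"
  assume not: "\<not> codim_below (?K T) {0} n"
  have K: "subspace (?K T)" by (rule subspace_linear_preimage[OF T subspace_V G(1)])
  have 0: "subspace {0::'v}" by (simp add: subspace_def)
  have K0: "{0} \<subseteq> ?K T" "?K T \<subseteq> V" using subspace_0[OF K] by auto
  obtain u where
    u: "\<And>j. j < n \<Longrightarrow> u j \<in> ?K T" "\<And>j. j < n \<Longrightarrow> N (u j) \<le> 1"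
    "\<And>c y j. y \<in> {0} \<Longrightarrow> j < n \<Longrightarrow> \<bar>c j\<bar> \<le> 3 ^ n * N ((\<Sum>j<n. c j *\<^sub>R u j) - y)"
    by (rule almost_orthogonal_family[OF 0 norm_closed_0 K0(1) K K0(2) not]) blast
  have "\<forall>j\<in>{..<n}. \<exists>x. x \<in> V \<and> N x \<le> C * e \<and> u j - x \<in> ?K S"
  proof
    fix j assume j: "j \<in> {..<n}"
    have uj: "u j \<in> V" "T (u j) \<in> G" using u(1) j by auto
    have mem: "S (u j) - T (u j) \<in> V" using uj S T by (auto simp: linear_into_def intro!: subspace_diff subspace_V)
    then obtain x where x: "x \<in> V" "N x \<le> C * N (S (u j) - T (u j))" "(S (u j) - T (u j)) - S x \<in> G"
      using onto by blast
    have "N (S (u j) - T (u j)) \<le> e * 1"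
      using near[OF uj(1)] u(2)[of j] j \<open>e \<ge> 0\<close> by (meson lessThan_iff mult_left_mono order_trans)
    then have "N x \<le> C * e" using x(2) \<open>C \<ge> 0\<close> mult_left_mono by fastforce
    moreover have "S (u j - x) \<in> G"
    proof -
      have "S (u j - x) = ((S (u j) - T (u j)) - S x) + T (u j)"
        using linear_into_diff[OF S subspace_V uj(1) x(1)] by simp
      then show ?thesis using x(3) uj(2) G(1) by (metis subspace_add)
    qed
    ultimately show "\<exists>x. x \<in> V \<and> N x \<le> C * e \<and> u j - x \<in> ?K S"
      using x(1) uj(1) subspace_diff[OF subspace_V] by blast
  qed
  from bchoice[OF this] obtain x where x: "\<And>j. j < n \<Longrightarrow> x j \<in> V" "\<And>j. j < n \<Longrightarrow> N (x j) \<le> C * e"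
    "\<And>j. j < n \<Longrightarrow> u j - x j \<in> ?K S" by auto
  obtain c where c: "\<exists>j<n. c j \<noteq> 0" "(\<Sum>j<n. c j *\<^sub>R (u j - x j)) \<in> {0}"
    using codim_belowD[OF dim, of "\<lambda>j. u j - x j"] x(3) by blast
  then have eq: "(\<Sum>j<n. c j *\<^sub>R u j) = (\<Sum>j<n. c j *\<^sub>R x j)"
    by (simp add: scaleR_diff_right sum_subtractf)
  obtain k where k: "k < n" "\<bar>c k\<bar> > 0" "\<And>j. j < n \<Longrightarrow> \<bar>c j\<bar> \<le> \<bar>c k\<bar>"
    using maximal_coefficient[OF c(1)] by blast
  have "\<bar>c k\<bar> \<le> 3 ^ n * N (\<Sum>j<n. c j *\<^sub>R x j)" using u(3)[of 0 k c] k(1) eq by simp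
  also have "\<dots> \<le> 3 ^ n * ((\<Sum>j<n. \<bar>c j\<bar>) * (C * e))"
    using x by (intro mult_left_mono norm_sum_le) auto
  also have "\<dots> \<le> 3 ^ n * ((n * \<bar>c k\<bar>) * (C * e))"
    using sum_bounded_above[of "{..<n}" "\<lambda>j. \<bar>c j\<bar>"] k(3) \<open>C \<ge> 0\<close> \<open>e \<ge> 0\<close>
    by (intro mult_left_mono mult_right_mono) auto
  also have "\<dots> = (3 ^ n * real n * (C * e)) * \<bar>c k\<bar>" by simp
  also have "\<dots> < 1 * \<bar>c k\<bar>" using small k(2) by (intro mult_strict_right_mono) auto
  finally show False by simp
qed

end

lemma unit_interval_steps:
  fixes Q :: "real \<Rightarrow> bool"
  assumes Q0: "Q 0" and pos: "\<delta> > 0"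
    and step: "\<And>s t. 0 \<le> s \<Longrightarrow> s \<le> t \<Longrightarrow> t \<le> 1 \<Longrightarrow> t - s \<le> \<delta> \<Longrightarrow> Q s \<Longrightarrow> Q t"
  shows "Q 1"
proof -
  have "\<exists>m. inverse (real (Suc m)) < \<delta>" using reals_Archimedean[of \<delta>, OF pos] .
  then obtain m where "inverse (real (Suc m)) < \<delta>" ..
  then have m: "1 / real (Suc m) < \<delta>" by (simp only: inverse_eq_divide)
  have "Q (real i / Suc m)" if "i \<le> Suc m" for i
    using that
  proof (induction i)
    case (Suc i)
    have "real (Suc i) / Suc m - real i / Suc m = 1 / Suc m" by (simp add: field_simps)
    then have gap: "real (Suc i) / Suc m - real i / Suc m \<le> \<delta>" using m by linarith
    have IH: "Q (real i / Suc m)" using Suc by simp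
    show ?case
    proof (rule step[OF _ _ _ gap IH])
      show "real i / Suc m \<le> real (Suc i) / Suc m" by (intro divide_right_mono) auto
      show "real (Suc i) / Suc m \<le> 1" using Suc.prems by (subst divide_le_eq_1_pos) auto
    qed simp
  qed (use Q0 in simp)
  from this[of "Suc m"] show ?thesis by simp
qed

section \<open>Consequences of completeness\<close>

text \<open>Vectors with control of their coefficients span a closed space, because bounded coefficient
  vectors have convergent subsequences.\<close>

lemma (in normed_carrier) norm_closed_coefficient_span:
  fixes n :: nat
  assumes u: "\<And>j. j < n \<Longrightarrow> u j \<in> V"
    and coeff: "\<And>c j. j < n \<Longrightarrow> \<bar>c j\<bar> \<le> K * N (\<Sum>j<n. c j *\<^sub>R u j)" and "K \<ge> 0"
  shows "norm_closed {\<Sum>j<n. c j *\<^sub>R u j | c. True}"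
  unfolding norm_closed_def
proof (intro ballI impI)
  let ?s = "\<lambda>c. \<Sum>j<n. c j *\<^sub>R u j"
  fix z assume z: "z \<in> V" and near: "\<forall>e>0. \<exists>y\<in>{?s c | c. True}. N (z - y) < e"
  have sV: "?s c \<in> V" for c using u by (intro subspace_sum subspace_V subspace_scale) auto
  have "\<forall>k::nat. \<exists>c. N (z - ?s c) < 1 / (real k + 1)"
  proof
    fix k :: nat
    have "1 / (real k + 1) > 0" by simp
    then obtain y where "y \<in> {?s c | c. True}" "N (z - y) < 1 / (real k + 1)" using near by blast
    then show "\<exists>c. N (z - ?s c) < 1 / (real k + 1)" by blast
  qed
  from choice[OF this] obtain c where "\<forall>k. N (z - ?s (c k)) < 1 / (real k + 1)" by blast
  then have c: "N (z - ?s (c k)) < 1 / (real k + 1)" for k by blast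
  define L where "L = (\<Sum>j<n. N (u j))"
  have L: "N (u j) \<le> L" if "j < n" for j
    unfolding L_def using that norm_nonneg by (intro member_le_sum) auto
  define f where "f k j = (if j < n then c k j else 0)" for k j
  have "\<bar>f k j\<bar> \<le> K * (N z + 1)" for k j
  proof (cases "j < n")
    case True
    have "N (?s (c k)) \<le> N z + N (z - ?s (c k))"
      using norm_triangle_sub[OF sV z, of "c k"] norm_commute[of "?s (c k)" z] by linarith
    also have "\<dots> \<le> N z + 1"
    proof -
      have "1 / (real k + 1) \<le> 1" by simp
      then show ?thesis using c[of k] by linarith
    qed
    finally have "K * N (?s (c k)) \<le> K * (N z + 1)" using \<open>K \<ge> 0\<close> by (rule mult_left_mono)
    then show ?thesis using coeff[OF True, of "c k"] True by (simp add: f_def)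
  qed (simp add: f_def \<open>K \<ge> 0\<close> norm_nonneg)
  then have "bounded (range (\<lambda>k. f k j))" for j by (auto simp: bounded_iff)
  then obtain r g where r: "strict_mono r" and g: "\<And>j. (\<lambda>k. f (r k) j) \<longlonglongrightarrow> g j"
    by (rule pointwise_convergent_subsequence[of f]) blast
  have lim: "(\<lambda>k. c (r k) j) \<longlonglongrightarrow> g j" if "j < n" for j
    using g[of j] that by (simp add: f_def)
  have "N (z - ?s g) \<le> 0"
  proof (rule LIMSEQ_le_const)
    have "(\<lambda>k. 1 / (real k + 1)) \<longlonglongrightarrow> 0"
      using LIMSEQ_inverse_real_of_nat by (simp add: inverse_eq_divide add.commute)
    then have "(\<lambda>k. 1 / (real (r k) + 1)) \<longlonglongrightarrow> 0"
      using LIMSEQ_subseq_LIMSEQ[OF _ r] by (force simp: o_def)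
    then have "(\<lambda>k. 1 / (real (r k) + 1) + (\<Sum>j<n. \<bar>c (r k) j - g j\<bar>) * L)
        \<longlonglongrightarrow> 0 + (\<Sum>j<n. \<bar>g j - g j\<bar>) * L"
      using lim by (intro tendsto_intros) auto
    then show "(\<lambda>k. 1 / (real (r k) + 1) + (\<Sum>j<n. \<bar>c (r k) j - g j\<bar>) * L) \<longlonglongrightarrow> 0" by simp
    show "\<exists>M. \<forall>k\<ge>M. N (z - ?s g) \<le> 1 / (real (r k) + 1) + (\<Sum>j<n. \<bar>c (r k) j - g j\<bar>) * L"
    proof (intro exI allI impI)
      fix k
      have eq: "z - ?s g = (z - ?s (c (r k))) + ?s (\<lambda>j. c (r k) j - g j)"
        by (simp add: scaleR_diff_left sum_subtractf)
      have "N (z - ?s g) \<le> N (z - ?s (c (r k))) + N (?s (\<lambda>j. c (r k) j - g j))"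
        unfolding eq by (rule norm_triangle[OF subspace_diff[OF subspace_V z sV] sV])
      also have "N (?s (\<lambda>j. c (r k) j - g j)) \<le> (\<Sum>j<n. \<bar>c (r k) j - g j\<bar>) * L"
        using u L by (intro norm_sum_le) auto
      finally show "N (z - ?s g) \<le> 1 / (real (r k) + 1) + (\<Sum>j<n. \<bar>c (r k) j - g j\<bar>) * L"
        using c[of "r k"] by linarith
    qed
  qed
  then have "N (z - ?s g) = 0" using norm_nonneg[of "z - ?s g"] by linarith
  then have "z - ?s g = 0" by (rule norm_eq_0[OF subspace_diff[OF subspace_V z sV]])
  then show "z \<in> {?s c | c. True}" by auto
qed

locale banach_carrier = normed_carrier V N for V :: "'v::real_vector set" and N +
  assumes complete: "\<And>x. (\<And>n. x n \<in> V) \<Longrightarrow> (\<And>e. e > 0 \<Longrightarrow> \<exists>M. \<forall>m\<ge>M. \<forall>n\<ge>M. N (x m - x n) < e)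
    \<Longrightarrow> \<exists>l\<in>V. (\<lambda>n::nat. N (x n - l)) \<longlonglongrightarrow> 0"
begin

text \<open>If every equation can be solved up to half of its right-hand side, iterating on the remainders
  gives a geometric series that converges to a solution. With \<open>G = {0}\<close> this is the last step of the
  open mapping theorem; with a larger \<open>G\<close> it shows that solvability modulo \<open>G\<close> is stable under
  perturbation.\<close>

lemma successive_approximation:
  assumes S: "linear_into V V S" and L: "\<And>x. x \<in> V \<Longrightarrow> N (S x) \<le> L * N x"
    and G: "subspace G" "norm_closed G" "G \<subseteq> V" and R: "R \<subseteq> V" and "C \<ge> 0"
    and approx: "\<And>y. y \<in> R \<Longrightarrow> \<exists>x\<in>V. \<exists>g\<in>G. N x \<le> C * N y \<and>
      y - S x - g \<in> R \<and> N (y - S x - g) \<le> N y / 2"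
    and y: "y \<in> R"
  shows "\<exists>x\<in>V. N x \<le> 2 * C * N y \<and> y - S x \<in> G"
proof -
  have "\<forall>y\<in>R. \<exists>p. fst p \<in> V \<and> snd p \<in> G \<and> N (fst p) \<le> C * N y \<and>
      y - S (fst p) - snd p \<in> R \<and> N (y - S (fst p) - snd p) \<le> N y / 2"
    using approx by (metis fst_conv snd_conv)
  then obtain P where P: "\<And>y. y \<in> R \<Longrightarrow> fst (P y) \<in> V \<and> snd (P y) \<in> G \<and> N (fst (P y)) \<le> C * N y \<and>
      y - S (fst (P y)) - snd (P y) \<in> R \<and> N (y - S (fst (P y)) - snd (P y)) \<le> N y / 2"
    by metis
  define r where "r = rec_nat y (\<lambda>_ z. z - S (fst (P z)) - snd (P z))"
  have r0: "r 0 = y" and rSuc: "r (Suc k) = r k - S (fst (P (r k))) - snd (P (r k))" for k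
    by (simp_all add: r_def)
  have rR: "r k \<in> R" for k by (induction k) (use y P r0 rSuc in auto)
  have rN: "N (r k) \<le> N y / 2 ^ k" for k
  proof (induction k)
    case (Suc k)
    have "N (r (Suc k)) \<le> N (r k) / 2" using P[OF rR[of k]] rSuc by simp
    also have "\<dots> \<le> N y / 2 ^ k / 2" using Suc by (intro divide_right_mono) auto
    finally show ?case by simp
  qed (simp add: r0)
  define x where "x k = fst (P (r k))" for k
  define g where "g k = snd (P (r k))" for k
  have x: "x k \<in> V" and g: "g k \<in> G" for k using P[OF rR[of k]] by (auto simp: x_def g_def)
  have xN: "N (x k) \<le> C * N y / 2 ^ k" for k
    using P[OF rR[of k]] mult_left_mono[OF rN[of k] \<open>C \<ge> 0\<close>] by (simp add: x_def)
  define s where "s k = (\<Sum>i<k. x i)" for k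
  define h where "h k = (\<Sum>i<k. g i)" for k
  have s: "s k \<in> V" for k using x by (auto simp: s_def intro!: subspace_sum subspace_V)
  have h: "h k \<in> G" for k using g by (auto simp: h_def intro!: subspace_sum G(1))
  have rest: "y - S (s k) - h k = r k" for k
  proof (induction k)
    case 0
    show ?case by (simp add: s_def h_def r0 linear_into_zero[OF S subspace_V])
  next
    case (Suc k)
    have "S (s (Suc k)) = S (s k) + S (x k)"
      using S s[of k] x[of k] by (simp add: s_def linear_into_def)
    then show ?case using Suc by (simp add: h_def rSuc x_def g_def algebra_simps)
  qed
  have step: "N (s m - s k) \<le> 2 * C * N y * (1 / 2 ^ k - 1 / 2 ^ m)" if "k \<le> m" for k m
    using that
  proof (induction m rule: dec_induct)
    case (step m)
    have "s (Suc m) - s k = (s m - s k) + x m" by (simp add: s_def)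
    then have "N (s (Suc m) - s k) \<le> N (s m - s k) + N (x m)"
      using norm_triangle s x by (metis subspace_V subspace_diff)
    also have "\<dots> \<le> 2 * C * N y * (1 / 2 ^ k - 1 / 2 ^ m) + C * N y / 2 ^ m"
      using step.IH xN[of m] by linarith
    also have "\<dots> = 2 * C * N y * (1 / 2 ^ k - 1 / 2 ^ Suc m)" by (simp add: field_simps)
    finally show ?case .
  qed simp
  have CN: "0 \<le> 2 * C * N y" using \<open>C \<ge> 0\<close> norm_nonneg by simp
  have tail: "N (s m - s k) \<le> 2 * C * N y / 2 ^ k" if "k \<le> m" for k m
  proof -
    have "2 * C * N y * (1 / 2 ^ k - 1 / 2 ^ m) \<le> 2 * C * N y * (1 / 2 ^ k)"
      using CN by (intro mult_left_mono) auto
    then show ?thesis using step[OF that] by simp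
  qed
  have pow: "(\<lambda>k. a / 2 ^ k) \<longlonglongrightarrow> 0" for a :: real
    using tendsto_mult_right_zero[OF LIMSEQ_inverse_realpow_zero[of 2], of a] by (simp add: field_simps)
  have "\<exists>l\<in>V. (\<lambda>n. N (s n - l)) \<longlonglongrightarrow> 0"
  proof (rule complete[OF s])
    fix e :: real assume "e > 0"
    then have "\<forall>\<^sub>F k in sequentially. 2 * C * N y / 2 ^ k < e / 2"
      by (intro order_tendstoD(2)[OF pow]) simp
    then obtain M where M: "2 * C * N y / 2 ^ M < e / 2"
      unfolding eventually_sequentially by blast
    have "N (s m - s n) < e" if "m \<ge> M" "n \<ge> M" for m n
    proof -
      have "s m - s n = (s m - s M) - (s n - s M)" by simp
      then have "N (s m - s n) \<le> N (s m - s M) + N (s n - s M)"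
        using norm_triangle_diff s by (metis subspace_V subspace_diff)
      then show ?thesis using tail[OF that(1)] tail[OF that(2)] M by linarith
    qed
    then show "\<exists>M. \<forall>m\<ge>M. \<forall>n\<ge>M. N (s m - s n) < e" by blast
  qed
  then obtain l where l: "l \<in> V" "(\<lambda>n. N (s n - l)) \<longlonglongrightarrow> 0" by blast
  have "N l \<le> 2 * C * N y + 0"
  proof (rule LIMSEQ_le_const)
    show "(\<lambda>k. 2 * C * N y + N (s k - l)) \<longlonglongrightarrow> 2 * C * N y + 0" by (intro tendsto_intros l)
    have "N l \<le> 2 * C * N y + N (s k - l)" for k
      using norm_triangle_sub[OF l(1) s[of k]] norm_commute[of l "s k"]
        tail[of 0 k] by (simp add: s_def)
    then show "\<exists>M. \<forall>k\<ge>M. N l \<le> 2 * C * N y + N (s k - l)" by blast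
  qed
  moreover have "y - S l \<in> G"
  proof (rule norm_closedD[OF G(2), of _ h])
    have yV: "y \<in> V" "S l \<in> V" using y R S l by (auto simp: linear_into_def)
    then show "y - S l \<in> V" by (simp add: subspace_V subspace_diff)
    show "(\<lambda>k. N (y - S l - h k)) \<longlonglongrightarrow> 0"
    proof (rule tendsto_sandwich[OF _ _ tendsto_const])
      have "N (y - S l - h k) \<le> N y / 2 ^ k + L * N (s k - l)" for k
      proof -
        have mem: "s k - l \<in> V" using s l by (simp add: subspace_V subspace_diff)
        then have "S (s k - l) \<in> V" using S by (auto simp: linear_into_def)
        moreover have "y - S l - h k = r k + S (s k - l)"
          using rest[of k] linear_into_diff[OF S subspace_V s[of k] l(1)] by (simp add: algebra_simps)
        ultimately have "N (y - S l - h k) \<le> N (r k) + N (S (s k - l))"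
          using norm_triangle rR[of k] R by (metis subsetD)
        then show ?thesis using rN[of k] L[OF mem] by linarith
      qed
      then show "\<forall>\<^sub>F k in sequentially. N (y - S l - h k) \<le> N y / 2 ^ k + L * N (s k - l)" by simp
      have "(\<lambda>k. N y / 2 ^ k + L * N (s k - l)) \<longlonglongrightarrow> 0 + L * 0"
        by (intro tendsto_intros pow l)
      then show "(\<lambda>k. N y / 2 ^ k + L * N (s k - l)) \<longlonglongrightarrow> 0" by simp
    qed (simp add: norm_nonneg)
  qed (rule h)
  ultimately show ?thesis using l(1) by auto
qed

lemma Metric_space_subset:
  assumes "R \<subseteq> V"
  shows "Metric_space R (\<lambda>x y. N (x - y))"
proof
  show "0 \<le> N (x - y)" for x y by (rule norm_nonneg)
  show "N (x - y) = N (y - x)" for x y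
    by (rule norm_commute)
  show "N (x - y) = 0 \<longleftrightarrow> x = y" if "x \<in> R" "y \<in> R" for x y
  proof -
    have "x - y \<in> V" using that assms by (meson subsetD subspace_V subspace_diff)
    then show ?thesis using norm_eq_0[of "x - y"] by auto
  qed
  show "N (x - z) \<le> N (x - y) + N (y - z)" if "x \<in> R" "y \<in> R" "z \<in> R" for x y z
  proof -
    have "x - y \<in> V" "y - z \<in> V" using that assms by (meson subsetD subspace_V subspace_diff)+
    then show ?thesis using norm_triangle[of "x - y" "y - z"] by simp
  qed
qed

text \<open>Baire's theorem is applied inside the range of \<open>A\<close>, which is complete because it is closed: the
  closures \<open>F k\<close> of the images of the balls of radius \<open>k\<close> cover it, so one of them contains a ball,
  and differences of its points give the approximate preimages.\<close>

lemma approximate_open_mapping: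
  assumes A: "linear_into V V A" and closed: "norm_closed (A ` V)"
  obtains C where "C \<ge> 0"
    "\<And>y e. y \<in> A ` V \<Longrightarrow> e > 0 \<Longrightarrow> \<exists>x\<in>V. N x \<le> C * N y \<and> N (y - A x) < e"
proof -
  define R where "R = A ` V"
  have RV: "R \<subseteq> V" and R: "subspace R"
    using A subspace_linear_image[OF A subspace_V] by (auto simp: R_def linear_into_def)
  interpret M: Metric_space R "\<lambda>x y. N (x - y)" by (rule Metric_space_subset[OF RV])
  have complete_R: "M.mcomplete"
    unfolding M.mcomplete_def
  proof (intro allI impI)
    fix \<sigma> assume C: "M.MCauchy \<sigma>"
    then have \<sigma>: "\<sigma> n \<in> R" for n by (auto simp: M.MCauchy_def)
    have "\<exists>l\<in>V. (\<lambda>n. N (\<sigma> n - l)) \<longlonglongrightarrow> 0"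
    proof (rule complete)
      show "\<sigma> n \<in> V" for n using \<sigma> RV by blast
      show "\<exists>M. \<forall>m\<ge>M. \<forall>n\<ge>M. N (\<sigma> m - \<sigma> n) < e" if "e > 0" for e
      proof -
        obtain K where "\<forall>n n'. K \<le> n \<longrightarrow> K \<le> n' \<longrightarrow> N (\<sigma> n - \<sigma> n') < e"
          using C \<open>e > 0\<close> unfolding M.MCauchy_def by meson
        then show ?thesis by (intro exI[of _ K]) simp
      qed
    qed
    then obtain l where l: "l \<in> V" "(\<lambda>n. N (\<sigma> n - l)) \<longlonglongrightarrow> 0" by blast
    then have "l \<in> R"
      using norm_closedD[OF closed l(1), of \<sigma>] \<sigma> unfolding R_def by (simp add: norm_commute)
    then have "limitin M.mtopology \<sigma> l sequentially"
      using l(2) \<sigma> by (simp add: M.limitin_metric_dist_null)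
    then show "\<exists>x. limitin M.mtopology \<sigma> x sequentially" by blast
  qed
  define F where "F k = {y\<in>R. \<forall>e>0. \<exists>x\<in>V. N x \<le> real k \<and> N (y - A x) < e}" for k
  have F_closed: "closedin M.mtopology (F k)" for k
    unfolding M.closedin_metric
  proof (intro conjI allI impI)
    show "F k \<subseteq> R" by (auto simp: F_def)
    fix y assume y: "y \<in> R - F k"
    then obtain e where e: "e > 0" "\<And>x. x \<in> V \<Longrightarrow> N x \<le> real k \<Longrightarrow> e \<le> N (y - A x)"
      by (auto simp: F_def not_less)
    have "False" if z: "z \<in> F k" "N (y - z) < e / 2" for z
    proof -
      have "e / 2 > 0" using e(1) by simp
      then obtain x where x: "x \<in> V" "N x \<le> real k" "N (z - A x) < e / 2"
        using z(1) unfolding F_def by blast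
      have "A x \<in> R" using x(1) by (auto simp: R_def)
      then have "N (y - A x) \<le> N (y - z) + N (z - A x)"
        using y z(1) by (intro M.triangle) (auto simp: F_def)
      then show False using e(2)[OF x(1,2)] z(2) x(3) by linarith
    qed
    then show "\<exists>r>0. disjnt (F k) (M.mball y r)"
      using e(1) by (intro exI[of _ "e / 2"]) (auto simp: disjnt_def)
  qed
  have "\<Union> (range F) = R"
  proof (intro equalityI subsetI)
    fix y assume "y \<in> R"
    then obtain x where x: "x \<in> V" "y = A x" by (auto simp: R_def)
    obtain k :: nat where "N x \<le> real k" using real_arch_simple by blast
    then have "y \<in> F k" using x \<open>y \<in> R\<close> by (force simp: F_def)
    then show "y \<in> \<Union> (range F)" by blast
  qed (auto simp: F_def)
  then have "M.mtopology interior_of \<Union> (range F) = R" by (metis M.topspace_mtopology interior_of_topspace)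
  moreover have "0 \<in> R" by (rule subspace_0[OF R])
  ultimately have "\<exists>T\<in>range F. M.mtopology interior_of T \<noteq> {}"
    using M.metric_Baire_category_alt[OF complete_R, of "range F"] F_closed by auto
  then obtain k y0 where "y0 \<in> M.mtopology interior_of (F k)" by blast
  then obtain T where "openin M.mtopology T" "T \<subseteq> F k" "y0 \<in> T" by (auto simp: interior_of_def)
  then obtain \<rho> where \<rho>: "\<rho> > 0" "M.mball y0 \<rho> \<subseteq> F k" "y0 \<in> R"
    unfolding M.openin_mtopology by (metis order_trans subsetD)
  have y0: "y0 \<in> F k" using \<rho> by (auto simp: subset_iff)
  define C where "C = 2 * real k * (2 / \<rho>)"
  have "C \<ge> 0" using \<rho>(1) by (simp add: C_def)
  moreover have "\<exists>x\<in>V. N x \<le> C * N y \<and> N (y - A x) < e" if y: "y \<in> A ` V" and e: "e > 0" for y e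
  proof (cases "y = 0")
    case True
    then show ?thesis using e linear_into_zero[OF A subspace_V] subspace_0[OF subspace_V]
      by (intro bexI[of _ 0]) auto
  next
    case False
    have yR: "y \<in> R" using y by (simp add: R_def)
    have Ny: "N y > 0" using norm_eq_0[of y] norm_nonneg[of y] yR RV False by force
    define t where "t = \<rho> / (2 * N y)"
    have t: "t > 0" "2 / \<rho> * N y = 1 / t" using Ny \<rho>(1) by (auto simp: t_def)
    have y1R: "y0 + t *\<^sub>R y \<in> R" using \<rho>(3) yR by (intro subspace_add subspace_scale R)
    have "N (t *\<^sub>R y) = \<rho> / 2" unfolding norm_scale using Ny t \<rho>(1) by (simp add: t_def)
    then have "N (y0 - (y0 + t *\<^sub>R y)) < \<rho>" using norm_commute[of y0 "y0 + t *\<^sub>R y"] \<rho>(1) by simp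
    then have y1: "y0 + t *\<^sub>R y \<in> F k" using \<rho> y1R by (auto simp: subset_iff)
    have te: "t * e / 2 > 0" using t e by simp
    obtain x0 where x0: "x0 \<in> V" "N x0 \<le> k" "N (y0 - A x0) < t * e / 2"
      using y0 te unfolding F_def by blast
    obtain x1 where x1: "x1 \<in> V" "N x1 \<le> k" "N (y0 + t *\<^sub>R y - A x1) < t * e / 2"
      using y1 te unfolding F_def by blast
    define x where "x = (1 / t) *\<^sub>R (x1 - x0)"
    have d: "x1 - x0 \<in> V" using x0 x1 by (simp add: subspace_V subspace_diff)
    then have xV: "x \<in> V" by (simp add: x_def subspace_V subspace_scale)
    have "N (x1 - x0) \<le> 2 * real k" using norm_triangle_diff[OF x1(1) x0(1)] x0 x1 by simp
    then have "N x \<le> (1 / t) * (2 * real k)"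
      unfolding x_def norm_scale using t by (simp add: divide_right_mono)
    also have "\<dots> = C * N y" unfolding t(2)[symmetric] by (simp add: C_def)
    finally have Nx: "N x \<le> C * N y" .
    have "A x = (1 / t) *\<^sub>R (A x1 - A x0)"
      using A d linear_into_diff[OF A subspace_V x1(1) x0(1)] by (simp add: x_def linear_into_def)
    then have eq: "y - A x = (1 / t) *\<^sub>R ((y0 + t *\<^sub>R y - A x1) - (y0 - A x0))"
      using t(1) by (simp add: algebra_simps)
    have "A x0 \<in> R" "A x1 \<in> R" using x0 x1 by (auto simp: R_def)
    then have "N ((y0 + t *\<^sub>R y - A x1) - (y0 - A x0)) \<le> N (y0 + t *\<^sub>R y - A x1) + N (y0 - A x0)"
      using y1R \<rho>(3) RV by (intro norm_triangle_diff) (meson subsetD subspace_V subspace_diff)+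
    also have "\<dots> < t * e" using x0(3) x1(3) by linarith
    finally have "N (y - A x) < (1 / t) * (t * e)"
      unfolding eq norm_scale using t(1) by (simp add: field_simps)
    then show ?thesis using xV Nx t(1) by auto
  qed
  ultimately show ?thesis by (rule that)
qed

lemma open_mapping:
  assumes A: "linear_into V V A" and L: "\<And>x. x \<in> V \<Longrightarrow> N (A x) \<le> L * N x"
    and closed: "norm_closed (A ` V)"
  obtains C where "C \<ge> 0" "\<And>y. y \<in> A ` V \<Longrightarrow> \<exists>x\<in>V. A x = y \<and> N x \<le> C * N y"
proof -
  obtain C where C: "C \<ge> 0"
    "\<And>y e. y \<in> A ` V \<Longrightarrow> e > 0 \<Longrightarrow> \<exists>x\<in>V. N x \<le> C * N y \<and> N (y - A x) < e"
    by (rule approximate_open_mapping[OF A closed]) blast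
  have R: "subspace (A ` V)" "A ` V \<subseteq> V"
    using A subspace_linear_image[OF A subspace_V] by (auto simp: linear_into_def)
  have 0: "subspace {0::'v}" "{0} \<subseteq> V" using subspace_0[OF subspace_V] by (auto simp: subspace_def)
  have "\<exists>x\<in>V. N x \<le> 2 * C * N y \<and> y - A x \<in> {0}" if y: "y \<in> A ` V" for y
  proof (rule successive_approximation[OF A L 0(1) norm_closed_0 0(2) R(2) C(1) _ y])
    fix y assume y: "y \<in> A ` V"
    show "\<exists>x\<in>V. \<exists>g\<in>{0}. N x \<le> C * N y \<and> y - A x - g \<in> A ` V \<and> N (y - A x - g) \<le> N y / 2"
    proof (cases "y = 0")
      case True
      then show ?thesis using linear_into_zero[OF A subspace_V] subspace_0[OF subspace_V] y
        by (intro bexI[of _ 0]) auto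
    next
      case False
      then have "N y / 2 > 0" using norm_eq_0[of y] norm_nonneg[of y] y R(2) by force
      then obtain x where x: "x \<in> V" "N x \<le> C * N y" "N (y - A x) < N y / 2" using C(2)[OF y] by blast
      moreover have "y - A x \<in> A ` V" using y x(1) by (intro subspace_diff R(1)) auto
      ultimately show ?thesis by (intro bexI[of _ x] bexI[of _ 0]) simp_all
    qed
  qed
  then have "\<exists>x\<in>V. A x = y \<and> N x \<le> 2 * C * N y" if "y \<in> A ` V" for y
    using that by (metis eq_iff_diff_eq_0 singletonD)
  then show ?thesis using C(1) by (intro that[of "2 * C"]) auto
qed

text \<open>The lower bound makes preimages of a convergent sequence of values a Cauchy sequence.\<close>

lemma norm_closed_range_of_lower_bound:
  assumes U: "subspace U" "U \<subseteq> V" "norm_closed U" and T: "linear_into U V T"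
    and lower: "\<And>x. x \<in> U \<Longrightarrow> a * N x \<le> N (T x)" and "a > 0"
    and L: "\<And>x. x \<in> U \<Longrightarrow> N (T x) \<le> L * N x"
  shows "norm_closed (T ` U)"
  unfolding norm_closed_def
proof (intro ballI impI)
  fix z assume z: "z \<in> V" and near: "\<forall>e>0. \<exists>y\<in>T ` U. N (z - y) < e"
  have "\<forall>k::nat. \<exists>x. x \<in> U \<and> N (z - T x) < 1 / (real k + 1)"
  proof
    fix k :: nat
    have "1 / (real k + 1) > 0" by simp
    then show "\<exists>x. x \<in> U \<and> N (z - T x) < 1 / (real k + 1)" using near by blast
  qed
  from choice[OF this] obtain x where "\<forall>k. x k \<in> U \<and> N (z - T (x k)) < 1 / (real k + 1)" by blast
  then have x: "x k \<in> U" "N (z - T (x k)) < 1 / (real k + 1)" for k by blast+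
  have TV: "T y \<in> V" if "y \<in> U" for y using T that by (auto simp: linear_into_def)
  have lim0: "(\<lambda>k. 1 / (real k + 1)) \<longlonglongrightarrow> 0"
    using LIMSEQ_inverse_real_of_nat by (simp add: inverse_eq_divide add.commute)
  have "\<exists>l\<in>V. (\<lambda>n. N (x n - l)) \<longlonglongrightarrow> 0"
  proof (rule complete)
    show "x n \<in> V" for n using x U by blast
    fix e :: real assume "e > 0"
    then have "a * e / 2 > 0" using \<open>a > 0\<close> by simp
    then have "\<forall>\<^sub>F k in sequentially. 1 / (real k + 1) < a * e / 2"
      by (rule order_tendstoD(2)[OF lim0])
    then obtain M where M: "\<And>k. k \<ge> M \<Longrightarrow> 1 / (real k + 1) < a * e / 2"
      unfolding eventually_sequentially by blast
    have "N (x m - x n) < e" if "m \<ge> M" "n \<ge> M" for m n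
    proof -
      have "a * N (x m - x n) \<le> N (T (x m - x n))"
        using x(1) U(1) by (intro lower) (simp add: subspace_diff)
      also have "T (x m - x n) = (z - T (x n)) - (z - T (x m))"
        using linear_into_diff[OF T U(1) x(1) x(1)] by simp
      also have "N \<dots> \<le> N (z - T (x n)) + N (z - T (x m))"
        using z TV x(1) by (intro norm_triangle_diff) (simp_all add: subspace_V subspace_diff)
      also have "\<dots> < a * e / 2 + a * e / 2"
        using x(2)[of m] x(2)[of n] M[OF that(1)] M[OF that(2)] by linarith
      finally show ?thesis using \<open>a > 0\<close> by simp
    qed
    then show "\<exists>M. \<forall>m\<ge>M. \<forall>n\<ge>M. N (x m - x n) < e" by blast
  qed
  then obtain l where l: "l \<in> V" "(\<lambda>n. N (x n - l)) \<longlonglongrightarrow> 0" by blast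
  then have lU: "l \<in> U" using norm_closedD[OF U(3) l(1) x(1)] by (simp add: norm_commute)
  have "N (z - T l) \<le> 0 + L * 0"
  proof (rule LIMSEQ_le_const)
    show "(\<lambda>k. 1 / (real k + 1) + L * N (x k - l)) \<longlonglongrightarrow> 0 + L * 0"
      by (intro tendsto_intros lim0 l)
    have "N (z - T l) \<le> 1 / (real k + 1) + L * N (x k - l)" for k
    proof -
      have mem: "x k - l \<in> U" using x lU U(1) by (simp add: subspace_diff)
      have "z - T l = (z - T (x k)) + T (x k - l)"
        using linear_into_diff[OF T U(1) x(1) lU] by simp
      then have "N (z - T l) \<le> N (z - T (x k)) + N (T (x k - l))"
        using norm_triangle z TV mem x(1) by (metis subspace_V subspace_diff)
      then show ?thesis using x(2)[of k] L[OF mem] by linarith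
    qed
    then show "\<exists>M. \<forall>k\<ge>M. N (z - T l) \<le> 1 / (real k + 1) + L * N (x k - l)" by blast
  qed
  then have "z - T l = 0"
    using norm_nonneg[of "z - T l"] norm_eq_0[of "z - T l"] z TV[OF lU]
    by (simp add: subspace_V subspace_diff)
  then show "z \<in> T ` U" using lU by auto
qed

text \<open>Solving for \<open>T\<close> instead of \<open>S\<close> leaves the remainder \<open>T x - S x\<close>, which is at most half of the
  right-hand side.\<close>

lemma onto_modulo_stable:
  assumes S: "linear_into V V S" and L: "\<And>x. x \<in> V \<Longrightarrow> N (S x) \<le> L * N x"
    and T: "linear_into V V T"
    and G: "subspace G" "norm_closed G" "G \<subseteq> V" and "C \<ge> 0"
    and onto: "\<And>y. y \<in> V \<Longrightarrow> \<exists>x\<in>V. N x \<le> C * N y \<and> y - T x \<in> G"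
    and near: "\<And>x. x \<in> V \<Longrightarrow> N (T x - S x) \<le> e * N x" and "e \<ge> 0" and small: "C * e \<le> 1 / 2"
    and y: "y \<in> V"
  shows "\<exists>x\<in>V. N x \<le> 2 * C * N y \<and> y - S x \<in> G"
proof (rule successive_approximation[OF S L G order_refl \<open>C \<ge> 0\<close> _ y])
  fix y assume "y \<in> V"
  then obtain x where x: "x \<in> V" "N x \<le> C * N y" "y - T x \<in> G" using onto by blast
  have "N (T x - S x) \<le> e * (C * N y)"
    using near[OF x(1)] mult_left_mono[OF x(2) \<open>e \<ge> 0\<close>] by linarith
  also have "\<dots> = (C * e) * N y" by simp
  also have "\<dots> \<le> 1 / 2 * N y" using small norm_nonneg by (rule mult_right_mono)
  finally have "N (T x - S x) \<le> N y / 2" by simp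
  moreover have "T x - S x \<in> V"
    using S T x(1) by (auto simp: linear_into_def intro!: subspace_diff subspace_V)
  ultimately show "\<exists>x\<in>V. \<exists>g\<in>G. N x \<le> C * N y \<and> y - S x - g \<in> V \<and> N (y - S x - g) \<le> N y / 2"
    using x by (intro bexI[of _ x] bexI[of _ "y - T x"]) auto
qed

text \<open>The quantitative form of a closed range of finite codimension. The complement of the range is
  spanned by an almost orthogonal basis, so the component of \<open>y\<close> in the range has a norm controlled by
  that of \<open>y\<close>, and the open mapping theorem lifts it.\<close>

lemma onto_modulo_finite:
  assumes A: "linear_into V V A" and L: "\<And>x. x \<in> V \<Longrightarrow> N (A x) \<le> L * N x"
    and closed: "norm_closed (A ` V)" and codim: "codim_below V (A ` V) n"
  obtains k :: nat and u C where "\<And>j. j < k \<Longrightarrow> u j \<in> V" "C \<ge> 0"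
    "norm_closed {\<Sum>j<k. c j *\<^sub>R u j | c. True}"
    "\<And>y. y \<in> V \<Longrightarrow> \<exists>x\<in>V. N x \<le> C * N y \<and> y - A x \<in> {\<Sum>j<k. c j *\<^sub>R u j | c. True}"
proof -
  have R: "subspace (A ` V)" "A ` V \<subseteq> V"
    using A subspace_linear_image[OF A subspace_V] by (auto simp: linear_into_def)
  obtain k :: nat and u where u: "\<And>j. j < k \<Longrightarrow> u j \<in> V" "\<And>j. j < k \<Longrightarrow> N (u j) \<le> 1"
    "\<And>c y j. y \<in> A ` V \<Longrightarrow> j < k \<Longrightarrow> \<bar>c j\<bar> \<le> 3 ^ k * N ((\<Sum>j<k. c j *\<^sub>R u j) - y)"
    "\<And>z. z \<in> V \<Longrightarrow> \<exists>c. z - (\<Sum>j<k. c j *\<^sub>R u j) \<in> A ` V"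
    by (rule almost_orthogonal_basis[OF R(1) closed R(2) subspace_V order_refl codim]) blast
  obtain C where C: "C \<ge> 0" "\<And>y. y \<in> A ` V \<Longrightarrow> \<exists>x\<in>V. A x = y \<and> N x \<le> C * N y"
    by (rule open_mapping[OF A L closed]) (assumption, rule that)
  have 1: "norm_closed {\<Sum>j<k. c j *\<^sub>R u j | c. True}"
    by (rule norm_closed_coefficient_span[of _ _ "3 ^ k"])
      (use u(1) u(3)[OF subspace_0[OF R(1)]] in auto)
  have "\<exists>x\<in>V. N x \<le> C * (1 + k * 3 ^ k) * N y \<and> y - A x \<in> {\<Sum>j<k. c j *\<^sub>R u j | c. True}"
    if y: "y \<in> V" for y
  proof -
    obtain c where c: "y - (\<Sum>j<k. c j *\<^sub>R u j) \<in> A ` V" using u(4)[OF y] by blast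
    let ?s = "\<Sum>j<k. c j *\<^sub>R u j"
    have sV: "?s \<in> V" using u by (intro subspace_sum subspace_V subspace_scale) auto
    have "?s - y \<in> A ` V" using subspace_neg[OF R(1) c] by simp
    then have cb: "\<bar>c j\<bar> \<le> 3 ^ k * N y" if "j < k" for j
      using u(3)[of "?s - y" j c] that by simp
    have "N (y - ?s) \<le> N y + N ?s" by (rule norm_triangle_diff[OF y sV])
    also have "N ?s \<le> (\<Sum>j<k. \<bar>c j\<bar>) * 1" using u by (intro norm_sum_le) auto
    also have "\<dots> \<le> k * (3 ^ k * N y)"
      using sum_bounded_above[of "{..<k}" "\<lambda>j. \<bar>c j\<bar>"] cb by simp
    finally have b: "N (y - ?s) \<le> (1 + k * 3 ^ k) * N y" by (simp add: algebra_simps)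
    obtain x where x: "x \<in> V" "A x = y - ?s" "N x \<le> C * N (y - ?s)" using C(2)[OF c] by blast
    have "N x \<le> C * (1 + k * 3 ^ k) * N y"
      using x(3) mult_left_mono[OF b C(1)] by (simp add: mult.assoc)
    moreover have "y - A x = ?s" using x(2) by simp
    ultimately show ?thesis using x(1) by blast
  qed
  moreover have "C * (1 + k * 3 ^ k) \<ge> 0" using C(1) by simp
  ultimately show ?thesis using that u(1) 1 by blast
qed

end

section \<open>The sequence spaces\<close>

lemma powr_le_cancel_base:
  fixes a b q :: real
  assumes "0 \<le> b" "1 \<le> q" "a powr q \<le> b powr q"
  shows "a \<le> b"
  using assms powr_less_mono2[of q b a] by force

lemma norm_coordinate_le_lp_norm:
  assumes p: "p = 0 \<or> 1 \<le> p" and x: "x \<in> lp_space p"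
  shows "norm (x n) \<le> lp_norm p x"
proof (cases "p = 0 \<or> p = \<infinity>")
  case sup: True
  then show ?thesis
    using cSUP_upper[OF UNIV_I lp_norm_sup(2)[OF sup x], of n] lp_norm_sup(1)[OF sup x] by simp
next
  case False
  then have sum: "p \<noteq> 0" "p \<noteq> \<infinity>" by auto
  let ?q = "enn2real p"
  have s: "(\<lambda>n. norm (x n) powr ?q) summable_on UNIV" using x sum by (simp add: lp_space_def)
  have "(\<Sum>n\<in>{n}. norm (x n) powr ?q) \<le> (\<Sum>\<^sub>\<infinity>n. norm (x n) powr ?q)"
    by (rule finite_sum_le_infsum[OF s]) auto
  also have "\<dots> = lp_norm p x powr ?q" by (rule lp_norm_powr[OF p sum x])
  finally have "norm (x n) powr ?q \<le> lp_norm p x powr ?q" by simp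
  then show ?thesis
    by (rule powr_le_cancel_base[OF lp_norm_nonneg lp_exponent[OF p sum]])
qed

lemma lp_norm_scaleR:
  assumes p: "p = 0 \<or> 1 \<le> p"
  shows "lp_norm p (c *\<^sub>R x) = \<bar>c\<bar> * lp_norm p x"
proof (cases "c = 0")
  case True
  then show ?thesis by (simp add: lp_norm_def)
next
  case c: False
  show ?thesis
  proof (cases "x \<in> lp_space p")
    case x: True
    have le: "lp_norm p (a *\<^sub>R y) \<le> \<bar>a\<bar> * lp_norm p y" if "y \<in> lp_space p"
      for a and y :: "int \<Rightarrow> 'a"
      by (rule lp_dominated(2)[OF p that]) auto
    have "lp_norm p x \<le> \<bar>1 / c\<bar> * lp_norm p (c *\<^sub>R x)"
      using le[OF lp_space_scaleR[OF x], of "1 / c" c] c by simp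
    then have "\<bar>c\<bar> * lp_norm p x \<le> lp_norm p (c *\<^sub>R x)" using c by (simp add: field_simps)
    then show ?thesis using le[OF x, of c] by simp
  next
    case x: False
    have "c *\<^sub>R x \<notin> lp_space p"
    proof
      assume "c *\<^sub>R x \<in> lp_space p"
      from lp_space_scaleR[OF this, of "1 / c"] show False using x c by simp
    qed
    then show ?thesis using x by (simp add: lp_norm_def)
  qed
qed

lemma lp_norm_sup_le:
  assumes "p = 0 \<or> p = \<infinity>" "x \<in> lp_space p" "\<And>n. norm (x n) \<le> C"
  shows "lp_norm p x \<le> C"
  unfolding lp_norm_sup(1)[OF assms(1,2)] using assms(3) by (intro cSUP_least) auto

text \<open>Closed balls of \<open>l\<^sup>p\<close> are closed under coordinatewise limits (Fatou). This fails for
  \<open>p = 0\<close>: the truncations of a bounded sequence lie in a ball of \<open>l\<^sup>0\<close>.\<close>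

lemma lp_fatou:
  assumes p: "1 \<le> p" and y: "\<And>k::nat. y k \<in> lp_space p" "\<And>k. lp_norm p (y k) \<le> C"
    and lim: "\<And>n. (\<lambda>k. y k n) \<longlonglongrightarrow> x n"
  shows "x \<in> lp_space p" and "lp_norm p x \<le> C"
proof -
  have p': "p = 0 \<or> 1 \<le> p" and p0: "p \<noteq> 0" using p by auto
  have "x \<in> lp_space p \<and> lp_norm p x \<le> C"
  proof (cases "p = \<infinity>")
    case True
    have le: "norm (x n) \<le> C" for n
    proof (rule LIMSEQ_le_const2[OF tendsto_norm[OF lim[of n]]])
      show "\<exists>N. \<forall>k\<ge>N. norm (y k n) \<le> C"
        using norm_coordinate_le_lp_norm[OF p' y(1)] y(2) by (meson order_trans)
    qed
    then have "x \<in> lp_space p" using True p0 by (auto simp: lp_space_def bounded_iff)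
    then show ?thesis using lp_norm_sup_le[of p x C] le True by blast
  next
    case False
    let ?q = "enn2real p"
    have q: "1 \<le> ?q" by (rule lp_exponent[OF p' p0 False])
    have C: "C \<ge> 0" using lp_norm_nonneg[of p "y 0"] y(2)[of 0] by linarith
    have fin: "(\<Sum>n\<in>F. norm (x n) powr ?q) \<le> C powr ?q" if F: "finite F" for F
    proof (rule LIMSEQ_le_const2)
      show "(\<lambda>k. \<Sum>n\<in>F. norm (y k n) powr ?q) \<longlonglongrightarrow> (\<Sum>n\<in>F. norm (x n) powr ?q)"
        using q by (intro tendsto_sum tendsto_powr2 tendsto_norm lim tendsto_const always_eventually) auto
      have "(\<Sum>n\<in>F. norm (y k n) powr ?q) \<le> C powr ?q" for k
      proof -
        have s: "(\<lambda>n. norm (y k n) powr ?q) summable_on UNIV"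
          using y(1)[of k] p0 False by (simp add: lp_space_def)
        have "(\<Sum>n\<in>F. norm (y k n) powr ?q) \<le> (\<Sum>\<^sub>\<infinity>n. norm (y k n) powr ?q)"
          by (rule finite_sum_le_infsum[OF s F]) auto
        also have "\<dots> = lp_norm p (y k) powr ?q" by (rule lp_norm_powr[OF p' p0 False y(1)])
        also have "\<dots> \<le> C powr ?q" using y(2) lp_norm_nonneg q by (intro powr_mono2) auto
        finally show ?thesis .
      qed
      then show "\<exists>N. \<forall>k\<ge>N. (\<Sum>n\<in>F. norm (y k n) powr ?q) \<le> C powr ?q" by blast
    qed
    have s: "(\<lambda>n. norm (x n) powr ?q) summable_on UNIV"
      by (rule nonneg_bdd_above_summable_on) (use fin in \<open>auto intro!: bdd_aboveI2\<close>)
    then have x: "x \<in> lp_space p" using p0 False by (simp add: lp_space_def)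
    have "lp_norm p x powr ?q \<le> C powr ?q"
      unfolding lp_norm_powr[OF p' p0 False x, symmetric]
      by (rule infsum_le_finite_sums[OF s]) (use fin in auto)
    then have "lp_norm p x \<le> C" by (rule powr_le_cancel_base[OF C q])
    then show ?thesis using x by blast
  qed
  then show "x \<in> lp_space p" "lp_norm p x \<le> C" by blast+
qed

lemma subspace_lp: "p = 0 \<or> 1 \<le> p \<Longrightarrow> subspace (lp_space p)"
  by (simp add: subspace_def lp_space_zero lp_space_add lp_space_scaleR)

text \<open>The coordinatewise limit is the limit in norm: by Fatou's lemma if \<open>p \<noteq> 0\<close>, and for \<open>p = 0\<close> because
  a uniform limit of null sequences is a null sequence.\<close>

lemma lp_complete:
  fixes x :: "nat \<Rightarrow> int \<Rightarrow> 'a::banach"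
  assumes p: "p = 0 \<or> 1 \<le> p" and x: "\<And>k. x k \<in> lp_space p"
    and cauchy: "\<And>e. e > 0 \<Longrightarrow> \<exists>M. \<forall>m\<ge>M. \<forall>n\<ge>M. lp_norm p (x m - x n) < e"
  shows "\<exists>l\<in>lp_space p. (\<lambda>k. lp_norm p (x k - l)) \<longlonglongrightarrow> 0"
proof -
  have coord: "norm (x m n - x k n) \<le> lp_norm p (x m - x k)" for m k n
    using norm_coordinate_le_lp_norm[OF p lp_space_diff[OF p x x], of m k n] by simp
  have "Cauchy (\<lambda>k. x k n)" for n
  proof (rule metric_CauchyI)
    fix e :: real assume "e > 0"
    then obtain M where M: "\<forall>m\<ge>M. \<forall>n\<ge>M. lp_norm p (x m - x n) < e" using cauchy by blast
    have "dist (x m n) (x k n) < e" if "m \<ge> M" "k \<ge> M" for m k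
      using coord[of m n k] M that unfolding dist_norm by (meson le_less_trans)
    then show "\<exists>M. \<forall>m\<ge>M. \<forall>k\<ge>M. dist (x m n) (x k n) < e" by blast
  qed
  then have "\<forall>n. \<exists>l. (\<lambda>k. x k n) \<longlonglongrightarrow> l" by (simp add: Cauchy_convergent_iff convergent_def)
  from choice[OF this] obtain l where "\<forall>n. (\<lambda>k. x k n) \<longlonglongrightarrow> l n" by blast
  then have l: "(\<lambda>k. x k n) \<longlonglongrightarrow> l n" for n by blast
  have close: "\<exists>M. \<forall>k\<ge>M. x k - l \<in> lp_space p \<and> lp_norm p (x k - l) \<le> e" if e: "e > 0" for e
  proof -
    obtain M where M: "\<And>m k. m \<ge> M \<Longrightarrow> k \<ge> M \<Longrightarrow> lp_norm p (x m - x k) < e"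
      using cauchy[OF e] by blast
    have lim: "(\<lambda>m. (x k - x (m + M)) n) \<longlonglongrightarrow> (x k - l) n" for k n
      using LIMSEQ_ignore_initial_segment[OF l] by (simp add: tendsto_diff)
    have pointwise: "norm ((x k - l) n) \<le> e" if "k \<ge> M" for k n
    proof (rule LIMSEQ_le_const2[OF tendsto_norm[OF lim[of k n]]])
      have "norm ((x k - x (m + M)) n) \<le> e" for m
        using coord[of k n "m + M"] M[OF that, of "m + M"] by simp
      then show "\<exists>N. \<forall>m\<ge>N. norm ((x k - x (m + M)) n) \<le> e" by blast
    qed
    show ?thesis
    proof (cases "p = 0")
      case False
      then have "1 \<le> p" using p by blast
      then have "x k - l \<in> lp_space p \<and> lp_norm p (x k - l) \<le> e" if "k \<ge> M" for k
        using lp_fatou[of p "\<lambda>m. x k - x (m + M)" e, OF _ _ _ lim] lp_space_diff[OF p x x]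
          M[OF that] by (metis le_add2 less_imp_le)
      then show ?thesis by blast
    next
      case True
      have "l \<in> lp_space 0"
        unfolding lp_space_0_iff
      proof (intro allI impI)
        fix d :: real assume "d > 0"
        then have "d / 2 > 0" by simp
        then obtain K where K: "\<And>m k. m \<ge> K \<Longrightarrow> k \<ge> K \<Longrightarrow> lp_norm p (x m - x k) < d / 2"
          using cauchy by blast
        obtain B where B: "\<forall>n. B \<le> \<bar>n\<bar> \<longrightarrow> norm (x K n) < d / 2"
          using x[of K] \<open>d / 2 > 0\<close> unfolding True lp_space_0_iff by blast
        have "norm (l n) < d" if "B \<le> \<bar>n\<bar>" for n
        proof -
          have "(\<lambda>m. norm (x (m + K) n - x K n)) \<longlonglongrightarrow> norm (l n - x K n)"
            using LIMSEQ_ignore_initial_segment[OF l, of K n] by (intro tendsto_intros)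
          then have "norm (l n - x K n) \<le> d / 2"
          proof (rule LIMSEQ_le_const2)
            have "norm (x (m + K) n - x K n) \<le> d / 2" for m
              using coord[of "m + K" n K] K[of "m + K" K] by simp
            then show "\<exists>N. \<forall>m\<ge>N. norm (x (m + K) n - x K n) \<le> d / 2" by blast
          qed
          then show ?thesis using B that norm_triangle_sub[of "l n" "x K n"] by fastforce
        qed
        then show "\<exists>N. \<forall>n. N \<le> \<bar>n\<bar> \<longrightarrow> norm (l n) < d" by blast
      qed
      then have "x k - l \<in> lp_space p" for k using lp_space_diff[OF p x] True by blast
      then show ?thesis using lp_norm_sup_le[OF disjI1[OF True], of "x _ - l" e] pointwise
        by blast
    qed
  qed
  obtain k where "x k - l \<in> lp_space p" using close[of 1] by auto
  from lp_space_diff[OF p x this, of k] have "l \<in> lp_space p" by simp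
  moreover have "(\<lambda>k. lp_norm p (x k - l)) \<longlonglongrightarrow> 0"
  proof (rule LIMSEQ_I)
    fix e :: real assume "e > 0"
    then obtain M where "\<forall>k\<ge>M. x k - l \<in> lp_space p \<and> lp_norm p (x k - l) \<le> e / 2"
      using close[of "e / 2"] by auto
    moreover have "e / 2 < e" using \<open>e > 0\<close> by simp
    ultimately have "\<forall>k\<ge>M. norm (lp_norm p (x k - l) - 0) < e"
      by (auto simp: abs_of_nonneg[OF lp_norm_nonneg] intro: le_less_trans)
    then show "\<exists>M. \<forall>k\<ge>M. norm (lp_norm p (x k - l) - 0) < e" by blast
  qed
  ultimately show ?thesis by blast
qed

lemma banach_carrier_lp:
  assumes p: "p = 0 \<or> 1 \<le> p"
  shows "banach_carrier (lp_space p :: (int \<Rightarrow> 'a::banach) set) (lp_norm p)"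
proof unfold_locales
  show "subspace (lp_space p :: (int \<Rightarrow> 'a) set)" by (rule subspace_lp[OF p])
  show "\<exists>l\<in>lp_space p. (\<lambda>n. lp_norm p (x n - l)) \<longlonglongrightarrow> 0"
    if "\<And>n. x n \<in> lp_space p" "\<And>e. e > 0 \<Longrightarrow> \<exists>M. \<forall>m\<ge>M. \<forall>n\<ge>M. lp_norm p (x m - x n) < e"
    for x :: "nat \<Rightarrow> int \<Rightarrow> 'a"
    by (rule lp_complete[OF p that])
qed (use lp_norm_nonneg lp_norm_eq_0[OF p] lp_norm_scaleR[OF p] lp_norm_triangle[OF p] in auto)

lemma norm_closed_if_closedin_lp:
  assumes p: "p = 0 \<or> 1 \<le> p" and R: "closedin (lp_topology p) R"
  shows "normed_carrier.norm_closed (lp_space p) (lp_norm p) (R :: (int \<Rightarrow> 'a::banach) set)"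
proof -
  interpret L: banach_carrier "lp_space p :: (int \<Rightarrow> 'a) set" "lp_norm p" by (rule banach_carrier_lp[OF p])
  interpret M: Metric_space "lp_space p :: (int \<Rightarrow> 'a) set" "lp_dist p" by (rule Metric_space_lp[OF p])
  show ?thesis unfolding L.norm_closed_def
  proof (intro ballI impI)
    fix z :: "int \<Rightarrow> 'a" assume z: "z \<in> lp_space p" and near: "\<forall>e>0. \<exists>y\<in>R. lp_norm p (z - y) < e"
    show "z \<in> R"
    proof (rule ccontr)
      assume "z \<notin> R"
      then obtain r where r: "r > 0" "disjnt R (M.mball z r)"
        using R z unfolding lp_topology_def M.closedin_metric by blast
      then obtain y where "y \<in> R" "lp_norm p (z - y) < r" using near by blast
      moreover have "R \<subseteq> lp_space p" using R unfolding lp_topology_def M.closedin_metric by blast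
      ultimately show False using r z by (auto simp: disjnt_iff lp_dist_def)
    qed
  qed
qed

lemma linear_into_lp:
  "lp_bounded_operator p A \<Longrightarrow> linear_into (lp_space p) (lp_space p) A"
  unfolding lp_bounded_operator_def linear_into_def by blast

lemma lp_bounded_operator_bound:
  assumes "lp_bounded_operator p A"
  obtains C where "\<And>x. x \<in> lp_space p \<Longrightarrow> lp_norm p (A x) \<le> C * lp_norm p x"
  using assms unfolding lp_bounded_operator_def by blast

lemma band_dominated_approx:
  fixes A :: "(int \<Rightarrow> 'a::banach) \<Rightarrow> int \<Rightarrow> 'a"
  assumes p: "p = 0 \<or> 1 \<le> p" and A: "band_dominated p A" and "e > 0"
  obtains B where "band_operator B"
    "\<And>x. x \<in> lp_space p \<Longrightarrow> lp_norm p (A x - B x) \<le> e * lp_norm p x"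
proof -
  interpret L: banach_carrier "lp_space p :: (int \<Rightarrow> 'a) set" "lp_norm p" by (rule banach_carrier_lp[OF p])
  obtain B where B: "band_operator B" "lp_opnorm p (A - B) < e"
    using A \<open>e > 0\<close> unfolding band_dominated_def by blast
  have bA: "lp_bounded_operator p A" using A by (simp add: band_dominated_def)
  have bB: "lp_bounded_operator p B" by (rule lp_bounded_operator_band[OF p B(1)])
  note lA = linear_into_lp[OF bA] and lB = linear_into_lp[OF bB]
  obtain a b where a: "\<And>x. x \<in> lp_space p \<Longrightarrow> lp_norm p (A x) \<le> a * lp_norm p x"
    and b: "\<And>x. x \<in> lp_space p \<Longrightarrow> lp_norm p (B x) \<le> b * lp_norm p x"
    using lp_bounded_operator_bound[OF bA] lp_bounded_operator_bound[OF bB] by metis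
  have mem: "A x \<in> lp_space p" "B x \<in> lp_space p" if "x \<in> lp_space p" for x
    using lA lB that by (auto simp: linear_into_def)
  have bdd: "lp_norm p ((A - B) x) \<le> \<bar>a\<bar> + \<bar>b\<bar>" if x: "x \<in> lp_space p" "lp_norm p x \<le> 1" for x
  proof -
    have "c * lp_norm p x \<le> \<bar>c\<bar> * 1" for c
      using x(2) lp_norm_nonneg[of p x] by (intro mult_mono) auto
    from order_trans[OF a[OF x(1)] this] order_trans[OF b[OF x(1)] this]
    have "lp_norm p (A x) \<le> \<bar>a\<bar>" "lp_norm p (B x) \<le> \<bar>b\<bar>" by simp_all
    then show ?thesis using L.norm_triangle_diff[OF mem[OF x(1)]] by simp
  qed
  have "lp_norm p (A x - B x) \<le> e * lp_norm p x" if x: "x \<in> lp_space p" for x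
  proof (cases "lp_norm p x = 0")
    case True
    then have "x = 0" by (rule lp_norm_eq_0[OF p x])
    then show ?thesis using linear_into_zero[OF lA L.subspace_V] linear_into_zero[OF lB L.subspace_V] by simp
  next
    case False
    define t where "t = 1 / lp_norm p x"
    have t: "t > 0" using False lp_norm_nonneg[of p x] by (simp add: t_def)
    have y: "t *\<^sub>R x \<in> lp_space p" by (rule lp_space_scaleR[OF x])
    have "lp_norm p (t *\<^sub>R x) \<le> 1" using t False by (simp add: L.norm_scale t_def)
    then have "lp_norm p ((A - B) (t *\<^sub>R x)) \<le> lp_opnorm p (A - B)"
      unfolding lp_opnorm_def using y bdd
      by (intro cSUP_upper[where x = "t *\<^sub>R x" and f = "\<lambda>x. lp_norm p ((A - B) x)"] bdd_aboveI2) blast+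
    also have "\<dots> < e" by (rule B(2))
    also have "(A - B) (t *\<^sub>R x) = t *\<^sub>R (A x - B x)"
      using lA lB x by (simp add: linear_into_def scaleR_diff_right)
    finally have "t * lp_norm p (A x - B x) < e" using t by (simp only: L.norm_scale abs_of_pos)
    then show ?thesis using False lp_norm_nonneg[of p x] by (simp add: t_def field_simps)
  qed
  then show ?thesis using that B(1) by blast
qed

section \<open>Coordinates in a finite-dimensional space\<close>

text \<open>A basis \<open>u\<close> with its dual basis \<open>\<phi>\<close>. The coordinates provide \<open>d\<close> linear equations for each site, and
  their boundedness gives compactness.\<close>

locale finite_coordinates =
  fixes d :: nat and u :: "nat \<Rightarrow> 'a::banach" and \<phi> :: "nat \<Rightarrow> 'a \<Rightarrow> real"
  assumes expand: "x = (\<Sum>j<d. \<phi> j x *\<^sub>R u j)"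
    and bounded_linear: "j < d \<Longrightarrow> bounded_linear (\<phi> j)"
    and dual: "j < d \<Longrightarrow> \<phi> j (\<Sum>i<d. c i *\<^sub>R u i) = c j"

lemma finite_coordinates_exist:
  assumes "finite_dim (UNIV :: 'a::banach set)"
  obtains d and u :: "nat \<Rightarrow> 'a::banach" and \<phi> where "finite_coordinates d u \<phi>"
proof -
  interpret normed_carrier "UNIV :: 'a set" norm
    by unfold_locales (auto simp: norm_triangle_ineq)
  have 0: "subspace {0::'a}" by (simp add: subspace_def)
  obtain n where n: "codim_below (UNIV :: 'a set) {0} n"
    using assms finite_dim_iff_codim_below[OF subspace_UNIV] by blast
  obtain d :: nat and u where u: "\<And>c y j. y \<in> {0} \<Longrightarrow> j < d \<Longrightarrow> \<bar>c j\<bar> \<le> 3 ^ d * norm ((\<Sum>j<d. c j *\<^sub>R u j) - y)"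
    "\<And>z::'a. z \<in> UNIV \<Longrightarrow> \<exists>c. z - (\<Sum>j<d. c j *\<^sub>R u j) \<in> {0}"
    by (rule almost_orthogonal_basis[OF 0 norm_closed_0 _ subspace_UNIV _ n]) (simp, simp, rule that)
  have "\<forall>x. \<exists>c. x = (\<Sum>j<d. c j *\<^sub>R u j)" using u(2) by simp
  from choice[OF this] obtain \<psi> where \<psi>: "\<forall>x. x = (\<Sum>j<d. \<psi> x j *\<^sub>R u j)" by blast
  have bound: "\<bar>c j\<bar> \<le> 3 ^ d * norm (\<Sum>j<d. c j *\<^sub>R u j)" if "j < d" for c j
    using u(1)[of 0 j c] that by simp
  have unique: "c j = b j" if "j < d" "(\<Sum>j<d. c j *\<^sub>R u j) = (\<Sum>j<d. b j *\<^sub>R u j)" for b c j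
    using bound[OF that(1), of "\<lambda>j. c j - b j"] that(2) by (simp add: scaleR_diff_left sum_subtractf)
  have expand: "x = (\<Sum>j<d. \<psi> x j *\<^sub>R u j)" for x using \<psi> by blast
  have dual: "\<psi> (\<Sum>i<d. c i *\<^sub>R u i) j = c j" if "j < d" for c j
    using unique[OF that, of "\<psi> (\<Sum>i<d. c i *\<^sub>R u i)" c] expand by metis
  have bl: "bounded_linear (\<lambda>x. \<psi> x j)" if j: "j < d" for j
  proof (rule bounded_linear_intro)
    fix x y :: 'a and r :: real
    have "(\<Sum>j<d. \<psi> (x + y) j *\<^sub>R u j) = (\<Sum>j<d. (\<psi> x j + \<psi> y j) *\<^sub>R u j)"
      unfolding scaleR_add_left sum.distrib expand[symmetric] ..
    then show "\<psi> (x + y) j = \<psi> x j + \<psi> y j" by (rule unique[OF j])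
    have "(\<Sum>j<d. \<psi> (r *\<^sub>R x) j *\<^sub>R u j) = (\<Sum>j<d. (r * \<psi> x j) *\<^sub>R u j)"
      unfolding scaleR_scaleR[symmetric] scaleR_sum_right[symmetric] expand[symmetric] ..
    then show "\<psi> (r *\<^sub>R x) j = r *\<^sub>R \<psi> x j" using unique[OF j] by simp
    show "norm (\<psi> x j) \<le> norm x * 3 ^ d"
      using bound[OF j, of "\<psi> x"] unfolding expand[symmetric] by (simp add: mult.commute)
  qed
  have "finite_coordinates d u (\<lambda>j x. \<psi> x j)" by (intro finite_coordinates.intro expand bl dual)
  then show ?thesis by (rule that)
qed

context finite_coordinates
begin

lemma eq_0_if_coordinates: "(\<And>j. j < d \<Longrightarrow> \<phi> j x = 0) \<Longrightarrow> x = 0"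
  by (subst expand) simp

lemma linear_sum: "j < d \<Longrightarrow> \<phi> j (\<Sum>i\<in>I. c i *\<^sub>R x i) = (\<Sum>i\<in>I. c i * \<phi> j (x i))"
  using linear_sum[of "\<phi> j" "\<lambda>i. c i *\<^sub>R x i" I] bounded_linear.linear[OF bounded_linear, of j]
  by (simp add: linear_cmul)

text \<open>Together with Fatou's lemma this plays the part of weak-star compactness of the closed balls of
  \<open>l\<^sup>p\<close>.\<close>

lemma bounded_sequence_compact:
  fixes x :: "nat \<Rightarrow> int \<Rightarrow> 'a"
  assumes "\<And>k n. norm (x k n) \<le> C"
  obtains r y where "strict_mono r" "\<And>n. (\<lambda>k. x (r k) n) \<longlonglongrightarrow> y n"
proof -
  define f where "f k i = (if snd i < d then \<phi> (snd i) (x k (fst i)) else 0)" for k and i :: "int \<times> nat"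
  have "bounded (range (\<lambda>k. f k i))" for i
  proof (cases "snd i < d")
    case True
    obtain K where K: "\<And>z. norm (\<phi> (snd i) z) \<le> norm z * K" "K > 0"
      using bounded_linear.pos_bounded[OF bounded_linear[OF True]] by auto
    have "norm (f k i) \<le> C * K" for k
      using K(1)[of "x k (fst i)"] assms[of k "fst i"] K(2) True
      by (simp add: f_def) (meson less_imp_le mult_right_mono order_trans)
    then show ?thesis by (auto simp: bounded_iff)
  qed (auto simp: f_def bounded_iff)
  then obtain r g where r: "strict_mono r" "\<And>i. (\<lambda>k. f (r k) i) \<longlonglongrightarrow> g i"
    by (rule pointwise_convergent_subsequence[of f]) blast
  have "(\<lambda>k. x (r k) n) \<longlonglongrightarrow> (\<Sum>j<d. g (n, j) *\<^sub>R u j)" for n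
  proof -
    have "(\<lambda>k. \<Sum>j<d. \<phi> j (x (r k) n) *\<^sub>R u j) \<longlonglongrightarrow> (\<Sum>j<d. g (n, j) *\<^sub>R u j)"
    proof (intro tendsto_sum tendsto_scaleR tendsto_const)
      fix j assume "j \<in> {..<d}"
      then show "(\<lambda>k. \<phi> j (x (r k) n)) \<longlonglongrightarrow> g (n, j)" using r(2)[of "(n, j)"] by (simp add: f_def)
    qed
    then show ?thesis unfolding expand[symmetric] .
  qed
  then show ?thesis by (rule that[OF r(1)])
qed

end

section \<open>Band operators\<close>

text \<open>Continuity under coordinatewise limits holds for any coordinatewise convergent sequence, bounded
  or not, because each entry of \<open>B x\<close> depends on finitely many entries of \<open>x\<close>.\<close>

lemma band_operator_local:
  fixes B :: "(int \<Rightarrow> 'a::real_normed_vector) \<Rightarrow> int \<Rightarrow> 'a"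
  assumes "band_operator B"
  obtains w :: nat where "linear_into UNIV UNIV B"
    "\<And>x y n. (\<And>i. \<bar>i - n\<bar> \<le> int w \<Longrightarrow> x i = y i) \<Longrightarrow> B x n = B y n"
    "\<And>x y n. (\<And>i. (\<lambda>k::nat. x k i) \<longlonglongrightarrow> y i) \<Longrightarrow> (\<lambda>k. B (x k) n) \<longlonglongrightarrow> B y n"
proof -
  obtain S a where S: "finite S" and B: "B = (\<Sum>\<alpha>\<in>S. mult_operator (a \<alpha>) \<circ> shift \<alpha>)"
    using assms unfolding band_operator_def by blast
  have "(\<Sum>\<alpha>\<in>S. mult_operator (a \<alpha>) \<circ> shift \<alpha>) x n = (\<Sum>\<alpha>\<in>S. blinfun_apply (a \<alpha> n) (x (n - \<alpha>)))" for x n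
    using S by (induction S rule: finite_induct) (auto simp: mult_operator_def shift_def)
  then have Bx: "B x n = (\<Sum>\<alpha>\<in>S. blinfun_apply (a \<alpha> n) (x (n - \<alpha>)))" for x n
    unfolding B by blast
  have "linear_into UNIV UNIV B"
    by (auto simp: linear_into_def fun_eq_iff Bx blinfun.add_right blinfun.scaleR_right sum.distrib scaleR_sum_right)
  moreover have "B x n = B y n"
    if eq: "\<And>i. \<bar>i - n\<bar> \<le> int (\<Sum>\<alpha>\<in>S. nat \<bar>\<alpha>\<bar>) \<Longrightarrow> x i = y i" for x y n
    unfolding Bx
  proof (intro sum.cong refl arg_cong[of _ _ "blinfun_apply _"] eq)
    fix \<alpha> assume "\<alpha> \<in> S"
    then have "nat \<bar>\<alpha>\<bar> \<le> (\<Sum>\<alpha>\<in>S. nat \<bar>\<alpha>\<bar>)" using S by (intro member_le_sum) auto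
    then show "\<bar>n - \<alpha> - n\<bar> \<le> int (\<Sum>\<alpha>\<in>S. nat \<bar>\<alpha>\<bar>)" by linarith
  qed
  moreover have "(\<lambda>k. B (x k) n) \<longlonglongrightarrow> B y n" if "\<And>i. (\<lambda>k::nat. x k i) \<longlonglongrightarrow> y i" for x y n
    unfolding Bx by (intro tendsto_sum bounded_linear.tendsto[OF blinfun.bounded_linear_right] that)
  ultimately show ?thesis by (rule that)
qed

section \<open>Band operators in finite windows\<close>

lemma sum_fun_apply: "(\<Sum>j\<in>J. f j) i = (\<Sum>j\<in>J. f j i)" for f :: "'j \<Rightarrow> 'i \<Rightarrow> 'b::comm_monoid_add"
  by (induction J rule: infinite_finite_induct) auto

text \<open>Independent sequences are already independent on a finite window, with a constant. Otherwise
  normalised coefficient vectors, giving smaller and smaller combinations on larger and larger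
  windows, would accumulate at the coefficients of a relation that holds everywhere. The factor
  \<open>m + 1\<close> lets one number serve as the size of the window and as the constant.\<close>

lemma independent_on_window:
  fixes v :: "nat \<Rightarrow> int \<Rightarrow> 'a::real_normed_vector"
  assumes indep: "\<And>c. (\<Sum>j<n. c j *\<^sub>R v j) = 0 \<Longrightarrow> \<forall>j<n. c j = 0"
  shows "\<exists>m::nat. \<forall>c. (\<forall>i. \<bar>i\<bar> \<le> int m \<longrightarrow>
      (real m + 1) * norm (\<Sum>j<n. c j *\<^sub>R v j i) \<le> (\<Sum>j<n. \<bar>c j\<bar>)) \<longrightarrow> (\<forall>j<n. c j = 0)"
proof (rule ccontr)
  assume none: "\<not> ?thesis"
  have "\<forall>m::nat. \<exists>c. (\<Sum>j<n. \<bar>c j\<bar>) = 1 \<and>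
    (\<forall>i. \<bar>i\<bar> \<le> int m \<longrightarrow> (real m + 1) * norm (\<Sum>j<n. c j *\<^sub>R v j i) \<le> 1)"
  proof
    fix m :: nat
    obtain c where c: "\<And>i. \<bar>i\<bar> \<le> int m \<Longrightarrow>
        (real m + 1) * norm (\<Sum>j<n. c j *\<^sub>R v j i) \<le> (\<Sum>j<n. \<bar>c j\<bar>)" "\<exists>j<n. c j \<noteq> 0"
      using none by blast
    obtain s where s: "s > 0" "(\<Sum>j<n. \<bar>s * c j\<bar>) = 1" using normalise_coefficients[OF c(2)] by blast
    have "(real m + 1) * norm (\<Sum>j<n. (s * c j) *\<^sub>R v j i) \<le> 1" if i: "\<bar>i\<bar> \<le> int m" for i
    proof -
      have "norm (\<Sum>j<n. (s * c j) *\<^sub>R v j i) = s * norm (\<Sum>j<n. c j *\<^sub>R v j i)"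
        using s(1) by (simp add: scaleR_scaleR[symmetric] scaleR_sum_right[symmetric] del: scaleR_scaleR)
      then have "(real m + 1) * norm (\<Sum>j<n. (s * c j) *\<^sub>R v j i)
          = s * ((real m + 1) * norm (\<Sum>j<n. c j *\<^sub>R v j i))" by simp
      also have "\<dots> \<le> s * (\<Sum>j<n. \<bar>c j\<bar>)" using c(1)[OF i] s(1) by (intro mult_left_mono) auto
      also have "\<dots> = 1" using s by (simp add: abs_mult sum_distrib_left)
      finally show ?thesis .
    qed
    then show "\<exists>c. (\<Sum>j<n. \<bar>c j\<bar>) = 1 \<and>
        (\<forall>i. \<bar>i\<bar> \<le> int m \<longrightarrow> (real m + 1) * norm (\<Sum>j<n. c j *\<^sub>R v j i) \<le> 1)"
      using s(2) by (intro exI[of _ "\<lambda>j. s * c j"]) blast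
  qed
  from choice[OF this] obtain c where "\<forall>m. (\<Sum>j<n. \<bar>c m j\<bar>) = 1 \<and>
    (\<forall>i. \<bar>i\<bar> \<le> int m \<longrightarrow> (real m + 1) * norm (\<Sum>j<n. c m j *\<^sub>R v j i) \<le> 1)" by blast
  then have c: "(\<Sum>j<n. \<bar>c m j\<bar>) = 1"
    "\<bar>i\<bar> \<le> int m \<Longrightarrow> (real m + 1) * norm (\<Sum>j<n. c m j *\<^sub>R v j i) \<le> 1" for m i by blast+
  obtain r g where r: "strict_mono r" and g: "\<And>j. j < n \<Longrightarrow> (\<lambda>k. c (r k) j) \<longlonglongrightarrow> g j"
    and nz: "\<exists>j<n. g j \<noteq> 0"
    by (rule unit_coefficients_subsequence[of c n, OF c(1)]) blast
  have zero: "(\<Sum>j<n. g j *\<^sub>R v j i) = 0" for i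
  proof -
    have "(\<lambda>k. norm (\<Sum>j<n. c (r k) j *\<^sub>R v j i)) \<longlonglongrightarrow> norm (\<Sum>j<n. g j *\<^sub>R v j i)"
      using g by (intro tendsto_norm tendsto_sum tendsto_scaleR tendsto_const) auto
    moreover have "(\<lambda>k. norm (\<Sum>j<n. c (r k) j *\<^sub>R v j i)) \<longlonglongrightarrow> 0"
    proof (rule tendsto_sandwich[OF _ _ tendsto_const])
      show "(\<lambda>k. inverse (real (Suc k))) \<longlonglongrightarrow> 0" by (rule LIMSEQ_inverse_real_of_nat)
      have "norm (\<Sum>j<n. c (r k) j *\<^sub>R v j i) \<le> inverse (real (Suc k))" if "k \<ge> nat \<bar>i\<bar>" for k
      proof -
        have k: "k \<le> r k" by (rule seq_suble[OF r])
        then have "\<bar>i\<bar> \<le> int (r k)" using that by linarith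
        from c(2)[OF this] have "norm (\<Sum>j<n. c (r k) j *\<^sub>R v j i) \<le> 1 / (real (r k) + 1)"
          by (simp add: field_simps)
        also have "\<dots> \<le> 1 / real (Suc k)" using k by (intro divide_left_mono) auto
        finally show ?thesis by (simp add: inverse_eq_divide)
      qed
      then show "\<forall>\<^sub>F k in sequentially. norm (\<Sum>j<n. c (r k) j *\<^sub>R v j i) \<le> inverse (real (Suc k))"
        unfolding eventually_sequentially by blast
    qed simp
    ultimately have "norm (\<Sum>j<n. g j *\<^sub>R v j i) = 0" by (rule LIMSEQ_unique)
    then show ?thesis by simp
  qed
  then have "(\<Sum>j<n. g j *\<^sub>R v j) = 0" by (simp add: fun_eq_iff sum_fun_apply)
  then show False using indep nz by blast
qed

lemma finite_support_in_lp:
  assumes "finite {n. x n \<noteq> 0}"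
  shows "x \<in> lp_space p"
proof -
  consider "p = 0" | "p = \<infinity>" "p \<noteq> 0" | "p \<noteq> 0" "p \<noteq> \<infinity>" by blast
  then show ?thesis
  proof cases
    case 1
    have "bdd_above (abs ` {n. x n \<noteq> 0})" using assms by (intro bdd_above_finite finite_imageI)
    then obtain K where K: "\<And>n. x n \<noteq> 0 \<Longrightarrow> \<bar>n\<bar> \<le> K" by (auto simp: bdd_above_def)
    have "\<forall>n. K + 1 \<le> \<bar>n\<bar> \<longrightarrow> norm (x n) < e" if "e > 0" for e
    proof (intro allI impI)
      fix n assume "K + 1 \<le> \<bar>n\<bar>"
      then have "x n = 0" using K[of n] by linarith
      then show "norm (x n) < e" using that by simp
    qed
    then show ?thesis unfolding 1 lp_space_0_iff by blast
  next
    case 2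
    have "range x \<subseteq> insert 0 (x ` {n. x n \<noteq> 0})" by auto
    then have "finite (range x)" using assms by (meson finite.insertI finite_imageI finite_subset)
    then show ?thesis using 2 by (simp add: lp_space_def finite_imp_bounded)
  next
    case 3
    have "(\<lambda>n. norm (x n) powr enn2real p) summable_on {n. x n \<noteq> 0}" using assms by (rule summable_on_finite)
    then have "(\<lambda>n. norm (x n) powr enn2real p) summable_on UNIV"
      by (rule summable_on_cong_neutral[THEN iffD1, rotated -1]) auto
    then show ?thesis using 3 by (simp add: lp_space_def)
  qed
qed

context finite_coordinates
begin

definition unit_vector :: "int \<times> nat \<Rightarrow> int \<Rightarrow> 'a" where
  "unit_vector q = (\<lambda>l. if l = fst q then u (snd q) else 0)"

lemma unit_vector_in_lp: "unit_vector q \<in> lp_space p"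
  by (rule finite_support_in_lp) (auto simp: unit_vector_def)

lemma block_apply:
  assumes "finite P"
  shows "(\<Sum>q\<in>P \<times> {..<d}. \<alpha> q *\<^sub>R unit_vector q) l = (if l \<in> P then \<Sum>a<d. \<alpha> (l, a) *\<^sub>R u a else 0)"
proof -
  have "(\<Sum>q\<in>P \<times> {..<d}. \<alpha> q *\<^sub>R unit_vector q) l = (\<Sum>i\<in>P. \<Sum>a<d. \<alpha> (i, a) *\<^sub>R unit_vector (i, a) l)"
    by (simp add: sum_fun_apply sum.cartesian_product split_def)
  also have "\<dots> = (\<Sum>i\<in>P. if l = i then \<Sum>a<d. \<alpha> (i, a) *\<^sub>R u a else 0)"
    by (intro sum.cong refl) (auto simp: unit_vector_def)
  finally show ?thesis using assms by (simp add: sum.delta)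
qed

lemma block_eq_0:
  assumes "finite P" and "\<And>l. l \<in> P \<Longrightarrow> (\<Sum>q\<in>P \<times> {..<d}. \<alpha> q *\<^sub>R unit_vector q) l = 0"
    and "q \<in> P \<times> {..<d}"
  shows "\<alpha> q = 0"
proof -
  obtain l a where q: "q = (l, a)" "l \<in> P" "a < d" using assms(3) by auto
  have "(\<Sum>a<d. \<alpha> (l, a) *\<^sub>R u a) = 0" using assms(2)[OF q(2)] q(2) unfolding block_apply[OF assms(1)] by simp
  then have "\<phi> a 0 = \<alpha> (l, a)" using dual[OF q(3), of "\<lambda>a. \<alpha> (l, a)"] by simp
  then show ?thesis
    using q(1) linear_0[OF bounded_linear.linear[OF bounded_linear[OF q(3)]]] by simp
qed

text \<open>The unknowns are the coefficients of \<open>v 0\<close>, ..., \<open>v (N - 1)\<close> and those of a vector \<open>x\<close> supported on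
  the sites \<open>m < \<bar>i\<bar> \<le> n\<close>; the equations say that \<open>B x\<close> cancels the combination of the \<open>v j\<close> on the
  window \<open>\<bar>i\<bar> \<le> n + w\<close>, outside of which \<open>B x\<close> vanishes anyway. There are \<open>2 (n - m) d + N\<close> unknowns and
  \<open>(2 (n + w) + 1) d\<close> equations, so the condition on \<open>N\<close> does not involve \<open>n\<close>. Injectivity of \<open>B\<close> excludes a
  solution in which only \<open>x\<close> is nonzero.\<close>

lemma band_window_relation:
  fixes B :: "(int \<Rightarrow> 'a) \<Rightarrow> int \<Rightarrow> 'a" and m n w :: nat
  assumes B: "linear_into UNIV UNIV B"
    and local: "\<And>x y n. (\<And>i. \<bar>i - n\<bar> \<le> int w \<Longrightarrow> x i = y i) \<Longrightarrow> B x n = B y n"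
    and inj: "\<And>x. x \<in> lp_space p \<Longrightarrow> (\<And>i. \<bar>i\<bar> \<le> int m \<Longrightarrow> x i = 0) \<Longrightarrow> B x = 0 \<Longrightarrow> x = 0"
    and n: "m \<le> n" and N: "(2 * w + 2 * m + 1) * d < N"
  obtains c x where "(\<Sum>j<N. \<bar>c j\<bar>) = 1" "x \<in> lp_space p" "\<And>i. \<bar>i\<bar> \<le> int m \<Longrightarrow> x i = 0"
    "\<And>i. \<bar>i\<bar> \<le> int (n + w) \<Longrightarrow> B x i = (\<Sum>j<N. c j *\<^sub>R v j i)"
    "\<And>i. \<bar>i\<bar> > int (n + w) \<Longrightarrow> B x i = 0"
proof -
  define P where "P = {- int n..int n} - {- int m..int m}"
  define Q where "Q = {- int (n + w)..int (n + w)}"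
  define I where "I = (P \<times> {..<d}) <+> {..<N}"
  define f where "f t s = (case t of Inl q \<Rightarrow> \<phi> (snd s) (B (unit_vector q) (fst s))
      | Inr j \<Rightarrow> \<phi> (snd s) (v j (fst s)))" for t :: "(int \<times> nat) + nat" and s :: "int \<times> nat"
  have fin: "finite P" by (simp add: P_def)
  have cardP: "card P = 2 * n - 2 * m"
  proof -
    have "card P = card {- int n..int n} - card {- int m..int m}"
      unfolding P_def using n by (intro card_Diff_subset) auto
    then show ?thesis by simp
  qed
  have cardQ: "card Q = 2 * (n + w) + 1" by (simp add: Q_def)
  have "card (Q \<times> {..<d}) < card I"
  proof -
    have "card (Q \<times> {..<d}) = (2 * n - 2 * m) * d + (2 * w + 2 * m + 1) * d"
      unfolding card_cartesian_product cardQ card_lessThan using n by (simp flip: add_mult_distrib)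
    also have "\<dots> < (2 * n - 2 * m) * d + N" using N by simp
    also have "\<dots> = card I" using fin by (simp add: I_def card_Plus card_cartesian_product cardP)
    finally show ?thesis .
  qed
  then obtain c where c: "\<exists>t\<in>I. c t \<noteq> 0" "\<forall>s\<in>Q \<times> {..<d}. (\<Sum>t\<in>I. c t * f t s) = 0"
    using underdetermined_system[of "Q \<times> {..<d}" I f] fin by (auto simp: I_def Q_def)
  define y where "y = (\<Sum>q\<in>P \<times> {..<d}. c (Inl q) *\<^sub>R unit_vector q)"
  define s where "s i = (\<Sum>j<N. c (Inr j) *\<^sub>R v j i)" for i
  have By: "B y i = (\<Sum>q\<in>P \<times> {..<d}. c (Inl q) *\<^sub>R B (unit_vector q) i)" for i
    unfolding y_def using linear_into_sum[OF B subspace_UNIV, of "P \<times> {..<d}" unit_vector "\<lambda>q. c (Inl q)"]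
    by (simp add: sum_fun_apply)
  have inside: "B y i + s i = 0" if i: "\<bar>i\<bar> \<le> int (n + w)" for i
  proof (rule eq_0_if_coordinates)
    fix b assume b: "b < d"
    have "(i, b) \<in> Q \<times> {..<d}" using i b by (auto simp: Q_def)
    then have "(\<Sum>t\<in>I. c t * f t (i, b)) = 0" using c(2) by blast
    then have "(\<Sum>q\<in>P \<times> {..<d}. c (Inl q) * \<phi> b (B (unit_vector q) i)) + (\<Sum>j<N. c (Inr j) * \<phi> b (v j i)) = 0"
      using fin by (simp add: I_def sum.Plus f_def)
    then show "\<phi> b (B y i + s i) = 0"
      unfolding By s_def linear_add[OF bounded_linear.linear[OF bounded_linear[OF b]]] linear_sum[OF b] .
  qed
  have y0: "y i = 0" if "i \<notin> P" for i using that unfolding y_def block_apply[OF fin] by simp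
  have outside: "B y i = 0" if "\<bar>i\<bar> > int (n + w)" for i
  proof -
    have "B y i = B 0 i"
    proof (rule local)
      fix l assume "\<bar>l - i\<bar> \<le> int w"
      then have "l \<notin> P" using that by (auto simp: P_def)
      then show "y l = 0 l" using y0 by simp
    qed
    then show ?thesis using linear_into_zero[OF B subspace_UNIV] by simp
  qed
  have y: "y \<in> lp_space p" "\<And>i. \<bar>i\<bar> \<le> int m \<Longrightarrow> y i = 0"
  proof -
    have "{i. y i \<noteq> 0} \<subseteq> P" using y0 by blast
    then show "y \<in> lp_space p" using fin by (intro finite_support_in_lp) (rule finite_subset)
    show "y i = 0" if "\<bar>i\<bar> \<le> int m" for i using that by (intro y0) (auto simp: P_def)
  qed
  have "\<exists>j<N. c (Inr j) \<noteq> 0"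
  proof (rule ccontr)
    assume not: "\<not> (\<exists>j<N. c (Inr j) \<noteq> 0)"
    then have "s i = 0" for i by (simp add: s_def)
    then have "B y i = 0" for i using inside[of i] outside[of i] by (cases "\<bar>i\<bar> \<le> int (n + w)") auto
    then have "B y = 0" by (simp add: fun_eq_iff)
    from inj[OF y(1) y(2) this] have "y = 0" by simp
    then have "c (Inl q) = 0" if "q \<in> P \<times> {..<d}" for q
      using block_eq_0[OF fin _ that, of "\<lambda>q. c (Inl q)"] by (simp add: y_def)
    then show False using c(1) not by (auto simp: I_def)
  qed
  from normalise_coefficients[OF this] obtain r where r: "r > 0" "(\<Sum>j<N. \<bar>r * c (Inr j)\<bar>) = 1" by blast
  have scaled: "B ((- r) *\<^sub>R y) i = (- r) *\<^sub>R B y i" for i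
    using B unfolding linear_into_def by (metis UNIV_I scaleR_fun_apply)
  show ?thesis
  proof (rule that[OF r(2) lp_space_scaleR[OF y(1), of "- r"]])
    show "((- r) *\<^sub>R y) i = 0" if "\<bar>i\<bar> \<le> int m" for i using y(2)[OF that] by simp
    show "B ((- r) *\<^sub>R y) i = (\<Sum>j<N. (r * c (Inr j)) *\<^sub>R v j i)" if "\<bar>i\<bar> \<le> int (n + w)" for i
    proof -
      have "B y i = - s i" using inside[OF that] by (simp add: eq_neg_iff_add_eq_0)
      then show ?thesis unfolding scaled s_def by (simp add: scaleR_sum_right sum_negf)
    qed
    show "B ((- r) *\<^sub>R y) i = 0" if "\<bar>i\<bar> > int (n + w)" for i
      unfolding scaled using outside[OF that] by simp
  qed
qed

text \<open>Let \<open>z q\<close> solve \<open>B (z q) = e q\<close> modulo \<open>G\<close>, where the \<open>e q\<close> are the unit vectors of the window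
  \<open>\<bar>i\<bar> \<le> m\<close>. Too many independent vectors \<open>v j\<close> in the preimage of \<open>G\<close> would admit a combination \<open>\<zeta>\<close> of the
  \<open>z q\<close> and the \<open>v j\<close> that vanishes on \<open>\<bar>i\<bar> \<le> m + w\<close> and for which the components of \<open>B \<zeta>\<close> in \<open>G\<close> cancel.
  Then \<open>B \<zeta>\<close> is the corresponding combination of the \<open>e q\<close>, and it vanishes on the window, so the
  \<open>z q\<close> have coefficients \<open>0\<close>. What remains is a combination of the \<open>v j\<close> that vanishes on the window,
  which is impossible if \<open>m\<close> is large.\<close>

lemma band_dim_preimage:
  fixes B :: "(int \<Rightarrow> 'a) \<Rightarrow> int \<Rightarrow> 'a" and k :: nat
  assumes band: "band_operator B" and G: "G = {\<Sum>l<k. \<gamma> l *\<^sub>R g l | \<gamma>. True}"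
    and onto: "\<And>y. y \<in> lp_space p \<Longrightarrow> \<exists>x\<in>lp_space p. y - B x \<in> G"
  shows "\<exists>n. codim_below {x\<in>lp_space p. B x \<in> G} {0} n"
proof -
  obtain w :: nat where B: "linear_into UNIV UNIV B"
    and local: "\<And>x y n. (\<And>i. \<bar>i - n\<bar> \<le> int w \<Longrightarrow> x i = y i) \<Longrightarrow> B x n = B y n"
    by (rule band_operator_local[OF band]) blast
  define N where "N = 2 * w * d + k + 1"
  have "codim_below {x\<in>lp_space p. B x \<in> G} {0} N"
  proof (rule ccontr)
    assume "\<not> codim_below {x\<in>lp_space p. B x \<in> G} {0} N"
    then obtain v where v: "\<forall>j<N. v j \<in> {x\<in>lp_space p. B x \<in> G}"
      and indep: "\<And>c. (\<Sum>j<N. c j *\<^sub>R v j) = 0 \<Longrightarrow> \<forall>j<N. c j = 0"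
      unfolding codim_below_def by blast
    obtain m :: nat where window: "\<forall>c. (\<forall>i. \<bar>i\<bar> \<le> int m \<longrightarrow>
        (real m + 1) * norm (\<Sum>j<N. c j *\<^sub>R v j i) \<le> (\<Sum>j<N. \<bar>c j\<bar>)) \<longrightarrow> (\<forall>j<N. c j = 0)"
      using independent_on_window[where n = N and v = v] indep by blast
    have "\<forall>j\<in>{..<N}. \<exists>\<delta>. B (v j) = (\<Sum>l<k. \<delta> l *\<^sub>R g l)" using v unfolding G by blast
    from bchoice[OF this] obtain \<delta> where \<delta>: "\<And>j. j < N \<Longrightarrow> B (v j) = (\<Sum>l<k. \<delta> j l *\<^sub>R g l)" by blast
    have "\<forall>q. \<exists>z. unit_vector q - B z \<in> G"
      using onto[OF unit_vector_in_lp] by blast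
    from choice[OF this] obtain z where "\<forall>q. unit_vector q - B (z q) \<in> G" by blast
    then have "\<forall>q. \<exists>\<gamma>. unit_vector q - B (z q) = (\<Sum>l<k. \<gamma> l *\<^sub>R g l)" unfolding G by blast
    from choice[OF this] obtain \<gamma> where "\<forall>q. unit_vector q - B (z q) = (\<Sum>l<k. \<gamma> q l *\<^sub>R g l)" by blast
    then have "unit_vector q - B (z q) = (\<Sum>l<k. \<gamma> q l *\<^sub>R g l)" for q by blast
    then have z: "B (z q) = unit_vector q - (\<Sum>l<k. \<gamma> q l *\<^sub>R g l)" for q
      unfolding eq_diff_eq by (metis add.commute diff_eq_eq)
    define P where "P = {- int m..int m}"
    define Q where "Q = {- int (m + w)..int (m + w)}"
    define I where "I = (P \<times> {..<d}) <+> {..<N}"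
    define J where "J = (Q \<times> {..<d}) <+> {..<k}"
    \<comment> \<open>The equations \<open>Inr l\<close> count the component along \<open>g l\<close>: \<open>z q\<close> contributes \<open>- \<gamma> q l\<close> and \<open>v j\<close>
      contributes \<open>\<delta> j l\<close> to \<open>B \<zeta>\<close>, here with the signs reversed.\<close>
    define f where "f t s = (case t of
        Inl q \<Rightarrow> (case s of Inl i \<Rightarrow> \<phi> (snd i) (z q (fst i)) | Inr l \<Rightarrow> \<gamma> q l)
      | Inr j \<Rightarrow> (case s of Inl i \<Rightarrow> \<phi> (snd i) (v j (fst i)) | Inr l \<Rightarrow> - \<delta> j l))"
      for t :: "(int \<times> nat) + nat" and s :: "(int \<times> nat) + nat"
    have fin: "finite P" "finite I" "finite J" and finQ: "finite Q"
      by (simp_all add: P_def Q_def I_def J_def)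
    have "card P = 2 * m + 1" "card Q = 2 * (m + w) + 1" by (simp_all add: P_def Q_def)
    then have "card J < card I" using fin(1) finQ
      by (simp add: I_def J_def N_def card_Plus card_cartesian_product algebra_simps)
    from underdetermined_system[OF fin(3,2) this, of f] obtain c
      where c: "\<exists>t\<in>I. c t \<noteq> 0" "\<forall>s\<in>J. (\<Sum>t\<in>I. c t * f t s) = 0" by blast
    define \<alpha> where "\<alpha> q = c (Inl q)" for q
    define \<beta> where "\<beta> j = c (Inr j)" for j
    have eqn: "(\<Sum>q\<in>P \<times> {..<d}. \<alpha> q * f (Inl q) s) + (\<Sum>j<N. \<beta> j * f (Inr j) s) = 0" if "s \<in> J" for s
      using c(2) that fin(1) by (simp add: I_def sum.Plus \<alpha>_def \<beta>_def)
    define \<zeta> where "\<zeta> = (\<Sum>q\<in>P \<times> {..<d}. \<alpha> q *\<^sub>R z q) + (\<Sum>j<N. \<beta> j *\<^sub>R v j)"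
    have zeta0: "\<zeta> i = 0" if i: "\<bar>i\<bar> \<le> int (m + w)" for i
    proof (rule eq_0_if_coordinates)
      fix b assume b: "b < d"
      have "Inl (i, b) \<in> J" using i b by (auto simp: J_def Q_def)
      from eqn[OF this] show "\<phi> b (\<zeta> i) = 0"
        by (simp add: \<zeta>_def sum_fun_apply f_def linear_add[OF bounded_linear.linear[OF bounded_linear[OF b]]]
            linear_sum[OF b])
    qed
    have G0: "(\<Sum>q\<in>P \<times> {..<d}. \<alpha> q *\<^sub>R (\<Sum>l<k. \<gamma> q l *\<^sub>R g l)) = (\<Sum>j<N. \<beta> j *\<^sub>R (\<Sum>l<k. \<delta> j l *\<^sub>R g l))"
    proof -
      have "(\<Sum>q\<in>P \<times> {..<d}. \<alpha> q *\<^sub>R (\<Sum>l<k. \<gamma> q l *\<^sub>R g l)) = (\<Sum>l<k. (\<Sum>q\<in>P \<times> {..<d}. \<alpha> q * \<gamma> q l) *\<^sub>R g l)"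
        unfolding scaleR_sum_right scaleR_sum_left scaleR_scaleR by (rule sum.swap)
      also have "\<dots> = (\<Sum>l<k. (\<Sum>j<N. \<beta> j * \<delta> j l) *\<^sub>R g l)"
      proof (intro sum.cong refl)
        fix l assume "l \<in> {..<k}"
        then have "Inr l \<in> J" by (auto simp: J_def)
        from eqn[OF this] have "(\<Sum>q\<in>P \<times> {..<d}. \<alpha> q * \<gamma> q l) = (\<Sum>j<N. \<beta> j * \<delta> j l)"
          by (simp add: f_def sum_negf)
        then show "(\<Sum>q\<in>P \<times> {..<d}. \<alpha> q * \<gamma> q l) *\<^sub>R g l = (\<Sum>j<N. \<beta> j * \<delta> j l) *\<^sub>R g l" by simp
      qed
      also have "\<dots> = (\<Sum>j<N. \<beta> j *\<^sub>R (\<Sum>l<k. \<delta> j l *\<^sub>R g l))"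
        unfolding scaleR_sum_right scaleR_sum_left scaleR_scaleR by (rule sum.swap)
      finally show ?thesis .
    qed
    have "B \<zeta> = (\<Sum>q\<in>P \<times> {..<d}. \<alpha> q *\<^sub>R B (z q)) + (\<Sum>j<N. \<beta> j *\<^sub>R B (v j))"
      using B linear_into_sum[OF B subspace_UNIV, of "P \<times> {..<d}" z \<alpha>] linear_into_sum[OF B subspace_UNIV, of "{..<N}" v \<beta>]
      unfolding \<zeta>_def linear_into_def by simp
    also have "\<dots> = (\<Sum>q\<in>P \<times> {..<d}. \<alpha> q *\<^sub>R unit_vector q)"
      using G0 by (simp add: z \<delta> scaleR_diff_right sum_subtractf)
    finally have Bz: "B \<zeta> = (\<Sum>q\<in>P \<times> {..<d}. \<alpha> q *\<^sub>R unit_vector q)" .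
    have \<alpha>0: "\<alpha> q = 0" if "q \<in> P \<times> {..<d}" for q
    proof (rule block_eq_0[OF fin(1) _ that])
      fix l assume l: "l \<in> P"
      have "B \<zeta> l = B 0 l"
      proof (rule local)
        fix i assume "\<bar>i - l\<bar> \<le> int w"
        then have "\<zeta> i = 0" using l by (intro zeta0) (auto simp: P_def)
        then show "\<zeta> i = 0 i" by simp
      qed
      then show "(\<Sum>q\<in>P \<times> {..<d}. \<alpha> q *\<^sub>R unit_vector q) l = 0"
        using linear_into_zero[OF B subspace_UNIV] Bz by simp
    qed
    have "\<forall>j<N. \<beta> j = 0"
    proof (rule mp[OF spec[OF window]], intro allI impI)
      fix i assume "\<bar>i\<bar> \<le> int m"
      then have "\<zeta> i = 0" by (intro zeta0) simp
      then have "(\<Sum>j<N. \<beta> j *\<^sub>R v j i) = 0" using \<alpha>0 by (simp add: \<zeta>_def sum_fun_apply)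
      then show "(real m + 1) * norm (\<Sum>j<N. \<beta> j *\<^sub>R v j i) \<le> (\<Sum>j<N. \<bar>\<beta> j\<bar>)" by (simp add: sum_nonneg)
    qed
    then show False using c(1) \<alpha>0 by (auto simp: I_def \<alpha>_def \<beta>_def)
  qed
  then show ?thesis by blast
qed

end

text \<open>A concrete closed subspace of finite codimension. For large \<open>m\<close> it meets a given
  finite-dimensional kernel in \<open>0\<close> only, and it is well suited to counting because it is defined site
  by site.\<close>

definition vanishing :: "ennreal \<Rightarrow> nat \<Rightarrow> (int \<Rightarrow> 'a::real_normed_vector) set" where
  "vanishing p m = {x \<in> lp_space p. \<forall>i. \<bar>i\<bar> \<le> int m \<longrightarrow> x i = 0}"

lemma subspace_vanishing: "p = 0 \<or> 1 \<le> p \<Longrightarrow> subspace (vanishing p m)"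
  using subspace_lp[of p] by (auto simp: subspace_def vanishing_def)

lemma norm_closed_vanishing:
  assumes p: "p = 0 \<or> 1 \<le> p"
  shows "normed_carrier.norm_closed (lp_space p) (lp_norm p) (vanishing p m :: (int \<Rightarrow> 'a::banach) set)"
proof -
  interpret L: banach_carrier "lp_space p :: (int \<Rightarrow> 'a) set" "lp_norm p" by (rule banach_carrier_lp[OF p])
  show ?thesis unfolding L.norm_closed_def
  proof (intro ballI impI)
    fix z :: "int \<Rightarrow> 'a"
    assume z: "z \<in> lp_space p" and near: "\<forall>e>0. \<exists>y\<in>vanishing p m. lp_norm p (z - y) < e"
    have "z i = 0" if i: "\<bar>i\<bar> \<le> int m" for i
    proof (rule ccontr)
      assume "z i \<noteq> 0"
      then obtain y where y: "y \<in> vanishing p m" "lp_norm p (z - y) < norm (z i)"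
        using near by (meson zero_less_norm_iff)
      then have "norm ((z - y) i) \<le> lp_norm p (z - y)"
        using z by (intro norm_coordinate_le_lp_norm[OF p] lp_space_diff[OF p]) (auto simp: vanishing_def)
      then show False using y i by (simp add: vanishing_def)
    qed
    then show "z \<in> vanishing p m" using z by (simp add: vanishing_def)
  qed
qed

text \<open>Each window yields a normalised relation between the vectors \<open>v j\<close> modulo the range, and the
  coefficients have a limit that is not zero. If \<open>p \<noteq> 0\<close>, the preimages \<open>x k\<close> are bounded by the lower
  bound, so they converge coordinatewise along a subsequence to a preimage for the limit. If \<open>p = 0\<close>,
  the limit of the \<open>x k\<close> need not be a null sequence; but then the truncations of a vector converge to
  it in norm, so the limit combination lies in the range because the range is closed.\<close>

lemma (in finite_coordinates) band_codim_range:
  fixes B :: "(int \<Rightarrow> 'a) \<Rightarrow> int \<Rightarrow> 'a"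
  assumes p: "p = 0 \<or> 1 \<le> p" and band: "band_operator B"
    and lower: "\<And>x. x \<in> vanishing p m \<Longrightarrow> a * lp_norm p x \<le> lp_norm p (B x)" and a: "a > 0"
  shows "\<exists>n. codim_below (lp_space p) (B ` vanishing p m) n"
proof -
  interpret L: banach_carrier "lp_space p :: (int \<Rightarrow> 'a) set" "lp_norm p" by (rule banach_carrier_lp[OF p])
  obtain w :: nat where B: "linear_into UNIV UNIV B"
    and local: "\<And>x y n. (\<And>i. \<bar>i - n\<bar> \<le> int w \<Longrightarrow> x i = y i) \<Longrightarrow> B x n = B y n"
    and cont: "\<And>x y n. (\<And>i. (\<lambda>k::nat. x k i) \<longlonglongrightarrow> y i) \<Longrightarrow> (\<lambda>k. B (x k) n) \<longlonglongrightarrow> B y n"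
    by (rule band_operator_local[OF band]) blast
  have Bp: "lp_bounded_operator p B" by (rule lp_bounded_operator_band[OF p band])
  have inj: "x = 0" if "x \<in> lp_space p" "\<And>i. \<bar>i\<bar> \<le> int m \<Longrightarrow> x i = 0" "B x = 0" for x
  proof -
    have "a * lp_norm p x \<le> 0" using lower[of x] that by (simp add: vanishing_def)
    then have "lp_norm p x = 0" using a lp_norm_nonneg[of p x] by (simp add: mult_le_0_iff)
    then show ?thesis by (rule lp_norm_eq_0[OF p that(1)])
  qed
  define N where "N = (2 * w + 2 * m + 1) * d + 1"
  have "codim_below (lp_space p) (B ` vanishing p m) N"
    unfolding codim_below_def
  proof (intro allI impI)
    fix v :: "nat \<Rightarrow> int \<Rightarrow> 'a" assume v: "\<forall>j<N. v j \<in> lp_space p"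
    define K where "K = (\<Sum>j<N. lp_norm p (v j))"
    have K: "lp_norm p (v j) \<le> K" if "j < N" for j
      unfolding K_def using that lp_norm_nonneg by (intro member_le_sum) auto
    have sum_lp: "(\<Sum>j<N. c j *\<^sub>R v j) \<in> lp_space p" for c
      using v by (intro subspace_sum[OF L.subspace_V] lp_space_scaleR) auto
    have "\<forall>k::nat. \<exists>t. (\<Sum>j<N. \<bar>fst t j\<bar>) = 1 \<and> snd t \<in> vanishing p m \<and>
        (\<forall>i. \<bar>i\<bar> \<le> int k \<longrightarrow> B (snd t) i = (\<Sum>j<N. fst t j *\<^sub>R v j i)) \<and>
        (\<forall>i. B (snd t) i = (\<Sum>j<N. fst t j *\<^sub>R v j i) \<or> B (snd t) i = 0)"
    proof
      fix k :: nat
      have "(2 * w + 2 * m + 1) * d < N" by (simp add: N_def)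
      then obtain c x where cx: "(\<Sum>j<N. \<bar>c j\<bar>) = 1" "x \<in> lp_space p" "\<And>i. \<bar>i\<bar> \<le> int m \<Longrightarrow> x i = 0"
        "\<And>i. \<bar>i\<bar> \<le> int (m + k + w) \<Longrightarrow> B x i = (\<Sum>j<N. c j *\<^sub>R v j i)"
        "\<And>i. \<bar>i\<bar> > int (m + k + w) \<Longrightarrow> B x i = 0"
        using band_window_relation[where n = "m + k" and v = v, OF B local inj le_add1] by blast
      have "B x i = (\<Sum>j<N. c j *\<^sub>R v j i) \<or> B x i = 0" for i
        by (cases "\<bar>i\<bar> \<le> int (m + k + w)") (use cx(4)[of i] cx(5)[of i] in auto)
      moreover have "B x i = (\<Sum>j<N. c j *\<^sub>R v j i)" if "\<bar>i\<bar> \<le> int k" for i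
        using cx(4)[of i] that by simp
      moreover have "x \<in> vanishing p m" using cx(2,3) by (simp add: vanishing_def)
      ultimately show "\<exists>t. (\<Sum>j<N. \<bar>fst t j\<bar>) = 1 \<and> snd t \<in> vanishing p m \<and>
        (\<forall>i. \<bar>i\<bar> \<le> int k \<longrightarrow> B (snd t) i = (\<Sum>j<N. fst t j *\<^sub>R v j i)) \<and>
        (\<forall>i. B (snd t) i = (\<Sum>j<N. fst t j *\<^sub>R v j i) \<or> B (snd t) i = 0)"
        using cx(1) by (intro exI[of _ "(c, x)"]) simp
    qed
    from choice[OF this] obtain t where t: "\<forall>k::nat. (\<Sum>j<N. \<bar>fst (t k) j\<bar>) = 1 \<and> snd (t k) \<in> vanishing p m \<and>
        (\<forall>i. \<bar>i\<bar> \<le> int k \<longrightarrow> B (snd (t k)) i = (\<Sum>j<N. fst (t k) j *\<^sub>R v j i)) \<and>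
        (\<forall>i. B (snd (t k)) i = (\<Sum>j<N. fst (t k) j *\<^sub>R v j i) \<or> B (snd (t k)) i = 0)" by blast
    define c where "c k = fst (t k)" for k
    define x where "x k = snd (t k)" for k
    have c1: "(\<Sum>j<N. \<bar>c k j\<bar>) = 1" and xW: "x k \<in> vanishing p m"
      and inside: "\<bar>i\<bar> \<le> int k \<Longrightarrow> B (x k) i = (\<Sum>j<N. c k j *\<^sub>R v j i)"
      and either: "B (x k) i = (\<Sum>j<N. c k j *\<^sub>R v j i) \<or> B (x k) i = 0" for k i
      using t by (simp_all add: c_def x_def)
    have xlp: "x k \<in> lp_space p" for k using xW[of k] by (simp add: vanishing_def)
    have xbound: "lp_norm p (x k) \<le> K / a" for k
    proof -
      have "lp_norm p (B (x k)) \<le> 1 * lp_norm p (\<Sum>j<N. c k j *\<^sub>R v j)"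
      proof (rule lp_dominated(2)[OF p sum_lp])
        show "norm (B (x k) i) \<le> 1 * norm ((\<Sum>j<N. c k j *\<^sub>R v j) i)" for i
          using either[of k i] by (auto simp: sum_fun_apply)
      qed simp
      also have "\<dots> \<le> 1 * ((\<Sum>j<N. \<bar>c k j\<bar>) * K)" using v K by (intro mult_left_mono L.norm_sum_le) auto
      finally have "a * lp_norm p (x k) \<le> K" using lower[OF xW[of k]] c1 by simp
      then show ?thesis using a by (simp add: field_simps)
    qed
    obtain r g where r: "strict_mono r" and g: "\<And>j. j < N \<Longrightarrow> (\<lambda>k. c (r k) j) \<longlonglongrightarrow> g j"
      and nz: "\<exists>j<N. g j \<noteq> 0"
      by (rule unit_coefficients_subsequence[of c N, OF c1]) blast
    have "(\<Sum>j<N. g j *\<^sub>R v j) \<in> B ` vanishing p m"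
    proof (cases "p = 0")
      case False
      then have p1: "1 \<le> p" using p by blast
      have "norm (x (r k) i) \<le> K / a" for k i
        using norm_coordinate_le_lp_norm[OF p xlp] xbound by (meson order_trans)
      from bounded_sequence_compact[of "\<lambda>k. x (r k)", OF this] obtain r' y
        where r': "strict_mono r'" and y: "\<And>i. (\<lambda>k. x (r (r' k)) i) \<longlonglongrightarrow> y i" by blast
      have "y \<in> lp_space p" by (rule lp_fatou(1)[OF p1 xlp xbound y])
      moreover have "y i = 0" if "\<bar>i\<bar> \<le> int m" for i
      proof -
        have "(\<lambda>k. x (r (r' k)) i) = (\<lambda>k. 0)" using xW that by (auto simp: vanishing_def)
        then show ?thesis using y[of i] by (simp add: LIMSEQ_const_iff)
      qed
      ultimately have yW: "y \<in> vanishing p m" by (simp add: vanishing_def)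
      have "B y i = (\<Sum>j<N. g j *\<^sub>R v j i)" for i
      proof (rule LIMSEQ_unique)
        show "(\<lambda>k. B (x (r (r' k))) i) \<longlonglongrightarrow> B y i" by (rule cont[OF y])
        have "(\<lambda>k. c (r (r' k)) j) \<longlonglongrightarrow> g j" if "j < N" for j
          using LIMSEQ_subseq_LIMSEQ[OF g[OF that] r'] by (simp add: o_def)
        then have "(\<lambda>k. \<Sum>j<N. c (r (r' k)) j *\<^sub>R v j i) \<longlonglongrightarrow> (\<Sum>j<N. g j *\<^sub>R v j i)"
          by (intro tendsto_sum tendsto_scaleR tendsto_const) auto
        moreover have "\<forall>\<^sub>F k in sequentially. (\<Sum>j<N. c (r (r' k)) j *\<^sub>R v j i) = B (x (r (r' k))) i"
          unfolding eventually_sequentially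
        proof (intro exI allI impI)
          fix k assume "nat \<bar>i\<bar> \<le> k"
          moreover have "k \<le> r (r' k)" using seq_suble[OF r] seq_suble[OF r'] by (meson order_trans)
          ultimately show "(\<Sum>j<N. c (r (r' k)) j *\<^sub>R v j i) = B (x (r (r' k))) i"
            by (intro inside[symmetric]) linarith
        qed
        ultimately show "(\<lambda>k. B (x (r (r' k))) i) \<longlonglongrightarrow> (\<Sum>j<N. g j *\<^sub>R v j i)"
          by (rule Lim_transform_eventually)
      qed
      then have "B y = (\<Sum>j<N. g j *\<^sub>R v j)" by (simp add: fun_eq_iff sum_fun_apply)
      then show ?thesis using yW by force
    next
      case True
      obtain D where D: "\<And>x. x \<in> lp_space p \<Longrightarrow> lp_norm p (B x) \<le> D * lp_norm p x"
        using lp_bounded_operator_bound[OF Bp] by blast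
      have W: "vanishing p m \<subseteq> lp_space p" by (auto simp: vanishing_def)
      have "linear_into (vanishing p m) (lp_space p) B"
        using linear_into_lp[OF Bp] W unfolding linear_into_def by blast
      then have closed: "L.norm_closed (B ` vanishing p m)"
        using W D by (intro L.norm_closed_range_of_lower_bound[OF subspace_vanishing[OF p] _
            norm_closed_vanishing[OF p] _ lower a]) auto
      show ?thesis
      proof (rule L.norm_closedD[OF closed sum_lp, of "\<lambda>k. B (x (r k))"])
        show "B (x (r k)) \<in> B ` vanishing p m" for k using xW by blast
        let ?s = "\<Sum>j<N. g j *\<^sub>R v j"
        show "(\<lambda>k. lp_norm p (?s - B (x (r k)))) \<longlonglongrightarrow> 0"
        proof (rule LIMSEQ_I)
          fix e :: real assume "e > 0"
          then have e2: "e / 2 > 0" by simp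
          obtain M where M: "\<forall>i. M \<le> \<bar>i\<bar> \<longrightarrow> norm (?s i) < e / 2"
            using sum_lp[of g] e2 unfolding True lp_space_0_iff by blast
          have "(\<lambda>k. (\<Sum>j<N. \<bar>g j - c (r k) j\<bar>) * K) \<longlonglongrightarrow> (\<Sum>j<N. \<bar>g j - g j\<bar>) * K"
            using g by (intro tendsto_intros) auto
          then have "(\<lambda>k. (\<Sum>j<N. \<bar>g j - c (r k) j\<bar>) * K) \<longlonglongrightarrow> 0" by simp
          from order_tendstoD(2)[OF this e2]
          obtain M' where M': "\<And>k. k \<ge> M' \<Longrightarrow> (\<Sum>j<N. \<bar>g j - c (r k) j\<bar>) * K < e / 2"
            unfolding eventually_sequentially by blast
          have "lp_norm p (?s - B (x (r k))) < e" if k: "k \<ge> max M' (nat M)" for k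
          proof -
            have Bx: "B (x (r k)) \<in> lp_space p"
              using xlp linear_into_lp[OF Bp] by (simp add: linear_into_def)
            have "lp_norm p (?s - B (x (r k))) \<le> e / 2"
            proof (rule lp_norm_sup_le[OF disjI1[OF True] lp_space_diff[OF p sum_lp Bx]])
              fix i
              have diff: "norm ((?s - (\<Sum>j<N. c (r k) j *\<^sub>R v j)) i) \<le> e / 2"
              proof -
                have "norm ((?s - (\<Sum>j<N. c (r k) j *\<^sub>R v j)) i) \<le> lp_norm p (?s - (\<Sum>j<N. c (r k) j *\<^sub>R v j))"
                  by (rule norm_coordinate_le_lp_norm[OF p lp_space_diff[OF p sum_lp sum_lp]])
                also have "\<dots> = lp_norm p (\<Sum>j<N. (g j - c (r k) j) *\<^sub>R v j)"
                  by (simp add: scaleR_diff_left sum_subtractf)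
                also have "\<dots> \<le> (\<Sum>j<N. \<bar>g j - c (r k) j\<bar>) * K"
                  using v K by (intro L.norm_sum_le) auto
                also have "\<dots> \<le> e / 2" using M'[of k] k by simp
                finally show ?thesis .
              qed
              show "norm ((?s - B (x (r k))) i) \<le> e / 2"
              proof (cases "\<bar>i\<bar> \<le> int (r k)")
                case True
                then show ?thesis using diff inside[OF True] by (simp add: sum_fun_apply)
              next
                case far: False
                have "k \<le> r k" by (rule seq_suble[OF r])
                then have "M \<le> \<bar>i\<bar>" using far k by linarith
                then have "norm (?s i) \<le> e / 2" using M by (meson less_imp_le)
                then show ?thesis using either[of "r k" i] diff by (auto simp: sum_fun_apply)
              qed
            qed
            then show ?thesis using \<open>e > 0\<close> by linarith
          qed
          then show "\<exists>k0. \<forall>k\<ge>k0. norm (lp_norm p (?s - B (x (r k))) - 0) < e"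
            by (intro exI[of _ "max M' (nat M)"]) (simp add: abs_of_nonneg[OF lp_norm_nonneg])
        qed
      qed
    qed
    then show "\<exists>c. (\<exists>j<N. c j \<noteq> 0) \<and> (\<Sum>j<N. c j *\<^sub>R v j) \<in> B ` vanishing p m" using nz by blast
  qed
  then show ?thesis by blast
qed

section \<open>Semi-Fredholm operators\<close>

text \<open>By the open mapping theorem, \<open>x\<close> differs from a vector \<open>x'\<close> with \<open>\<parallel>x'\<parallel> \<le> C \<parallel>A x\<parallel>\<close> by an element of
  the kernel. On the window where \<open>x\<close> vanishes this element equals \<open>- x'\<close>, and an element of a
  finite-dimensional space of sequences is controlled by its values on a large window.\<close>

lemma lower_bound_off_window:
  fixes A :: "(int \<Rightarrow> 'a::banach) \<Rightarrow> int \<Rightarrow> 'a"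
  assumes p: "p = 0 \<or> 1 \<le> p" and A: "Phi_plus p A"
  obtains m a where "a > 0" "\<And>x. x \<in> vanishing p m \<Longrightarrow> a * lp_norm p x \<le> lp_norm p (A x)"
proof -
  interpret L: banach_carrier "lp_space p :: (int \<Rightarrow> 'a) set" "lp_norm p" by (rule banach_carrier_lp[OF p])
  have bA: "lp_bounded_operator p A" and closed: "closedin (lp_topology p) (A ` lp_space p)"
    and ker: "finite_dim (lp_kernel p A)"
    using A by (auto simp: Phi_plus_def normally_solvable_def)
  have lA: "linear_into (lp_space p) (lp_space p) A" by (rule linear_into_lp[OF bA])
  obtain D where D: "\<And>x. x \<in> lp_space p \<Longrightarrow> lp_norm p (A x) \<le> D * lp_norm p x"
    using lp_bounded_operator_bound[OF bA] by blast
  obtain C where C: "C \<ge> 0"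
    "\<And>y. y \<in> A ` lp_space p \<Longrightarrow> \<exists>x\<in>lp_space p. A x = y \<and> lp_norm p x \<le> C * lp_norm p y"
    by (rule L.open_mapping[OF lA D norm_closed_if_closedin_lp[OF p closed]]) (assumption, rule that)
  have 0: "subspace {0 :: int \<Rightarrow> 'a}" by (simp add: subspace_def)
  have "lp_kernel p A = {x\<in>lp_space p. A x \<in> {0}}" by (auto simp: lp_kernel_def)
  then have "subspace (lp_kernel p A)" using subspace_linear_preimage[OF lA L.subspace_V 0] by simp
  then obtain n where "codim_below (lp_kernel p A) {0} n"
    using ker finite_dim_iff_codim_below by blast
  then obtain k :: nat and v where v: "\<And>j. j < k \<Longrightarrow> v j \<in> lp_kernel p A"
    and indep: "\<And>c. (\<Sum>j<k. c j *\<^sub>R v j) \<in> {0} \<Longrightarrow> \<forall>j<k. c j = 0"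
    and span: "\<And>z. z \<in> lp_kernel p A \<Longrightarrow> \<exists>c. z - (\<Sum>j<k. c j *\<^sub>R v j) \<in> {0}"
    by (rule codim_below_basis[OF 0]) blast
  obtain m :: nat where window: "\<forall>c. (\<forall>i. \<bar>i\<bar> \<le> int m \<longrightarrow>
        (real m + 1) * norm (\<Sum>j<k. c j *\<^sub>R v j i) \<le> (\<Sum>j<k. \<bar>c j\<bar>)) \<longrightarrow> (\<forall>j<k. c j = 0)"
    using independent_on_window[where n = k and v = v] indep by blast
  define E where "E = (\<Sum>j<k. lp_norm p (v j))"
  have E: "lp_norm p (v j) \<le> E" if "j < k" for j
    unfolding E_def using that lp_norm_nonneg by (intro member_le_sum) auto
  have "E \<ge> 0" unfolding E_def by (intro sum_nonneg lp_norm_nonneg)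
  define b where "b = (1 + E * (real m + 1)) * C + 1"
  have "b > 0" using \<open>E \<ge> 0\<close> C(1) by (simp add: b_def add_nonneg_pos)
  have "lp_norm p x \<le> b * lp_norm p (A x)" if x: "x \<in> vanishing p m" for x
  proof -
    have xlp: "x \<in> lp_space p" and x0: "\<And>i. \<bar>i\<bar> \<le> int m \<Longrightarrow> x i = 0" using x by (auto simp: vanishing_def)
    obtain x' where x': "x' \<in> lp_space p" "A x' = A x" "lp_norm p x' \<le> C * lp_norm p (A x)"
      using C(2)[of "A x"] xlp by blast
    have "x - x' \<in> lp_kernel p A"
      using lp_space_diff[OF p xlp x'(1)] linear_into_diff[OF lA L.subspace_V xlp x'(1)] x'(2)
      by (simp add: lp_kernel_def)
    then obtain c where c: "x - x' = (\<Sum>j<k. c j *\<^sub>R v j)" using span by fastforce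
    have coeff: "(\<Sum>j<k. \<bar>c j\<bar>) \<le> (real m + 1) * lp_norm p x'"
    proof (cases "\<forall>j<k. c j = 0")
      case True
      then show ?thesis using lp_norm_nonneg[of p x'] by simp
    next
      case False
      then obtain i where i: "\<bar>i\<bar> \<le> int m" "\<not> (real m + 1) * norm (\<Sum>j<k. c j *\<^sub>R v j i) \<le> (\<Sum>j<k. \<bar>c j\<bar>)"
        using window by blast
      have "(\<Sum>j<k. c j *\<^sub>R v j i) = (x - x') i" unfolding c by (simp add: sum_fun_apply)
      then have "norm (\<Sum>j<k. c j *\<^sub>R v j i) = norm (x' i)" using x0[OF i(1)] by simp
      then have "norm (\<Sum>j<k. c j *\<^sub>R v j i) \<le> lp_norm p x'"
        using norm_coordinate_le_lp_norm[OF p x'(1)] by simp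
      then have "(real m + 1) * norm (\<Sum>j<k. c j *\<^sub>R v j i) \<le> (real m + 1) * lp_norm p x'"
        by (intro mult_left_mono) auto
      then show ?thesis using i(2) by linarith
    qed
    have "lp_norm p (x - x') \<le> (\<Sum>j<k. \<bar>c j\<bar>) * E"
      unfolding c using v E by (intro L.norm_sum_le) (auto simp: lp_kernel_def)
    also have "\<dots> \<le> (real m + 1) * lp_norm p x' * E" using coeff \<open>E \<ge> 0\<close> by (rule mult_right_mono)
    finally have "lp_norm p x \<le> (1 + E * (real m + 1)) * lp_norm p x'"
      using L.norm_triangle_sub[OF xlp x'(1)] by (simp add: algebra_simps)
    also have "\<dots> \<le> (1 + E * (real m + 1)) * (C * lp_norm p (A x))"
      using x'(3) \<open>E \<ge> 0\<close> by (intro mult_left_mono) auto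
    also have "\<dots> \<le> b * lp_norm p (A x)" using lp_norm_nonneg[of p "A x"] by (simp add: b_def distrib_right)
    finally show ?thesis .
  qed
  then have "(1 / b) * lp_norm p x \<le> lp_norm p (A x)" if "x \<in> vanishing p m" for x
    using that \<open>b > 0\<close> by (simp add: field_simps)
  then show ?thesis using \<open>b > 0\<close> by (intro that[of "1 / b" m]) auto
qed

lemma linear_into_segment:
  assumes U: "subspace V" and A: "linear_into U V A" and B: "linear_into U V B"
  shows "linear_into U V (\<lambda>x. B x + t *\<^sub>R (A x - B x))"
  using A B unfolding linear_into_def
  by (auto simp: algebra_simps intro!: subspace_add[OF U] subspace_diff[OF U] subspace_scale[OF U])

lemma segment_diff:
  "(b + s *\<^sub>R (a - b)) - (b + t *\<^sub>R (a - b)) = (s - t) *\<^sub>R (a - b)" for a b :: "'b::real_vector"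
  by (simp add: algebra_simps)

text \<open>Half of the lower bound \<open>a\<close> of \<open>A\<close> on \<open>W\<close> remains valid on the whole segment from \<open>B\<close> to \<open>A\<close>.\<close>

lemma Phi_plus_imp_finite_codim:
  fixes A :: "(int \<Rightarrow> 'a::banach) \<Rightarrow> int \<Rightarrow> 'a"
  assumes fin: "finite_dim (UNIV :: 'a set)" and p: "p = 0 \<or> 1 \<le> p"
    and bd: "band_dominated p A" and A: "Phi_plus p A"
  shows "finite_dim_quotient (lp_space p) (A ` lp_space p)"
proof -
  interpret L: banach_carrier "lp_space p :: (int \<Rightarrow> 'a) set" "lp_norm p" by (rule banach_carrier_lp[OF p])
  obtain d :: nat and u :: "nat \<Rightarrow> 'a" and \<phi> where "finite_coordinates d u \<phi>"
    by (rule finite_coordinates_exist[OF fin])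
  then interpret F: finite_coordinates d u \<phi> .
  obtain m a where a: "a > 0" and lower: "\<And>x. x \<in> vanishing p m \<Longrightarrow> a * lp_norm p x \<le> lp_norm p (A x)"
    by (rule lower_bound_off_window[OF p A]) blast
  define W :: "(int \<Rightarrow> 'a) set" where "W = vanishing p m"
  have W: "subspace W" "W \<subseteq> lp_space p" "L.norm_closed W"
    using subspace_vanishing[OF p] norm_closed_vanishing[OF p] by (auto simp: W_def vanishing_def)
  have "a / 2 > 0" using a by simp
  then obtain B where B: "band_operator B"
    and near: "\<And>x. x \<in> lp_space p \<Longrightarrow> lp_norm p (A x - B x) \<le> (a / 2) * lp_norm p x"
    using band_dominated_approx[OF p bd] by metis
  have bA: "lp_bounded_operator p A" using bd by (simp add: band_dominated_def)
  have bB: "lp_bounded_operator p B" by (rule lp_bounded_operator_band[OF p B])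
  note lA = linear_into_lp[OF bA] and lB = linear_into_lp[OF bB]
  define S where "S t x = B x + t *\<^sub>R (A x - B x)" for t x
  have lS: "linear_into (lp_space p) (lp_space p) (S t)" for t
    unfolding S_def by (rule linear_into_segment[OF L.subspace_V lA lB])
  then have lSW: "linear_into W (lp_space p) (S t)" for t
    using W(2) unfolding linear_into_def by blast
  have memA: "A x \<in> lp_space p" and memB: "B x \<in> lp_space p" and memS: "S t x \<in> lp_space p"
    if "x \<in> lp_space p" for x t
    using lA lB lS that by (auto simp: linear_into_def)
  have dist: "lp_norm p (S s x - S t x) \<le> \<bar>s - t\<bar> * (a / 2) * lp_norm p x" if "x \<in> lp_space p" for s t x
    unfolding S_def segment_diff L.norm_scale mult.assoc
    using near[OF that] by (intro mult_left_mono) auto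
  have S1: "S 1 x = A x" and S0: "S 0 x = B x" for x by (simp_all add: S_def)
  have lowerS: "(a / 2) * lp_norm p x \<le> lp_norm p (S t x)" if x: "x \<in> W" and t: "0 \<le> t" "t \<le> 1" for x t
  proof -
    have xlp: "x \<in> lp_space p" using x W by blast
    have "lp_norm p (A x - S t x) \<le> \<bar>1 - t\<bar> * (a / 2) * lp_norm p x" using dist[OF xlp, of 1 t] S1 by simp
    also have "\<dots> \<le> 1 * (a / 2) * lp_norm p x"
      using t a lp_norm_nonneg[of p x] by (intro mult_right_mono) auto
    finally show ?thesis
      using lower[of x] x L.norm_triangle_sub[OF memA[OF xlp] memS[OF xlp], of t] by (simp add: W_def)
  qed
  obtain DB where DB: "\<And>x. x \<in> lp_space p \<Longrightarrow> lp_norm p (B x) \<le> DB * lp_norm p x"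
    using lp_bounded_operator_bound[OF bB] by blast
  have bound: "lp_norm p (S t x) \<le> (\<bar>t\<bar> * (a / 2) + DB) * lp_norm p x" if "x \<in> lp_space p" for t x
    using L.norm_triangle_sub[OF memS[OF that] memB[OF that], of t] dist[OF that, of t 0] DB[OF that] S0
    by (simp add: distrib_right)
  have closed: "L.norm_closed (S t ` W)" if "0 \<le> t" "t \<le> 1" for t
    using W(2) a bound
    by (intro L.norm_closed_range_of_lower_bound[OF W lSW lowerS[OF _ that]]) auto
  have "\<And>x. x \<in> vanishing p m \<Longrightarrow> (a / 2) * lp_norm p x \<le> lp_norm p (B x)"
    using lowerS[of _ 0] S0 by (simp add: W_def)
  then obtain n where n: "codim_below (lp_space p) (B ` W) n"
    using F.band_codim_range[OF p B _ \<open>a / 2 > 0\<close>] unfolding W_def by blast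
  define \<delta> where "\<delta> = 1 / (3 ^ n * real n + 1)"
  have "\<delta> > 0" by (simp add: \<delta>_def add_nonneg_pos)
  have "codim_below (lp_space p) (S 1 ` W) n"
  proof (rule unit_interval_steps[of "\<lambda>t. codim_below (lp_space p) (S t ` W) n", OF _ \<open>\<delta> > 0\<close>])
    show "codim_below (lp_space p) (S 0 ` W) n" using n S0 by simp
    fix s t :: real
    assume st: "0 \<le> s" "s \<le> t" "t \<le> 1" "t - s \<le> \<delta>"
      and cod: "codim_below (lp_space p) (S s ` W) n"
    show "codim_below (lp_space p) (S t ` W) n"
    proof (rule L.codim_range_stable[OF W(1,2) lSW lSW lowerS \<open>a / 2 > 0\<close> _ _ _ _ cod])
      show "0 \<le> s" "s \<le> 1" using st by auto
      show "lp_norm p (S s x - S t x) \<le> \<bar>s - t\<bar> * (a / 2) * lp_norm p x" if "x \<in> W" for x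
        using dist that W(2) by blast
      show "L.norm_closed (S t ` W)" using closed st by simp
      show "0 \<le> \<bar>s - t\<bar> * (a / 2)" using a by simp
      have "(3 ^ n * real n) * \<bar>s - t\<bar> \<le> (3 ^ n * real n) * \<delta>"
        using st by (intro mult_left_mono) auto
      also have "\<dots> < 1" by (simp add: \<delta>_def add_nonneg_pos)
      finally have "(3 ^ n * real n) * \<bar>s - t\<bar> * (a / 2) < 1 * (a / 2)"
        using \<open>a / 2 > 0\<close> by (rule mult_strict_right_mono)
      then show "3 ^ n * real n * (\<bar>s - t\<bar> * (a / 2)) < a / 2" by (simp add: mult.assoc)
    qed
  qed
  then have "codim_below (lp_space p) (A ` lp_space p) n"
    by (rule codim_below_mono) (use W(2) S1 in auto)
  then show ?thesis
    using finite_dim_quotient_iff_codim_below[OF subspace_linear_image[OF lA L.subspace_V]] by blast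
qed

text \<open>Along the segment from \<open>B\<close> to \<open>A\<close> the dimension of the preimage of \<open>G\<close> is followed rather than that
  of the kernel: surjectivity modulo \<open>G\<close> is stable, and it is what allows corrections inside the
  preimage. The kernel of \<open>A\<close> is contained in the preimage of \<open>G\<close>.\<close>

lemma Phi_minus_imp_finite_dim_kernel:
  fixes A :: "(int \<Rightarrow> 'a::banach) \<Rightarrow> int \<Rightarrow> 'a"
  assumes fin: "finite_dim (UNIV :: 'a set)" and p: "p = 0 \<or> 1 \<le> p"
    and bd: "band_dominated p A" and A: "Phi_minus p A"
  shows "finite_dim (lp_kernel p A)"
proof -
  interpret L: banach_carrier "lp_space p :: (int \<Rightarrow> 'a) set" "lp_norm p" by (rule banach_carrier_lp[OF p])
  obtain d :: nat and u :: "nat \<Rightarrow> 'a" and \<phi> where "finite_coordinates d u \<phi>"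
    by (rule finite_coordinates_exist[OF fin])
  then interpret F: finite_coordinates d u \<phi> .
  have closed: "closedin (lp_topology p) (A ` lp_space p)"
    and quot: "finite_dim_quotient (lp_space p) (A ` lp_space p)"
    using A by (auto simp: Phi_minus_def normally_solvable_def)
  have bA: "lp_bounded_operator p A" using bd by (simp add: band_dominated_def)
  have lA: "linear_into (lp_space p) (lp_space p) A" by (rule linear_into_lp[OF bA])
  obtain D where D: "\<And>x. x \<in> lp_space p \<Longrightarrow> lp_norm p (A x) \<le> D * lp_norm p x"
    using lp_bounded_operator_bound[OF bA] by blast
  obtain n where codim: "codim_below (lp_space p) (A ` lp_space p) n"
    using quot finite_dim_quotient_iff_codim_below[OF subspace_linear_image[OF lA L.subspace_V]] by blast
  obtain k :: nat and g C where g: "\<And>j. j < k \<Longrightarrow> g j \<in> lp_space p" and C: "C \<ge> 0"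
    and G_closed: "L.norm_closed {\<Sum>j<k. c j *\<^sub>R g j | c. True}"
    and onto: "\<And>y. y \<in> lp_space p \<Longrightarrow>
      \<exists>x\<in>lp_space p. lp_norm p x \<le> C * lp_norm p y \<and> y - A x \<in> {\<Sum>j<k. c j *\<^sub>R g j | c. True}"
    by (rule L.onto_modulo_finite[OF lA D norm_closed_if_closedin_lp[OF p closed] codim])
      (assumption, rule that)
  define G where "G = {\<Sum>j<k. c j *\<^sub>R g j | c. True}"
  have "G = span (g ` {..<k})" by (auto simp: G_def in_span_image_iff)
  then have G: "subspace G" by simp
  have GV: "G \<subseteq> lp_space p"
    using g by (auto simp: G_def intro!: subspace_sum[OF L.subspace_V] lp_space_scaleR)
  \<comment> \<open>Close enough for solvability modulo \<open>G\<close> to hold on the whole segment with the constant \<open>2 C\<close>.\<close>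
  define e where "e = 1 / (2 * C + 1)"
  have e: "e > 0" "C * e \<le> 1 / 2" using C by (auto simp: e_def field_simps)
  obtain B where B: "band_operator B"
    and near: "\<And>x. x \<in> lp_space p \<Longrightarrow> lp_norm p (A x - B x) \<le> e * lp_norm p x"
    using band_dominated_approx[OF p bd e(1)] by metis
  have bB: "lp_bounded_operator p B" by (rule lp_bounded_operator_band[OF p B])
  note lB = linear_into_lp[OF bB]
  define S where "S t x = B x + t *\<^sub>R (A x - B x)" for t x
  have lS: "linear_into (lp_space p) (lp_space p) (S t)" for t
    unfolding S_def by (rule linear_into_segment[OF L.subspace_V lA lB])
  have dist: "lp_norm p (S s x - S t x) \<le> \<bar>s - t\<bar> * e * lp_norm p x" if "x \<in> lp_space p" for s t x
    unfolding S_def segment_diff L.norm_scale mult.assoc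
    using near[OF that] by (intro mult_left_mono) auto
  have S1: "S 1 x = A x" and S0: "S 0 x = B x" for x by (simp_all add: S_def)
  have memA: "A x \<in> lp_space p" and memS: "S t x \<in> lp_space p" if "x \<in> lp_space p" for x t
    using lA lS that by (auto simp: linear_into_def)
  have bound: "lp_norm p (S t x) \<le> (\<bar>t - 1\<bar> * e + D) * lp_norm p x" if "x \<in> lp_space p" for t x
    using L.norm_triangle_sub[OF memS[OF that] memA[OF that], of t] dist[OF that, of t 1] D[OF that] S1
    by (simp add: distrib_right)
  have ontoS: "\<exists>x\<in>lp_space p. lp_norm p x \<le> 2 * C * lp_norm p y \<and> y - S t x \<in> G"
    if t: "0 \<le> t" "t \<le> 1" and y: "y \<in> lp_space p" for t y
  proof (rule L.onto_modulo_stable[OF lS bound lA G _ GV C _ _ _ e(2) y])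
    show "L.norm_closed G" using G_closed by (simp add: G_def)
    show "\<exists>x\<in>lp_space p. lp_norm p x \<le> C * lp_norm p y \<and> y - A x \<in> G" if "y \<in> lp_space p" for y
      using onto[OF that] by (simp add: G_def)
    show "lp_norm p (A x - S t x) \<le> e * lp_norm p x" if x: "x \<in> lp_space p" for x
    proof -
      have "\<bar>1 - t\<bar> * (e * lp_norm p x) \<le> 1 * (e * lp_norm p x)"
        using t e(1) lp_norm_nonneg[of p x] by (intro mult_right_mono) auto
      then show ?thesis using dist[OF x, of 1 t] S1 by (simp add: mult.assoc)
    qed
    show "0 \<le> e" using e(1) by simp
  qed auto
  have "\<exists>x\<in>lp_space p. y - B x \<in> G" if "y \<in> lp_space p" for y
    using ontoS[of 0 y] that S0 by auto
  then obtain N where N: "codim_below {x\<in>lp_space p. B x \<in> G} {0} N"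
    using F.band_dim_preimage[OF B G_def] by blast
  define \<delta> where "\<delta> = 1 / (3 ^ N * real N + 1)"
  have "\<delta> > 0" by (simp add: \<delta>_def add_nonneg_pos)
  have "codim_below {x\<in>lp_space p. S 1 x \<in> G} {0} N"
  proof (rule unit_interval_steps[of "\<lambda>t. codim_below {x\<in>lp_space p. S t x \<in> G} {0} N", OF _ \<open>\<delta> > 0\<close>])
    show "codim_below {x\<in>lp_space p. S 0 x \<in> G} {0} N" using N S0 by simp
    fix s t :: real
    assume st: "0 \<le> s" "s \<le> t" "t \<le> 1" "t - s \<le> \<delta>"
      and cod: "codim_below {x\<in>lp_space p. S s x \<in> G} {0} N"
    show "codim_below {x\<in>lp_space p. S t x \<in> G} {0} N"
    proof (rule L.dim_preimage_stable[OF G GV lS lS ontoS _ _ _ _ cod])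
      show "0 \<le> s" "s \<le> 1" "0 \<le> 2 * C" using st C by auto
      show "lp_norm p (S s x - S t x) \<le> \<bar>s - t\<bar> * e * lp_norm p x" if "x \<in> lp_space p" for x
        by (rule dist[OF that])
      show "0 \<le> \<bar>s - t\<bar> * e" using e(1) by simp
      have "\<bar>s - t\<bar> * (2 * (C * e)) \<le> \<delta> * 1"
        using st e C \<open>\<delta> > 0\<close> by (intro mult_mono) auto
      then have "(3 ^ N * real N) * (\<bar>s - t\<bar> * (2 * (C * e))) \<le> (3 ^ N * real N) * \<delta>"
        by (intro mult_left_mono) auto
      also have "\<dots> < 1" by (simp add: \<delta>_def add_nonneg_pos)
      finally show "3 ^ N * real N * (2 * C * (\<bar>s - t\<bar> * e)) < 1" by (simp add: mult.assoc mult.left_commute)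
    qed
  qed
  then have "codim_below (lp_kernel p A) {0} N"
    by (rule codim_below_mono) (use S1 subspace_0[OF G] in \<open>auto simp: lp_kernel_def\<close>)
  moreover have "subspace (lp_kernel p A)"
  proof -
    have "lp_kernel p A = {x\<in>lp_space p. A x \<in> {0}}" by (auto simp: lp_kernel_def)
    then show ?thesis using subspace_linear_preimage[OF lA L.subspace_V, of "{0}"] by (simp add: subspace_def)
  qed
  ultimately show ?thesis using finite_dim_iff_codim_below by blast
qed

theorem theorem4p3:
  fixes p :: ennreal
    and A :: "(int \<Rightarrow> 'a::banach) \<Rightarrow> (int \<Rightarrow> 'a)"
  assumes "finite_dim (UNIV :: 'a set)"
    and "p = 0 \<or> 1 \<le> p"
    and "band_dominated p A"
    and "semi_Fredholm p A"
  shows "Fredholm p A"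
  using assms(4) unfolding semi_Fredholm_def Fredholm_def
  using Phi_plus_imp_finite_codim[OF assms(1-3)] Phi_minus_imp_finite_dim_kernel[OF assms(1-3)]
  by (auto simp: Phi_plus_def Phi_minus_def)

end
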